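(* Let $G$ be a finitely generated, virtually abelian group of rank $n$. Then $\mathcal{A}_{sn}(G)$ and $\mathcal{J}_{sn}(G)$ are nilpotent of index $n+1$.
   Context: All groups are discrete. For a group $G$, $\ell^1(G)$ is the Banach algebra of absolutely summable functions $G\to\mathbb{C}$ under convolution; $\delta_t$ is the point mass at $t$; $\ell^1(G)^*=\ell^\infty(G)$, and $1$ is the constant function. The bidual $\ell^1(G)^{**}$ carries the first Arens product $\Box$: for a Banach algebra $A$, $\langle \Psi\Box\Phi,\lambda\rangle=\langle\Psi,\Phi\cdot\lambda\rangle$, $\langle a,\Phi\cdot\lambda\rangle=\langle\Phi,\lambda\cdot a\rangle$, $\langle b,\lambda\cdot a\rangle=\langle ab,\lambda\rangle$ ($\Phi,\Psi\in A^{**}$, $\lambda\in A^*$, $a,b\in A$). For $H\le G$, $\ell^1(H)^{**}$ is identified with its image in $\ell^1(G)^{**}$ under the second adjoint of the inclusion $\ell^1(H)\hookrightarrow\ell^1(G)$. An invariant difference on a group $H$ is an element $\Gamma\in\ell^1(H)^{**}$ with $\delta_s\Box\Gamma=\Gamma$ for all $s\in H$ and $\langle\Gamma,1\rangle=0$. $\mathcal{D}(H)$ is the set of invariant differences on $H$. A subgroup $H\le G$ is subnormal if there is a finite chain $H=H_n\lhd H_{n-1}\lhd\cdots\lhd H_1\lhd G$. Define $$\mathcal{A}_{sn}(G)=\operatorname{span}\{\Gamma_1\Box\cdots\Box\Gamma_n : n\in\mathbb{N},\ \Gamma_i\in\mathcal{D}(H_i)\text{ for some subnormal subgroups } H_i\text{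 of }G\},$$ $$\mathcal{J}_{sn}(G)=\operatorname{span}\{\Phi\Box\Gamma:\Phi\in\ell^1(G)^{**},\ \Gamma\in\mathcal{D}(H)\text{ for some subnormal subgroup } H\text{ of } G\}.$$ An algebra $A$ is nilpotent if $A^m=\{0\}$ for some $m\in\mathbb{N}=\{1,2,\dots\}$ (all $m$-fold products vanish); the least such $m$ is the index of nilpotence. The rank of a finitely generated virtually abelian group is the (torsion-free) rank of any finite-index abelian subgroup. *)

theory Defs
  imports
    "HOL-Algebra.Algebra"
    "HOL-Analysis.Analysis"
    "HOL-Library.Function_Algebras"
    "HOL-Library.Extended_Nat"
begin

text \<open>
  Vectors are complex-valued functions; addition and zero on them are the pointwise ones
  of \<^theory>\<open>HOL-Library.Function_Algebras\<close>. A space of functions on a subset of a type is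
  represented by functions vanishing outside that subset, so that equality and linear
  combinations are the ones of the ambient type.
\<close>

definition cscale :: "complex \<Rightarrow> ('x \<Rightarrow> complex) \<Rightarrow> 'x \<Rightarrow> complex" where
  "cscale c f = (\<lambda>x. c * f x)"

lemma vector_space_cscale: "vector_space (cscale :: complex \<Rightarrow> ('x \<Rightarrow> complex) \<Rightarrow> _)"
  by unfold_locales (auto simp: cscale_def algebra_simps fun_eq_iff)

abbreviation cspan :: "('x \<Rightarrow> complex) set \<Rightarrow> ('x \<Rightarrow> complex) set" where
  "cspan \<equiv> module.span cscale"

definition dual_space ::
  "('x \<Rightarrow> complex) set \<Rightarrow> (('x \<Rightarrow> complex) \<Rightarrow> real) \<Rightarrow> (('x \<Rightarrow> complex) \<Rightarrow> complex) set" where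
  "dual_space V N = {\<phi>.
     (\<forall>f\<in>V. \<forall>g\<in>V. \<phi> (f + g) = \<phi> f + \<phi> g) \<and>
     (\<forall>c. \<forall>f\<in>V. \<phi> (cscale c f) = c * \<phi> f) \<and>
     (\<exists>C. \<forall>f\<in>V. norm (\<phi> f) \<le> C * N f) \<and>
     (\<forall>f. f \<notin> V \<longrightarrow> \<phi> f = 0)}"

definition dual_norm ::
  "('x \<Rightarrow> complex) set \<Rightarrow> (('x \<Rightarrow> complex) \<Rightarrow> real) \<Rightarrow> (('x \<Rightarrow> complex) \<Rightarrow> complex) \<Rightarrow> real" where
  "dual_norm V N \<phi> = (SUP f\<in>{f\<in>V. N f \<le> 1}. norm (\<phi> f))"

definition ell1 :: "('a, 'b) monoid_scheme \<Rightarrow> ('a \<Rightarrow> complex) set" where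
  "ell1 G = {f. (\<forall>x. x \<notin> carrier G \<longrightarrow> f x = 0) \<and> (\<lambda>x. norm (f x)) summable_on carrier G}"

definition ell1_norm :: "('a, 'b) monoid_scheme \<Rightarrow> ('a \<Rightarrow> complex) \<Rightarrow> real" where
  "ell1_norm G f = (\<Sum>\<^sub>\<infinity>x\<in>carrier G. norm (f x))"

definition convolution ::
  "('a, 'b) monoid_scheme \<Rightarrow> ('a \<Rightarrow> complex) \<Rightarrow> ('a \<Rightarrow> complex) \<Rightarrow> 'a \<Rightarrow> complex" where
  "convolution G f g = (\<lambda>x. if x \<in> carrier G
     then \<Sum>\<^sub>\<infinity>y\<in>carrier G. f y * g (inv\<^bsub>G\<^esub> y \<otimes>\<^bsub>G\<^esub> x) else 0)"

definition point_mass :: "'a \<Rightarrow> 'a \<Rightarrow> complex" where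
  "point_mass t = (\<lambda>x. if x = t then 1 else 0)"

definition ell1_dual :: "('a, 'b) monoid_scheme \<Rightarrow> (('a \<Rightarrow> complex) \<Rightarrow> complex) set" where
  "ell1_dual G = dual_space (ell1 G) (ell1_norm G)"

definition ell1_bidual ::
  "('a, 'b) monoid_scheme \<Rightarrow> ((('a \<Rightarrow> complex) \<Rightarrow> complex) \<Rightarrow> complex) set" where
  "ell1_bidual G = dual_space (ell1_dual G) (dual_norm (ell1 G) (ell1_norm G))"

text \<open>The functional on \<open>ell1 G\<close> corresponding to a bounded function on \<open>G\<close>.\<close>

definition of_bounded ::
  "('a, 'b) monoid_scheme \<Rightarrow> ('a \<Rightarrow> complex) \<Rightarrow> ('a \<Rightarrow> complex) \<Rightarrow> complex" where
  "of_bounded G h = (\<lambda>f. if f \<in> ell1 G then \<Sum>\<^sub>\<infinity>x\<in>carrier G. f x * h x else 0)"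

definition canonical ::
  "('a, 'b) monoid_scheme \<Rightarrow> ('a \<Rightarrow> complex) \<Rightarrow> (('a \<Rightarrow> complex) \<Rightarrow> complex) \<Rightarrow> complex" where
  "canonical G a = (\<lambda>\<phi>. if \<phi> \<in> ell1_dual G then \<phi> a else 0)"

text \<open>
  The first Arens product on the bidual of \<open>ell1 G\<close>: \<open>dual_act G \<phi> a\<close> is the functional
  \<open>b \<mapsto> \<phi> (a b)\<close>, and \<open>bidual_act G \<Phi> \<phi>\<close> is the functional \<open>a \<mapsto> \<Phi> (dual_act G \<phi> a)\<close>.
\<close>

definition dual_act ::
  "('a, 'b) monoid_scheme \<Rightarrow> (('a \<Rightarrow> complex) \<Rightarrow> complex) \<Rightarrow> ('a \<Rightarrow> complex)
     \<Rightarrow> ('a \<Rightarrow> complex) \<Rightarrow> complex" where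
  "dual_act G \<phi> a = (\<lambda>b. if b \<in> ell1 G then \<phi> (convolution G a b) else 0)"

definition bidual_act ::
  "('a, 'b) monoid_scheme \<Rightarrow> ((('a \<Rightarrow> complex) \<Rightarrow> complex) \<Rightarrow> complex)
     \<Rightarrow> (('a \<Rightarrow> complex) \<Rightarrow> complex) \<Rightarrow> ('a \<Rightarrow> complex) \<Rightarrow> complex" where
  "bidual_act G \<Phi> \<phi> = (\<lambda>a. if a \<in> ell1 G then \<Phi> (dual_act G \<phi> a) else 0)"

definition arens ::
  "('a, 'b) monoid_scheme \<Rightarrow> ((('a \<Rightarrow> complex) \<Rightarrow> complex) \<Rightarrow> complex)
     \<Rightarrow> ((('a \<Rightarrow> complex) \<Rightarrow> complex) \<Rightarrow> complex) \<Rightarrow> (('a \<Rightarrow> complex) \<Rightarrow> complex) \<Rightarrow> complex" where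
  "arens G \<Psi> \<Phi> = (\<lambda>\<phi>. if \<phi> \<in> ell1_dual G then \<Psi> (bidual_act G \<Phi> \<phi>) else 0)"

text \<open>The product of a nonempty list; the Arens product is associative on the bidual.\<close>

definition arens_prod ::
  "('a, 'b) monoid_scheme \<Rightarrow> ((('a \<Rightarrow> complex) \<Rightarrow> complex) \<Rightarrow> complex) list
     \<Rightarrow> (('a \<Rightarrow> complex) \<Rightarrow> complex) \<Rightarrow> complex" where
  "arens_prod G \<Gamma>s = foldr (arens G) (butlast \<Gamma>s) (last \<Gamma>s)"

definition invariant_differences ::
  "('a, 'b) monoid_scheme \<Rightarrow> ((('a \<Rightarrow> complex) \<Rightarrow> complex) \<Rightarrow> complex) set" where
  "invariant_differences H = {\<Gamma> \<in> ell1_bidual H.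
     (\<forall>s\<in>carrier H. arens H (canonical H (point_mass s)) \<Gamma> = \<Gamma>) \<and>
     \<Gamma> (of_bounded H (\<lambda>_. 1)) = 0}"

text \<open>
  For a subgroup \<open>K\<close> of \<open>G\<close>, elements of \<open>ell1\<close> of \<open>K\<close> are already extended by zero, so
  the inclusion into \<open>ell1 G\<close> is the identity, and its adjoint restricts functionals.
\<close>

definition incl_adjoint ::
  "('a, 'b) monoid_scheme \<Rightarrow> 'a set \<Rightarrow> (('a \<Rightarrow> complex) \<Rightarrow> complex)
     \<Rightarrow> ('a \<Rightarrow> complex) \<Rightarrow> complex" where
  "incl_adjoint G K \<phi> = (\<lambda>f. if f \<in> ell1 (G\<lparr>carrier := K\<rparr>) then \<phi> f else 0)"

definition incl_bidual ::
  "('a, 'b) monoid_scheme \<Rightarrow> 'a set \<Rightarrow> ((('a \<Rightarrow> complex) \<Rightarrow> complex) \<Rightarrow> complex)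
     \<Rightarrow> (('a \<Rightarrow> complex) \<Rightarrow> complex) \<Rightarrow> complex" where
  "incl_bidual G K \<Gamma> = (\<lambda>\<phi>. if \<phi> \<in> ell1_dual G then \<Gamma> (incl_adjoint G K \<phi>) else 0)"

definition invariant_differences_in ::
  "('a, 'b) monoid_scheme \<Rightarrow> 'a set \<Rightarrow> ((('a \<Rightarrow> complex) \<Rightarrow> complex) \<Rightarrow> complex) set" where
  "invariant_differences_in G K = incl_bidual G K ` invariant_differences (G\<lparr>carrier := K\<rparr>)"

definition subnormal :: "'a set \<Rightarrow> ('a, 'b) monoid_scheme \<Rightarrow> bool" where
  "subnormal H G \<longleftrightarrow> (\<exists>(m::nat) K. K 0 = carrier G \<and> K m = H \<and>
     (\<forall>i<m. K (Suc i) \<lhd> G\<lparr>carrier := K i\<rparr>))"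

definition A_sn ::
  "('a, 'b) monoid_scheme \<Rightarrow> ((('a \<Rightarrow> complex) \<Rightarrow> complex) \<Rightarrow> complex) set" where
  "A_sn G = cspan {arens_prod G \<Gamma>s | \<Gamma>s. \<Gamma>s \<noteq> [] \<and>
     (\<forall>\<Gamma>\<in>set \<Gamma>s. \<exists>H. subnormal H G \<and> \<Gamma> \<in> invariant_differences_in G H)}"

definition J_sn ::
  "('a, 'b) monoid_scheme \<Rightarrow> ((('a \<Rightarrow> complex) \<Rightarrow> complex) \<Rightarrow> complex) set" where
  "J_sn G = cspan {arens G \<Phi> \<Gamma> | \<Phi> \<Gamma>. \<Phi> \<in> ell1_bidual G \<and>
     (\<exists>H. subnormal H G \<and> \<Gamma> \<in> invariant_differences_in G H)}"

definition products_vanish ::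
  "('a, 'b) monoid_scheme \<Rightarrow> ((('a \<Rightarrow> complex) \<Rightarrow> complex) \<Rightarrow> complex) set \<Rightarrow> nat \<Rightarrow> bool" where
  "products_vanish G A m \<longleftrightarrow> (\<forall>\<Gamma>s. length \<Gamma>s = m \<and> set \<Gamma>s \<subseteq> A \<longrightarrow> arens_prod G \<Gamma>s = 0)"

definition arens_nilpotent ::
  "('a, 'b) monoid_scheme \<Rightarrow> ((('a \<Rightarrow> complex) \<Rightarrow> complex) \<Rightarrow> complex) set \<Rightarrow> bool" where
  "arens_nilpotent G A \<longleftrightarrow> (\<exists>m\<ge>1. products_vanish G A m)"

definition nilpotence_index ::
  "('a, 'b) monoid_scheme \<Rightarrow> ((('a \<Rightarrow> complex) \<Rightarrow> complex) \<Rightarrow> complex) set \<Rightarrow> nat" where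
  "nilpotence_index G A = (LEAST m. m \<ge> 1 \<and> products_vanish G A m)"

definition finitely_generated_group :: "('a, 'b) monoid_scheme \<Rightarrow> bool" where
  "finitely_generated_group G \<longleftrightarrow>
     (\<exists>S. finite S \<and> S \<subseteq> carrier G \<and> generate G S = carrier G)"

definition finite_index_abelian :: "'a set \<Rightarrow> ('a, 'b) monoid_scheme \<Rightarrow> bool" where
  "finite_index_abelian K G \<longleftrightarrow>
     subgroup K G \<and> finite (rcosets\<^bsub>G\<^esub> K) \<and> comm_group (G\<lparr>carrier := K\<rparr>)"

definition virtually_abelian :: "('a, 'b) monoid_scheme \<Rightarrow> bool" where
  "virtually_abelian G \<longleftrightarrow> (\<exists>K. finite_index_abelian K G)"

definition int_independent :: "('a, 'b) monoid_scheme \<Rightarrow> 'a set \<Rightarrow> bool" where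
  "int_independent K S \<longleftrightarrow> finite S \<and> S \<subseteq> carrier K \<and>
     (\<forall>k :: 'a \<Rightarrow> int. finprod K (\<lambda>s. s [^]\<^bsub>K\<^esub> k s) S = \<one>\<^bsub>K\<^esub> \<longrightarrow> (\<forall>s\<in>S. k s = 0))"

text \<open>Torsion-free rank of an abelian group (only meaningful for commutative \<open>K\<close>).\<close>

definition torsion_free_rank :: "('a, 'b) monoid_scheme \<Rightarrow> enat" where
  "torsion_free_rank K = (SUP S\<in>{S. int_independent K S}. enat (card S))"

text \<open>
  Finite-index abelian subgroups of \<open>G\<close> all have the same torsion-free rank, so it does
  not matter which one witnesses the rank.
\<close>

definition virtually_abelian_rank :: "('a, 'b) monoid_scheme \<Rightarrow> nat \<Rightarrow> bool" where
  "virtually_abelian_rank G n \<longleftrightarrow>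
     (\<exists>K. finite_index_abelian K G \<and> torsion_free_rank (G\<lparr>carrier := K\<rparr>) = enat n)"

end

theory Submission imports Defs begin

text \<open>
  The dual of \<open>\<ell>\<^sup>1(G)\<close> is \<open>\<ell>\<^sup>\<infinity>(G)\<close>, on which \<open>\<Phi>\<close> in the bidual acts by
  \<open>(\<Phi> \<cdot> f)(x) = \<langle>\<Phi>, f(x _)\<rangle>\<close>. Let \<open>N\<close> be a normal abelian subgroup of finite index, and consider
  the span of the bounded functions that are right invariant under some \<open>r\<close> independent elements
  of \<open>N\<close>. Splitting \<open>\<Phi>\<close> along the cosets of \<open>N\<close> shows that this span is preserved by every \<open>\<Phi>\<close>: the
  piece on the coset of \<open>g\<close> replaces the independent elements by their conjugates under \<open>g\<close>. An
  invariant difference \<open>\<Gamma>\<close> on \<open>H\<close> even maps it to the span for \<open>r + 1\<close>: the pieces of \<open>\<Gamma> \<cdot> f\<close> are also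
  invariant under \<open>H \<inter> N\<close>, which supplies a further independent element unless the right stabiliser
  of \<open>f\<close> has finite index in \<open>H\<close>, and in that case \<open>\<Gamma> \<cdot> f = 0\<close> because \<open>\<Gamma>\<close> takes equal values on the
  indicators of the cosets of the stabiliser and vanishes on \<open>1\<close>. Since \<open>N\<close> has rank \<open>n\<close>, products of
  \<open>n + 1\<close> factors vanish.

  Conversely, for independent \<open>x\<^sub>1, \<dots>, x\<^sub>m\<close> in \<open>N\<close> let \<open>\<Gamma>\<^sub>i\<close> be the difference of an invariant mean on
  \<open>\<langle>x\<^sub>i\<rangle>\<close> concentrated at \<open>+\<infinity>\<close> and one concentrated at \<open>-\<infinity>\<close>. The product of the \<open>\<Gamma>\<^sub>i\<close> takes the
  value 1 at the indicator function of the products of nonnegative powers of the \<open>x\<^sub>i\<close>.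
\<close>

section \<open>Functionals on the summable functions\<close>

text \<open>Different cosets of \<open>N\<close> conjugate an independent tuple differently, so the
  image of a function fixed by one tuple need not be fixed by any single tuple. This forces the
  filtration to consist of spans whose summands each have their own tuple. Finite index keeps the
  number of pieces finite, normality keeps the conjugates in \<open>N\<close>, and commutativity
  makes the conjugated tuple the same for all elements of one coset. For an invariant difference on
  H and a function with right stabiliser P, the alternative is whether some element of H \<inter> N
  has no positive power in P. If so, that element is automatically independent of those already in
  P. If not, the quotient of H \<inter> N by H \<inter> N \<inter> P is a torsion group, and it is
  finite because N is a finitely generated abelian group; so H \<inter> P has finite index in H. For
  the lower bound, factors are needed that vanish on constants but not on the indicator of a
  half-line. Means at the two ends of the integers agree on constants and differ by 1 on a
  half-line, so each factor strips one coordinate off the indicator of an orthant.\<close>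

no_notation Infinite_Set_Sum.abs_summable_on (infix "abs'_summable'_on" 50)

interpretation cmod: vector_space "cscale :: complex \<Rightarrow> ('x \<Rightarrow> complex) \<Rightarrow> _"
  by (rule vector_space_cscale)

lemma ell1I:
  assumes "\<And>x. x \<notin> carrier G \<Longrightarrow> f x = 0" "f abs_summable_on carrier G"
  shows "f \<in> ell1 G"
  using assms by (auto simp: ell1_def)

lemma ell1_abs_summable: "f \<in> ell1 G \<Longrightarrow> f abs_summable_on carrier G"
  by (auto simp: ell1_def)

lemma ell1_zero_outside: "f \<in> ell1 G \<Longrightarrow> x \<notin> carrier G \<Longrightarrow> f x = 0"
  by (auto simp: ell1_def)

lemma ell1_norm_nonneg: "ell1_norm G f \<ge> 0"
  unfolding ell1_norm_def by (rule infsum_nonneg) auto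

lemma ell1_0 [simp]: "0 \<in> ell1 G"
  by (rule ell1I) auto

lemma ell1_norm_0 [simp]: "ell1_norm G 0 = 0"
  by (simp add: ell1_norm_def)

lemma ell1_add:
  assumes "f \<in> ell1 G" "g \<in> ell1 G"
  shows "f + g \<in> ell1 G"
proof (rule ell1I)
  have "(\<lambda>x. norm (f x) + norm (g x)) summable_on carrier G"
    using assms by (intro summable_on_add ell1_abs_summable)
  then show "(f + g) abs_summable_on carrier G"
    by (rule summable_on_comparison_test) (auto intro: norm_triangle_ineq)
qed (use assms in \<open>auto simp: ell1_zero_outside\<close>)

lemma ell1_cscale:
  assumes "f \<in> ell1 G"
  shows "cscale c f \<in> ell1 G"
proof (rule ell1I)
  show "cscale c f abs_summable_on carrier G"
    using ell1_abs_summable[OF assms]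
    by (auto simp: cscale_def norm_mult intro: summable_on_cmult_right)
qed (use assms in \<open>auto simp: ell1_zero_outside cscale_def\<close>)

lemma point_mass_ell1 [simp]:
  assumes "t \<in> carrier G"
  shows "point_mass t \<in> ell1 G"
proof (rule ell1I)
  show "point_mass t abs_summable_on carrier G"
    by (rule summable_on_cong_neutral[THEN iffD1, OF _ _ _
      summable_on_finite[of "{t}" "\<lambda>x. norm (point_mass t x)"]])
      (use assms in \<open>auto simp: point_mass_def\<close>)
qed (use assms in \<open>auto simp: point_mass_def\<close>)

lemma infsum_point_mass:
  assumes "t \<in> carrier G"
  shows "(\<Sum>\<^sub>\<infinity>x\<in>carrier G. point_mass t x * h x) = h t"
  using infsum_cong_neutral[of "{t}" "carrier G" "\<lambda>x. h x" "\<lambda>x. point_mass t x * h x"] assms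
  by (auto simp: point_mass_def)

lemma ell1_norm_point_mass:
  assumes "t \<in> carrier G"
  shows "ell1_norm G (point_mass t) = 1"
  using infsum_cong_neutral[of "{t}" "carrier G" "\<lambda>x. 1" "\<lambda>x. norm (point_mass t x)"] assms
  by (auto simp: point_mass_def ell1_norm_def)

section \<open>Bounded functionals and their description by bounded functions\<close>

lemma dual_spaceI:
  assumes "\<And>f g. f \<in> V \<Longrightarrow> g \<in> V \<Longrightarrow> \<phi> (f + g) = \<phi> f + \<phi> g"
    "\<And>c f. f \<in> V \<Longrightarrow> \<phi> (cscale c f) = c * \<phi> f"
    "\<And>f. f \<in> V \<Longrightarrow> norm (\<phi> f) \<le> C * N f"
    "\<And>f. f \<notin> V \<Longrightarrow> \<phi> f = 0"
  shows "\<phi> \<in> dual_space V N"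
  using assms unfolding dual_space_def by blast

lemma dual_spaceD:
  assumes "\<phi> \<in> dual_space V N"
  shows "f \<in> V \<Longrightarrow> g \<in> V \<Longrightarrow> \<phi> (f + g) = \<phi> f + \<phi> g"
    "f \<in> V \<Longrightarrow> \<phi> (cscale c f) = c * \<phi> f"
    "f \<notin> V \<Longrightarrow> \<phi> f = 0"
  using assms unfolding dual_space_def by auto

lemma dual_space_bound:
  assumes "\<phi> \<in> dual_space V N" "\<And>f. N f \<ge> 0"
  obtains C where "C \<ge> 0" "\<And>f. f \<in> V \<Longrightarrow> norm (\<phi> f) \<le> C * N f"
proof -
  obtain C where C: "\<And>f. f \<in> V \<Longrightarrow> norm (\<phi> f) \<le> C * N f"
    using assms(1) unfolding dual_space_def by blast
  have "norm (\<phi> f) \<le> max C 0 * N f" if "f \<in> V" for f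
    using C[OF that] mult_right_mono[OF max.cobounded1[of C 0] assms(2)] by (rule order_trans)
  then show ?thesis by (intro that[of "max C 0"]) auto
qed

lemma bounded_image_iff: "bounded (h ` A) \<longleftrightarrow> (\<exists>M. \<forall>x\<in>A. norm (h x) \<le> M)"
  by (auto simp: bounded_iff)

lemma bounded_obtain:
  assumes "bounded (h ` A)"
  obtains M where "M \<ge> 0" "\<And>x. x \<in> A \<Longrightarrow> norm (h x) \<le> M"
proof -
  obtain M where "\<And>x. x \<in> A \<Longrightarrow> norm (h x) \<le> M"
    using assms by (auto simp: bounded_iff)
  then show ?thesis by (intro that[of "max M 0"]) (auto simp: le_max_iff_disj)
qed

lemma bounded_image_plus: "bounded (f ` A) \<Longrightarrow> bounded (g ` A) \<Longrightarrow> bounded ((f + g) ` A)"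
  for f g :: "'x \<Rightarrow> complex"
  unfolding plus_fun_def by (rule bounded_plus_comp)

lemma bounded_image_cscale:
  assumes "bounded (f ` A)"
  shows "bounded (cscale c f ` A)"
proof -
  obtain M where "\<And>x. x \<in> A \<Longrightarrow> norm (f x) \<le> M"
    using bounded_obtain[OF assms] by metis
  then show ?thesis
    unfolding bounded_image_iff
    by (intro exI[of _ "norm c * M"]) (auto simp: cscale_def norm_mult mult_left_mono)
qed

lemma bounded_mult_summable:
  fixes h f :: "'x \<Rightarrow> complex"
  assumes "\<And>x. x \<in> A \<Longrightarrow> norm (h x) \<le> M" "f abs_summable_on A"
  shows "(\<lambda>x. f x * h x) abs_summable_on A"
proof -
  have "(\<lambda>x. norm (f x) * M) summable_on A"
    using assms(2) by (rule summable_on_cmult_left)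
  then show ?thesis
    by (rule summable_on_comparison_test) (use assms(1) in \<open>auto simp: norm_mult mult_left_mono\<close>)
qed

lemma of_bounded_bound:
  assumes "\<And>x. x \<in> carrier G \<Longrightarrow> norm (h x) \<le> M" "f \<in> ell1 G"
  shows "norm (of_bounded G h f) \<le> M * ell1_norm G f"
proof -
  have s: "(\<lambda>x. f x * h x) abs_summable_on carrier G"
    using bounded_mult_summable[OF assms(1) ell1_abs_summable[OF assms(2)]] by auto
  have "norm (of_bounded G h f) \<le> (\<Sum>\<^sub>\<infinity>x\<in>carrier G. norm (f x * h x))"
    using assms(2) norm_infsum_bound[OF s] by (simp add: of_bounded_def)
  also have "\<dots> \<le> (\<Sum>\<^sub>\<infinity>x\<in>carrier G. norm (f x) * M)"
    by (rule infsum_mono)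
      (use s assms in \<open>auto simp: norm_mult mult_left_mono intro: summable_on_cmult_left ell1_abs_summable\<close>)
  also have "\<dots> = M * ell1_norm G f"
    by (subst infsum_cmult_left') (simp add: ell1_norm_def mult.commute)
  finally show ?thesis .
qed

lemma of_bounded_dual:
  assumes "bounded (h ` carrier G)"
  shows "of_bounded G h \<in> ell1_dual G"
proof -
  obtain M where M: "\<And>x. x \<in> carrier G \<Longrightarrow> norm (h x) \<le> M"
    using bounded_obtain[OF assms] by metis
  have s: "(\<lambda>x. f x * h x) summable_on carrier G" if "f \<in> ell1 G" for f
    using abs_summable_summable[OF bounded_mult_summable[OF M ell1_abs_summable[OF that]]] .
  show ?thesis unfolding ell1_dual_def
  proof (rule dual_spaceI[where C=M])
    fix f g assume "f \<in> ell1 G" "g \<in> ell1 G"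
    then show "of_bounded G h (f + g) = of_bounded G h f + of_bounded G h g"
      using s by (simp add: of_bounded_def ell1_add distrib_right infsum_add)
  next
    fix c f assume "f \<in> ell1 G"
    then show "of_bounded G h (cscale c f) = c * of_bounded G h f"
      by (simp add: of_bounded_def ell1_cscale) (simp add: cscale_def mult.assoc infsum_cmult_right')
  next
    fix f assume "f \<in> ell1 G"
    then show "norm (of_bounded G h f) \<le> M * ell1_norm G f"
      using of_bounded_bound[of G h M] M by blast
  qed (auto simp: of_bounded_def)
qed

lemma of_bounded_point_mass: "x \<in> carrier G \<Longrightarrow> of_bounded G h (point_mass x) = h x"
  by (simp add: of_bounded_def infsum_point_mass)

lemma of_bounded_cong:
  assumes "\<And>x. x \<in> carrier G \<Longrightarrow> g x = h x"
  shows "of_bounded G g = of_bounded G h"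
  using assms unfolding of_bounded_def by (auto simp: fun_eq_iff intro!: infsum_cong)

lemma dual_point_mass_bounded:
  assumes "\<phi> \<in> ell1_dual G"
  shows "bounded ((\<lambda>x. \<phi> (point_mass x)) ` carrier G)"
proof -
  obtain C where "\<And>f. f \<in> ell1 G \<Longrightarrow> norm (\<phi> f) \<le> C * ell1_norm G f"
    using dual_space_bound[OF assms[unfolded ell1_dual_def] ell1_norm_nonneg] by metis
  then have "norm (\<phi> (point_mass x)) \<le> C" if "x \<in> carrier G" for x
    using that point_mass_ell1[OF that] ell1_norm_point_mass[OF that] by fastforce
  then show ?thesis by (auto simp: bounded_iff)
qed

text \<open>Deleting a finite set F from f leaves a tail whose norm tends to 0 as F grows. By
  boundedness the value of \<open>\<phi>\<close> at the tail tends to 0, and only its values at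
  point masses remain. This identifies the dual with the bounded functions.\<close>

lemma dual_eq_of_bounded:
  assumes "\<phi> \<in> ell1_dual G"
  shows "\<phi> = of_bounded G (\<lambda>x. \<phi> (point_mass x))"
proof
  fix f
  have \<phi>: "\<phi> \<in> dual_space (ell1 G) (ell1_norm G)"
    using assms by (simp add: ell1_dual_def)
  note D = dual_spaceD[OF \<phi>]
  obtain C where C0: "C \<ge> 0" and C: "\<And>f. f \<in> ell1 G \<Longrightarrow> norm (\<phi> f) \<le> C * ell1_norm G f"
    using dual_space_bound[OF \<phi> ell1_norm_nonneg] by metis
  show "\<phi> f = of_bounded G (\<lambda>x. \<phi> (point_mass x)) f"
  proof (cases "f \<in> ell1 G")
    case False
    then show ?thesis using D(3) by (simp add: of_bounded_def)
  next
    case f: True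
    define r where "r F = (\<lambda>x. if x \<in> F then 0 else f x)" for F
    have r: "r F \<in> ell1 G" for F
    proof (rule ell1I)
      show "r F abs_summable_on carrier G"
        by (rule Infinite_Sum.abs_summable_on_comparison_test[OF ell1_abs_summable[OF f]]) (auto simp: r_def)
    qed (use f ell1_zero_outside in \<open>auto simp: r_def\<close>)
    have dec: "\<phi> f = (\<Sum>x\<in>F. f x * \<phi> (point_mass x)) + \<phi> (r F)"
      if "finite F" "F \<subseteq> carrier G" for F
      using that
    proof (induction F)
      case empty
      have "r {} = f" by (auto simp: r_def)
      then show ?case by simp
    next
      case (insert y F)
      have "r F = cscale (f y) (point_mass y) + r (insert y F)"
        using insert by (auto simp: r_def cscale_def point_mass_def fun_eq_iff)
      then have "\<phi> (r F) = f y * \<phi> (point_mass y) + \<phi> (r (insert y F))"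
        using D(1)[of "cscale (f y) (point_mass y)" "r (insert y F)"] D(2)[of "point_mass y"] r insert
        by (simp add: ell1_cscale)
      then show ?case using insert by simp
    qed
    have nr: "ell1_norm G (r F) = ell1_norm G f - (\<Sum>x\<in>F. norm (f x))"
      if "finite F" "F \<subseteq> carrier G" for F
    proof -
      have "ell1_norm G (r F) = (\<Sum>\<^sub>\<infinity>x\<in>carrier G - F. norm (f x))"
        unfolding ell1_norm_def by (rule infsum_cong_neutral) (auto simp: r_def)
      also have "\<dots> = ell1_norm G f - (\<Sum>\<^sub>\<infinity>x\<in>F. norm (f x))"
        unfolding ell1_norm_def
        by (rule infsum_Diff) (use f that ell1_abs_summable in auto)
      finally show ?thesis using that by simp
    qed
    have lim: "((\<lambda>F. C * (ell1_norm G f - (\<Sum>x\<in>F. norm (f x)))) \<longlongrightarrow> 0) (finite_subsets_at_top (carrier G))"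
      using tendsto_mult[OF tendsto_const tendsto_diff[OF tendsto_const infsum_tendsto[OF ell1_abs_summable[OF f]]], of C "ell1_norm G f"]
      by (simp add: ell1_norm_def)
    have "((\<lambda>F. (\<Sum>x\<in>F. f x * \<phi> (point_mass x)) - \<phi> f) \<longlongrightarrow> 0) (finite_subsets_at_top (carrier G))"
    proof (rule tendsto_0_le[OF lim, of _ 1])
      show "\<forall>\<^sub>F F in finite_subsets_at_top (carrier G). norm ((\<Sum>x\<in>F. f x * \<phi> (point_mass x)) - \<phi> f)
          \<le> norm (C * (ell1_norm G f - (\<Sum>x\<in>F. norm (f x)))) * 1"
      proof (rule eventually_finite_subsets_at_top_weakI)
        fix F assume F: "finite F" "F \<subseteq> carrier G"
        have "norm ((\<Sum>x\<in>F. f x * \<phi> (point_mass x)) - \<phi> f) = norm (\<phi> (r F))"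
          using dec[OF F] by (simp add: norm_minus_commute)
        also have "\<dots> \<le> C * ell1_norm G (r F)"
          by (rule C[OF r])
        also have "\<dots> = C * (ell1_norm G f - (\<Sum>x\<in>F. norm (f x)))"
          by (simp add: nr[OF F])
        also have "\<dots> \<le> norm (C * (ell1_norm G f - (\<Sum>x\<in>F. norm (f x)))) * 1"
          by simp
        finally show "norm ((\<Sum>x\<in>F. f x * \<phi> (point_mass x)) - \<phi> f)
          \<le> norm (C * (ell1_norm G f - (\<Sum>x\<in>F. norm (f x)))) * 1" .
      qed
    qed
    then have "((\<lambda>x. f x * \<phi> (point_mass x)) has_sum \<phi> f) (carrier G)"
      unfolding has_sum_def by (simp add: LIM_zero_iff)
    then show ?thesis using f by (simp add: of_bounded_def infsumI)
  qed
qed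

lemma dual_norm_bdd:
  assumes "\<phi> \<in> ell1_dual G"
  shows "bdd_above ((\<lambda>f. norm (\<phi> f)) ` {f \<in> ell1 G. ell1_norm G f \<le> 1})"
proof -
  obtain C where C: "C \<ge> 0" "\<And>f. f \<in> ell1 G \<Longrightarrow> norm (\<phi> f) \<le> C * ell1_norm G f"
    using dual_space_bound[OF assms[unfolded ell1_dual_def] ell1_norm_nonneg] by metis
  have "norm (\<phi> f) \<le> C" if "f \<in> ell1 G" "ell1_norm G f \<le> 1" for f
    using C(2)[OF that(1)] mult_left_mono[OF that(2) C(1)] by simp
  then show ?thesis by (intro bdd_aboveI2[of _ _ C]) auto
qed

lemma dual_norm_upper:
  assumes "\<phi> \<in> ell1_dual G" "f \<in> ell1 G" "ell1_norm G f \<le> 1"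
  shows "norm (\<phi> f) \<le> dual_norm (ell1 G) (ell1_norm G) \<phi>"
  unfolding dual_norm_def using assms by (intro cSUP_upper dual_norm_bdd) auto

lemma dual_norm_le:
  assumes "\<And>f. f \<in> ell1 G \<Longrightarrow> norm (\<phi> f) \<le> M * ell1_norm G f" "M \<ge> 0"
  shows "dual_norm (ell1 G) (ell1_norm G) \<phi> \<le> M"
  unfolding dual_norm_def
proof (rule cSUP_least)
  show "{f \<in> ell1 G. ell1_norm G f \<le> 1} \<noteq> {}"
    using ell1_0 ell1_norm_0 by (auto intro!: exI[of _ 0])
  fix f assume f: "f \<in> {f \<in> ell1 G. ell1_norm G f \<le> 1}"
  then have "norm (\<phi> f) \<le> M * ell1_norm G f" using assms by auto
  also have "\<dots> \<le> M" using f assms(2) by (simp add: mult_left_le)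
  finally show "norm (\<phi> f) \<le> M" .
qed

lemma dual_norm_nonneg:
  assumes "\<phi> \<in> ell1_dual G"
  shows "dual_norm (ell1 G) (ell1_norm G) \<phi> \<ge> 0"
  by (rule order_trans[OF norm_ge_zero dual_norm_upper[OF assms ell1_0]]) simp

text \<open>Point masses have norm 1, so the dual norm dominates the representing function; the
  bound then follows without normalising \<open>f\<close>.\<close>

lemma dual_norm_mult:
  assumes "\<phi> \<in> ell1_dual G" "f \<in> ell1 G"
  shows "norm (\<phi> f) \<le> dual_norm (ell1 G) (ell1_norm G) \<phi> * ell1_norm G f"
proof -
  obtain M where M: "M \<ge> 0" "\<And>x. x \<in> carrier G \<Longrightarrow> norm (\<phi> (point_mass x)) \<le> M"
    using bounded_obtain[OF dual_point_mass_bounded[OF assms(1)]] by metis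
  have "norm (\<phi> (point_mass x)) \<le> dual_norm (ell1 G) (ell1_norm G) \<phi>" if "x \<in> carrier G" for x
    by (rule dual_norm_upper[OF assms(1)]) (use that in \<open>auto simp: ell1_norm_point_mass[OF that]\<close>)
  then show ?thesis
    by (subst dual_eq_of_bounded[OF assms(1)]) (rule of_bounded_bound[OF _ assms(2)])
qed

lemma ell1_dual_linear:
  assumes "\<phi> \<in> ell1_dual G"
  shows "f \<in> ell1 G \<Longrightarrow> g \<in> ell1 G \<Longrightarrow> \<phi> (f + g) = \<phi> f + \<phi> g"
    "f \<in> ell1 G \<Longrightarrow> \<phi> (cscale c f) = c * \<phi> f"
    "f \<notin> ell1 G \<Longrightarrow> \<phi> f = 0"
  using dual_spaceD assms unfolding ell1_dual_def by blast+

lemma cscale_apply: "cscale c f x = c * f x"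
  by (simp add: cscale_def)

section \<open>Convolution and the Arens product\<close>

text \<open>The bijection (x, y) -> (y, y^-1 x) turns the double sum into that of norm (f y) * norm
  (g z), which factors.\<close>

lemma (in group) convolution_pair_summable:
  assumes "f \<in> ell1 G" "g \<in> ell1 G"
  shows "(\<lambda>(x, y). norm (f y * g (inv y \<otimes> x))) summable_on carrier G \<times> carrier G" (is ?S)
    and "(\<Sum>\<^sub>\<infinity>(x, y)\<in>carrier G \<times> carrier G. norm (f y * g (inv y \<otimes> x))) = ell1_norm G f * ell1_norm G g" (is ?E)
proof -
  note sf = ell1_abs_summable[OF assms(1)] and sg = ell1_abs_summable[OF assms(2)]
  let ?P = "\<lambda>(y, z). norm (f y) * norm (g z)"
  let ?A = "carrier G \<times> carrier G"
  have P: "?P summable_on ?A"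
  proof (rule summable_on_SigmaI)
    show "((\<lambda>z. case (y, z) of (y, z) \<Rightarrow> norm (f y) * norm (g z))
      has_sum norm (f y) * ell1_norm G g) (carrier G)" for y
      unfolding ell1_norm_def using has_sum_cmult_right[OF has_sum_infsum[OF sg]] by simp
    show "(\<lambda>y. norm (f y) * ell1_norm G g) summable_on carrier G"
      by (rule summable_on_cmult_left[OF sf])
  qed auto
  have PE: "infsum ?P ?A = ell1_norm G f * ell1_norm G g"
    by (subst infsum_Sigma'_banach[OF P, symmetric])
      (simp add: ell1_norm_def infsum_cmult_right' infsum_cmult_left')
  have bij: "bij_betw (\<lambda>(x, y). (y, inv y \<otimes> x)) ?A ?A"
    by (rule bij_betwI[of _ _ _ "\<lambda>(y, z). (y \<otimes> z, y)"]) (auto simp: m_assoc[symmetric])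
  have eq: "(\<lambda>p. ?P ((\<lambda>(x, y). (y, inv y \<otimes> x)) p)) = (\<lambda>(x, y). norm (f y * g (inv y \<otimes> x)))"
    by (auto simp: norm_mult fun_eq_iff)
  show ?S using summable_on_reindex_bij_betw[OF bij, of ?P] P unfolding eq by simp
  show ?E using infsum_reindex_bij_betw[OF bij, of ?P] PE unfolding eq by simp
qed

lemma (in group) convolution_summable:
  assumes "f \<in> ell1 G" "g \<in> ell1 G" "x \<in> carrier G"
  shows "(\<lambda>y. norm (f y * g (inv y \<otimes> x))) summable_on carrier G"
proof -
  have "(\<lambda>(x, y). f y * g (inv y \<otimes> x)) abs_summable_on Sigma (carrier G) (\<lambda>_. carrier G)"
    using convolution_pair_summable(1)[OF assms(1,2)] by (simp add: case_prod_unfold)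
  then show ?thesis using assms(3) unfolding Infinite_Sum.abs_summable_on_Sigma_iff by auto
qed

lemma (in group) convolution_ell1_and_norm:
  assumes "f \<in> ell1 G" "g \<in> ell1 G"
  shows "convolution G f g \<in> ell1 G"
    and "ell1_norm G (convolution G f g) \<le> ell1_norm G f * ell1_norm G g"
proof -
  let ?q = "\<lambda>x. \<Sum>\<^sub>\<infinity>y\<in>carrier G. norm (f y * g (inv y \<otimes> x))"
  note S = convolution_pair_summable(1)[OF assms]
  have q: "?q summable_on carrier G"
    using summable_on_Sigma_banach[OF S] by simp
  have le: "norm (convolution G f g x) \<le> ?q x" if "x \<in> carrier G" for x
    using norm_infsum_bound[OF convolution_summable[OF assms that]] that by (simp add: convolution_def)
  have s: "convolution G f g abs_summable_on carrier G"
    by (rule summable_on_comparison_test[OF q]) (use le in auto)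
  then show "convolution G f g \<in> ell1 G"
    by (intro ell1I) (auto simp: convolution_def)
  have "ell1_norm G (convolution G f g) \<le> infsum ?q (carrier G)"
    unfolding ell1_norm_def by (rule infsum_mono[OF s q le])
  also have "\<dots> = ell1_norm G f * ell1_norm G g"
    using infsum_Sigma'_banach[OF S] convolution_pair_summable(2)[OF assms] by simp
  finally show "ell1_norm G (convolution G f g) \<le> ell1_norm G f * ell1_norm G g" .
qed

lemma (in group) convolution_add_right:
  assumes "f \<in> ell1 G" "g \<in> ell1 G" "h \<in> ell1 G"
  shows "convolution G f (g + h) = convolution G f g + convolution G f h"
  using abs_summable_summable[OF convolution_summable[OF assms(1,2)]]
    abs_summable_summable[OF convolution_summable[OF assms(1,3)]]
  by (auto simp: convolution_def fun_eq_iff distrib_left infsum_add)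

lemma (in group) convolution_add_left:
  assumes "f \<in> ell1 G" "g \<in> ell1 G" "h \<in> ell1 G"
  shows "convolution G (f + g) h = convolution G f h + convolution G g h"
  using abs_summable_summable[OF convolution_summable[OF assms(1,3)]]
    abs_summable_summable[OF convolution_summable[OF assms(2,3)]]
  by (auto simp: convolution_def fun_eq_iff distrib_right infsum_add)

lemma convolution_cscale_right: "convolution G f (cscale c g) = cscale c (convolution G f g)"
  by (auto simp: convolution_def cscale_def fun_eq_iff mult.left_commute[of _ c] infsum_cmult_right')

lemma convolution_cscale_left: "convolution G (cscale c f) g = cscale c (convolution G f g)"
  by (auto simp: convolution_def cscale_def fun_eq_iff mult.assoc infsum_cmult_right')

lemma (in group) convolution_point_mass:
  assumes "s \<in> carrier G" "t \<in> carrier G"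
  shows "convolution G (point_mass s) (point_mass t) = point_mass (s \<otimes> t)"
proof
  fix x
  have "inv s \<otimes> x = t \<longleftrightarrow> x = s \<otimes> t" if "x \<in> carrier G"
    using that assms inv_solve_left by metis
  then show "convolution G (point_mass s) (point_mass t) x = point_mass (s \<otimes> t) x"
    using assms by (auto simp: convolution_def infsum_point_mass) (auto simp: point_mass_def)
qed

lemma (in group) dual_act_dual:
  assumes "\<phi> \<in> ell1_dual G" "a \<in> ell1 G"
  shows "dual_act G \<phi> a \<in> ell1_dual G"
    and "dual_norm (ell1 G) (ell1_norm G) (dual_act G \<phi> a)
      \<le> dual_norm (ell1 G) (ell1_norm G) \<phi> * ell1_norm G a"
proof -
  note C = convolution_ell1_and_norm[OF assms(2)]
  let ?M = "dual_norm (ell1 G) (ell1_norm G) \<phi> * ell1_norm G a"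
  have le: "norm (dual_act G \<phi> a f) \<le> ?M * ell1_norm G f" if f: "f \<in> ell1 G" for f
  proof -
    have "norm (dual_act G \<phi> a f) \<le> dual_norm (ell1 G) (ell1_norm G) \<phi> * ell1_norm G (convolution G a f)"
      using dual_norm_mult[OF assms(1) C(1)[OF f]] f by (simp add: dual_act_def)
    also have "\<dots> \<le> ?M * ell1_norm G f"
      using mult_left_mono[OF C(2)[OF f] dual_norm_nonneg[OF assms(1)]] by (simp add: mult.assoc)
    finally show ?thesis .
  qed
  show "dual_act G \<phi> a \<in> ell1_dual G"
    unfolding ell1_dual_def
  proof (rule dual_spaceI[where C="?M"])
    show "dual_act G \<phi> a (f + g) = dual_act G \<phi> a f + dual_act G \<phi> a g"
      if "f \<in> ell1 G" "g \<in> ell1 G" for f g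
      using that assms by (simp add: dual_act_def ell1_add convolution_add_right ell1_dual_linear C)
    show "dual_act G \<phi> a (cscale c f) = c * dual_act G \<phi> a f" if "f \<in> ell1 G" for c f
      using that assms by (simp add: dual_act_def ell1_cscale convolution_cscale_right ell1_dual_linear C)
    show "norm (dual_act G \<phi> a f) \<le> ?M * ell1_norm G f" if "f \<in> ell1 G" for f
      using le that .
  qed (simp add: dual_act_def)
  show "dual_norm (ell1 G) (ell1_norm G) (dual_act G \<phi> a) \<le> ?M"
    by (rule dual_norm_le[OF le]) (auto intro: mult_nonneg_nonneg dual_norm_nonneg assms ell1_norm_nonneg)
qed

lemma ell1_bidual_linear:
  assumes "\<Phi> \<in> ell1_bidual G"
  shows "\<phi> \<in> ell1_dual G \<Longrightarrow> \<psi> \<in> ell1_dual G \<Longrightarrow> \<Phi> (\<phi> + \<psi>) = \<Phi> \<phi> + \<Phi> \<psi>"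
    "\<phi> \<in> ell1_dual G \<Longrightarrow> \<Phi> (cscale c \<phi>) = c * \<Phi> \<phi>"
    "\<phi> \<notin> ell1_dual G \<Longrightarrow> \<Phi> \<phi> = 0"
  using dual_spaceD assms unfolding ell1_bidual_def by blast+

lemma ell1_bidual_bound:
  assumes "\<Phi> \<in> ell1_bidual G"
  obtains C where "C \<ge> 0"
    "\<And>\<phi>. \<phi> \<in> ell1_dual G \<Longrightarrow> norm (\<Phi> \<phi>) \<le> C * dual_norm (ell1 G) (ell1_norm G) \<phi>"
proof -
  obtain C where C: "\<And>\<phi>. \<phi> \<in> ell1_dual G \<Longrightarrow> norm (\<Phi> \<phi>) \<le> C * dual_norm (ell1 G) (ell1_norm G) \<phi>"
    using assms unfolding ell1_bidual_def dual_space_def by blast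
  have "norm (\<Phi> \<phi>) \<le> max C 0 * dual_norm (ell1 G) (ell1_norm G) \<phi>" if "\<phi> \<in> ell1_dual G" for \<phi>
    using C[OF that] mult_right_mono[OF max.cobounded1[of C 0] dual_norm_nonneg[OF that]]
      by (rule order_trans)
  then show ?thesis by (intro that[of "max C 0"]) auto
qed

lemma (in group) bidual_act_dual:
  assumes "\<Phi> \<in> ell1_bidual G" "\<phi> \<in> ell1_dual G"
  shows "bidual_act G \<Phi> \<phi> \<in> ell1_dual G"
proof -
  obtain C where C0: "C \<ge> 0"
    and C: "\<And>\<phi>. \<phi> \<in> ell1_dual G \<Longrightarrow> norm (\<Phi> \<phi>) \<le> C * dual_norm (ell1 G) (ell1_norm G) \<phi>"
    using ell1_bidual_bound[OF assms(1)] by metis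
  show ?thesis unfolding ell1_dual_def
  proof (rule dual_spaceI)
    fix a b assume ab: "a \<in> ell1 G" "b \<in> ell1 G"
    have "dual_act G \<phi> (a + b) = dual_act G \<phi> a + dual_act G \<phi> b"
      using ab assms(2)
      by (auto simp: dual_act_def fun_eq_iff convolution_add_left ell1_dual_linear convolution_ell1_and_norm)
    then show "bidual_act G \<Phi> \<phi> (a + b) = bidual_act G \<Phi> \<phi> a + bidual_act G \<Phi> \<phi> b"
      using ab assms by (simp add: bidual_act_def ell1_add ell1_bidual_linear dual_act_dual)
  next
    fix c a assume a: "a \<in> ell1 G"
    have "dual_act G \<phi> (cscale c a) = cscale c (dual_act G \<phi> a)"
      using a assms(2) unfolding cscale_def[of c "dual_act G \<phi> a"]
      by (auto simp: dual_act_def fun_eq_iff convolution_cscale_left ell1_dual_linear convolution_ell1_and_norm)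
    then show "bidual_act G \<Phi> \<phi> (cscale c a) = c * bidual_act G \<Phi> \<phi> a"
      using a assms by (simp add: bidual_act_def ell1_cscale ell1_bidual_linear dual_act_dual)
  next
    fix a assume a: "a \<in> ell1 G"
    have "norm (\<Phi> (dual_act G \<phi> a)) \<le> C * dual_norm (ell1 G) (ell1_norm G) (dual_act G \<phi> a)"
      by (rule C[OF dual_act_dual(1)[OF assms(2) a]])
    also have "\<dots> \<le> C * (dual_norm (ell1 G) (ell1_norm G) \<phi> * ell1_norm G a)"
      by (rule mult_left_mono[OF dual_act_dual(2)[OF assms(2) a] C0])
    finally show "norm (bidual_act G \<Phi> \<phi> a) \<le> (C * dual_norm (ell1 G) (ell1_norm G) \<phi>) * ell1_norm G a"
      using a by (simp add: bidual_act_def mult.assoc)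
  qed (simp add: bidual_act_def)
qed

text \<open>
  Under the identification of the dual with the bounded functions, \<open>at_fun G \<Phi> h\<close> is \<open>\<langle>\<Phi>, h\<rangle>\<close> and
  \<open>left_action G \<Phi> h\<close> is \<open>\<Phi> \<cdot> h\<close>.
\<close>

definition at_fun ::
  "('a, 'b) monoid_scheme \<Rightarrow> ((('a \<Rightarrow> complex) \<Rightarrow> complex) \<Rightarrow> complex) \<Rightarrow> ('a \<Rightarrow> complex) \<Rightarrow> complex" where
  "at_fun G \<Phi> h = \<Phi> (of_bounded G h)"

definition left_action ::
  "('a, 'b) monoid_scheme \<Rightarrow> ((('a \<Rightarrow> complex) \<Rightarrow> complex) \<Rightarrow> complex) \<Rightarrow> ('a \<Rightarrow> complex) \<Rightarrow> 'a \<Rightarrow> complex" where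
  "left_action G \<Phi> h = (\<lambda>x. if x \<in> carrier G then at_fun G \<Phi> (\<lambda>y. h (x \<otimes>\<^bsub>G\<^esub> y)) else 0)"

lemma of_bounded_add:
  assumes "bounded (g ` carrier G)" "bounded (h ` carrier G)"
  shows "of_bounded G (g + h) = of_bounded G g + of_bounded G h"
proof -
  obtain M N where M: "\<And>x. x \<in> carrier G \<Longrightarrow> norm (g x) \<le> M" and N: "\<And>x. x \<in> carrier G \<Longrightarrow> norm (h x) \<le> N"
    using bounded_obtain assms by metis
  have "(\<lambda>x. f x * g x) summable_on carrier G" "(\<lambda>x. f x * h x) summable_on carrier G" if "f \<in> ell1 G" for f
    using abs_summable_summable[OF bounded_mult_summable[of "carrier G" g M, OF _ ell1_abs_summable[OF that]]] M
      abs_summable_summable[OF bounded_mult_summable[of "carrier G" h N, OF _ ell1_abs_summable[OF that]]] N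
    by blast+
  then show ?thesis by (auto simp: of_bounded_def fun_eq_iff distrib_left intro!: infsum_add)
qed

lemma of_bounded_cscale: "of_bounded G (cscale c h) = cscale c (of_bounded G h)"
  by (auto simp: of_bounded_def cscale_def fun_eq_iff mult.left_commute[of _ c] infsum_cmult_right')

lemma at_fun_add:
  assumes "\<Phi> \<in> ell1_bidual G" "bounded (g ` carrier G)" "bounded (h ` carrier G)"
  shows "at_fun G \<Phi> (g + h) = at_fun G \<Phi> g + at_fun G \<Phi> h"
  using assms by (simp add: at_fun_def of_bounded_add ell1_bidual_linear of_bounded_dual)

lemma at_fun_cscale:
  assumes "\<Phi> \<in> ell1_bidual G" "bounded (h ` carrier G)"
  shows "at_fun G \<Phi> (cscale c h) = c * at_fun G \<Phi> h"
  using assms by (simp add: at_fun_def of_bounded_cscale ell1_bidual_linear of_bounded_dual)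

lemma at_fun_0: "\<Phi> \<in> ell1_bidual G \<Longrightarrow> at_fun G \<Phi> 0 = 0"
  using at_fun_cscale[of \<Phi> G 0 0] by (auto simp: bounded_iff)

lemma at_fun_cong: "(\<And>x. x \<in> carrier G \<Longrightarrow> g x = h x) \<Longrightarrow> at_fun G \<Phi> g = at_fun G \<Phi> h"
  unfolding at_fun_def by (metis of_bounded_cong)

lemma at_fun_bound:
  assumes "\<Phi> \<in> ell1_bidual G"
  obtains C where "C \<ge> 0"
    "\<And>h M. M \<ge> 0 \<Longrightarrow> (\<And>x. x \<in> carrier G \<Longrightarrow> norm (h x) \<le> M) \<Longrightarrow> norm (at_fun G \<Phi> h) \<le> C * M"
proof -
  obtain C where C0: "C \<ge> 0"
    and C: "\<And>\<phi>. \<phi> \<in> ell1_dual G \<Longrightarrow> norm (\<Phi> \<phi>) \<le> C * dual_norm (ell1 G) (ell1_norm G) \<phi>"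
    using ell1_bidual_bound[OF assms] by metis
  have "norm (at_fun G \<Phi> h) \<le> C * M" if "M \<ge> 0" and M: "\<And>x. x \<in> carrier G \<Longrightarrow> norm (h x) \<le> M" for h M
  proof -
    have "bounded (h ` carrier G)" using M by (auto simp: bounded_iff)
    then have "norm (at_fun G \<Phi> h) \<le> C * dual_norm (ell1 G) (ell1_norm G) (of_bounded G h)"
      unfolding at_fun_def by (intro C of_bounded_dual)
    also have "\<dots> \<le> C * M"
      using of_bounded_bound[of G h M] M by (intro mult_left_mono C0 dual_norm_le that(1)) auto
    finally show ?thesis .
  qed
  then show ?thesis using C0 that by blast
qed

lemma bidual_eqI:
  assumes "\<Phi> \<in> ell1_bidual G" "\<Psi> \<in> ell1_bidual G"
    "\<And>h. bounded (h ` carrier G) \<Longrightarrow> at_fun G \<Phi> h = at_fun G \<Psi> h"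
  shows "\<Phi> = \<Psi>"
proof
  fix \<phi>
  show "\<Phi> \<phi> = \<Psi> \<phi>"
  proof (cases "\<phi> \<in> ell1_dual G")
    case True
    then show ?thesis
      using assms(3)[OF dual_point_mass_bounded] dual_eq_of_bounded[OF True]
      unfolding at_fun_def by metis
  next
    case False
    then show ?thesis using assms ell1_bidual_linear(3) by metis
  qed
qed

text \<open>Every functional in the dual is \<open>of_bounded\<close> of its values at point masses,
  and these are bounded by its dual norm. Hence linearity and a sup-norm bound on bounded functions
  suffice, and no later construction has to return to the dual norm.\<close>

lemma ell1_bidualI:
  assumes add: "\<And>g h. bounded (g ` carrier G) \<Longrightarrow> bounded (h ` carrier G) \<Longrightarrow> at_fun G \<Phi> (g + h)
    = at_fun G \<Phi> g + at_fun G \<Phi> h"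
    and sc: "\<And>c h. bounded (h ` carrier G) \<Longrightarrow> at_fun G \<Phi> (cscale c h) = c * at_fun G \<Phi> h"
    and bd: "\<And>h M. M \<ge> 0 \<Longrightarrow> (\<And>x. x \<in> carrier G \<Longrightarrow> norm (h x) \<le> M) \<Longrightarrow> norm (at_fun G \<Phi> h) \<le> C * M"
    and ext: "\<And>\<phi>. \<phi> \<notin> ell1_dual G \<Longrightarrow> \<Phi> \<phi> = 0"
  shows "\<Phi> \<in> ell1_bidual G"
  unfolding ell1_bidual_def
proof (rule dual_spaceI[where C=C])
  fix \<phi> \<psi> assume D: "\<phi> \<in> ell1_dual G" "\<psi> \<in> ell1_dual G"
  let ?f = "\<lambda>x. \<phi> (point_mass x)" and ?g = "\<lambda>x. \<psi> (point_mass x)"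
  have "of_bounded G (?f + ?g) = of_bounded G ?f + of_bounded G ?g"
    by (intro of_bounded_add dual_point_mass_bounded D)
  then show "\<Phi> (\<phi> + \<psi>) = \<Phi> \<phi> + \<Phi> \<psi>"
    using add[of ?f ?g, OF dual_point_mass_bounded dual_point_mass_bounded, OF D]
      dual_eq_of_bounded[OF D(1)] dual_eq_of_bounded[OF D(2)] unfolding at_fun_def by metis
next
  fix c \<phi> assume D: "\<phi> \<in> ell1_dual G"
  show "\<Phi> (cscale c \<phi>) = c * \<Phi> \<phi>"
    using sc[OF dual_point_mass_bounded[OF D], of c] dual_eq_of_bounded[OF D]
    unfolding at_fun_def of_bounded_cscale by metis
next
  fix \<phi> assume D: "\<phi> \<in> ell1_dual G"
  have "norm (\<phi> (point_mass x)) \<le> dual_norm (ell1 G) (ell1_norm G) \<phi>" if "x \<in> carrier G" for x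
    by (rule dual_norm_upper[OF D]) (use that in \<open>auto simp: ell1_norm_point_mass[OF that]\<close>)
  then show "norm (\<Phi> \<phi>) \<le> C * dual_norm (ell1 G) (ell1_norm G) \<phi>"
    using bd[OF dual_norm_nonneg[OF D], of "\<lambda>x. \<phi> (point_mass x)"] dual_eq_of_bounded[OF D]
    unfolding at_fun_def by metis
qed (rule ext)

lemma ell1_bidual_0: "0 \<in> ell1_bidual G"
  by (rule ell1_bidualI[where C=0]) (auto simp: at_fun_def)

lemma ell1_bidual_add:
  assumes "\<Phi> \<in> ell1_bidual G" "\<Psi> \<in> ell1_bidual G"
  shows "\<Phi> + \<Psi> \<in> ell1_bidual G"
proof -
  obtain C D where C: "\<And>h M. M \<ge> 0 \<Longrightarrow> (\<And>x. x \<in> carrier G \<Longrightarrow> norm (h x) \<le> M) \<Longrightarrow> norm (at_fun G \<Phi> h) \<le> C * M"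
    and D: "\<And>h M. M \<ge> 0 \<Longrightarrow> (\<And>x. x \<in> carrier G \<Longrightarrow> norm (h x) \<le> M) \<Longrightarrow> norm (at_fun G \<Psi> h) \<le> D * M"
    using at_fun_bound assms by metis
  have eq: "at_fun G (\<Phi> + \<Psi>) h = at_fun G \<Phi> h + at_fun G \<Psi> h" for h
    by (simp add: at_fun_def)
  show ?thesis
  proof (rule ell1_bidualI[where C="C + D"])
    fix h :: "'a \<Rightarrow> complex" and M :: real assume h: "M \<ge> 0" "\<And>x. x \<in> carrier G \<Longrightarrow> norm (h x) \<le> M"
    then show "norm (at_fun G (\<Phi> + \<Psi>) h) \<le> (C + D) * M"
      using C[of M h, OF h] D[of M h, OF h] norm_triangle_ineq[of "at_fun G \<Phi> h" "at_fun G \<Psi> h"]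
      unfolding eq by (simp add: distrib_right)
  qed (use assms in \<open>auto simp: eq at_fun_add at_fun_cscale distrib_left ell1_bidual_linear\<close>)
qed

lemma ell1_bidual_cscale:
  assumes "\<Phi> \<in> ell1_bidual G"
  shows "cscale c \<Phi> \<in> ell1_bidual G"
proof -
  obtain C where C: "\<And>h M. M \<ge> 0 \<Longrightarrow> (\<And>x. x \<in> carrier G \<Longrightarrow> norm (h x) \<le> M) \<Longrightarrow> norm (at_fun G \<Phi> h) \<le> C * M"
    using at_fun_bound assms by metis
  have eq: "at_fun G (cscale c \<Phi>) h = c * at_fun G \<Phi> h" for h
    by (simp add: at_fun_def cscale_def)
  show ?thesis
  proof (rule ell1_bidualI[where C="norm c * C"])
    fix h :: "'a \<Rightarrow> complex" and M :: real assume h: "M \<ge> 0" "\<And>x. x \<in> carrier G \<Longrightarrow> norm (h x) \<le> M"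
    then show "norm (at_fun G (cscale c \<Phi>) h) \<le> norm c * C * M"
      using mult_left_mono[OF C[of M h, OF h], of "norm c"]
      unfolding eq by (simp add: norm_mult mult.assoc)
  qed (use assms in \<open>auto simp: eq at_fun_add at_fun_cscale distrib_left ell1_bidual_linear cscale_apply\<close>)
qed

lemma (in group) translate_bounded:
  assumes "bounded (h ` carrier G)" "x \<in> carrier G"
  shows "bounded ((\<lambda>y. h (x \<otimes> y)) ` carrier G)"
  by (rule bounded_subset[OF assms(1)]) (use assms(2) in auto)

lemma (in group) left_action_bounded:
  assumes "\<Phi> \<in> ell1_bidual G" "bounded (h ` carrier G)"
  shows "bounded (left_action G \<Phi> h ` carrier G)"
proof -
  obtain M where M: "M \<ge> 0" "\<And>x. x \<in> carrier G \<Longrightarrow> norm (h x) \<le> M"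
    using bounded_obtain[OF assms(2)] by metis
  obtain C where C: "\<And>h M. M \<ge> 0 \<Longrightarrow> (\<And>x. x \<in> carrier G \<Longrightarrow> norm (h x) \<le> M) \<Longrightarrow> norm (at_fun G \<Phi> h) \<le> C * M"
    using at_fun_bound[OF assms(1)] by metis
  have "norm (left_action G \<Phi> h x) \<le> C * M" if "x \<in> carrier G" for x
    using that M by (auto simp: left_action_def intro!: C)
  then show ?thesis by (auto simp: bounded_iff)
qed

text \<open>Both sides lie in the dual, so it suffices to compare them at point masses. There
  convolution is the group multiplication, and \<open>dual_act\<close> becomes left translation of
  \<open>h\<close>.\<close>

lemma (in group) bidual_act_of_bounded:
  assumes "\<Phi> \<in> ell1_bidual G" "bounded (h ` carrier G)"
  shows "bidual_act G \<Phi> (of_bounded G h) = of_bounded G (left_action G \<Phi> h)"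
proof -
  note hd = of_bounded_dual[OF assms(2)]
  have "bidual_act G \<Phi> (of_bounded G h) (point_mass x) = left_action G \<Phi> h x" if x: "x \<in> carrier G" for x
  proof -
    have "dual_act G (of_bounded G h) (point_mass x)
        = of_bounded G (\<lambda>y. dual_act G (of_bounded G h) (point_mass x) (point_mass y))"
      by (rule dual_eq_of_bounded[OF dual_act_dual(1)[OF hd point_mass_ell1[OF x]]])
    also have "\<dots> = of_bounded G (\<lambda>y. h (x \<otimes> y))"
      by (rule of_bounded_cong) (use x in \<open>simp add: dual_act_def convolution_point_mass of_bounded_point_mass\<close>)
    finally show ?thesis using x by (simp add: bidual_act_def left_action_def at_fun_def)
  qed
  then show ?thesis
    using of_bounded_cong[of G "\<lambda>x. bidual_act G \<Phi> (of_bounded G h) (point_mass x)" "left_action G \<Phi> h"]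
      dual_eq_of_bounded[OF bidual_act_dual[OF assms(1) hd]] by simp
qed

lemma (in group) at_fun_arens:
  assumes "\<Phi> \<in> ell1_bidual G" "bounded (h ` carrier G)"
  shows "at_fun G (arens G \<Psi> \<Phi>) h = at_fun G \<Psi> (left_action G \<Phi> h)"
  using assms by (simp add: at_fun_def arens_def of_bounded_dual bidual_act_of_bounded)

lemma left_action_add:
  assumes "group G" "\<Phi> \<in> ell1_bidual G" "bounded (g ` carrier G)" "bounded (h ` carrier G)"
  shows "left_action G \<Phi> (g + h) = left_action G \<Phi> g + left_action G \<Phi> h"
  using at_fun_add[OF assms(2) group.translate_bounded[OF assms(1,3)] group.translate_bounded[OF assms(1,4)]]
  by (auto simp: left_action_def fun_eq_iff plus_fun_def)

lemma left_action_cscale: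
  assumes "group G" "\<Phi> \<in> ell1_bidual G" "bounded (h ` carrier G)"
  shows "left_action G \<Phi> (cscale c h) = cscale c (left_action G \<Phi> h)"
  using at_fun_cscale[OF assms(2) group.translate_bounded[OF assms(1,3)]]
  by (auto simp: left_action_def fun_eq_iff cscale_def)

lemma (in group) arens_bidual:
  assumes "\<Psi> \<in> ell1_bidual G" "\<Phi> \<in> ell1_bidual G"
  shows "arens G \<Psi> \<Phi> \<in> ell1_bidual G"
proof -
  obtain C where C: "C \<ge> 0" "\<And>h M. M \<ge> 0 \<Longrightarrow> (\<And>x. x \<in> carrier G \<Longrightarrow> norm (h x) \<le> M) \<Longrightarrow> norm (at_fun G \<Phi> h) \<le> C * M"
    using at_fun_bound[OF assms(2)] by metis
  obtain D where D: "D \<ge> 0" "\<And>h M. M \<ge> 0 \<Longrightarrow> (\<And>x. x \<in> carrier G \<Longrightarrow> norm (h x) \<le> M) \<Longrightarrow> norm (at_fun G \<Psi> h) \<le> D * M"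
    using at_fun_bound[OF assms(1)] by metis
  show ?thesis
  proof (rule ell1_bidualI[where C="D * C"])
    show "at_fun G (arens G \<Psi> \<Phi>) (g + h) = at_fun G (arens G \<Psi> \<Phi>) g + at_fun G (arens G \<Psi> \<Phi>) h"
      if "bounded (g ` carrier G)" "bounded (h ` carrier G)" for g h
      using that assms at_fun_arens[OF assms(2) bounded_image_plus[OF that]]
      by (simp add: at_fun_arens left_action_add[OF is_group] left_action_bounded at_fun_add)
    show "at_fun G (arens G \<Psi> \<Phi>) (cscale c h) = c * at_fun G (arens G \<Psi> \<Phi>) h"
      if "bounded (h ` carrier G)" for c h
      using that assms by (simp add: at_fun_arens bounded_image_cscale left_action_cscale[OF is_group]
        left_action_bounded at_fun_cscale)
    fix h :: "'a \<Rightarrow> complex" and M :: real assume M: "M \<ge> 0" "\<And>x. x \<in> carrier G \<Longrightarrow> norm (h x) \<le> M"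
    then have "bounded (h ` carrier G)" by (auto simp: bounded_iff)
    then show "norm (at_fun G (arens G \<Psi> \<Phi>) h) \<le> D * C * M"
      using M C D unfolding at_fun_arens[OF assms(2) \<open>bounded (h ` carrier G)\<close>] mult.assoc
      by (auto simp: left_action_def intro!: D(2) C(2))
  qed (simp add: arens_def)
qed

text \<open>The first Arens product turns the bidual into an algebra acting from the left, with the
  right factor acting first; long products are computed by applying the actions one after
  another.\<close>

lemma (in group) left_action_arens:
  assumes "\<Phi> \<in> ell1_bidual G" "bounded (h ` carrier G)"
  shows "left_action G (arens G \<Psi> \<Phi>) h = left_action G \<Psi> (left_action G \<Phi> h)"
proof
  fix x
  show "left_action G (arens G \<Psi> \<Phi>) h x = left_action G \<Psi> (left_action G \<Phi> h) x"
  proof (cases "x \<in> carrier G")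
    case True
    have "at_fun G \<Psi> (left_action G \<Phi> (\<lambda>y. h (x \<otimes> y))) = at_fun G \<Psi> (\<lambda>y. left_action G \<Phi> h (x \<otimes> y))"
    proof (rule at_fun_cong)
      fix y assume y: "y \<in> carrier G"
      have "at_fun G \<Phi> (\<lambda>z. h (x \<otimes> (y \<otimes> z))) = at_fun G \<Phi> (\<lambda>z. h (x \<otimes> y \<otimes> z))"
        by (rule at_fun_cong) (use True y in \<open>simp add: m_assoc\<close>)
      then show "left_action G \<Phi> (\<lambda>y. h (x \<otimes> y)) y = left_action G \<Phi> h (x \<otimes> y)"
        using True y by (simp add: left_action_def)
    qed
    then show ?thesis
      using True by (simp add: left_action_def[of G "arens G \<Psi> \<Phi>"] left_action_def[of G \<Psi>]
        at_fun_arens[OF assms(1) translate_bounded[OF assms(2)]])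
  qed (simp add: left_action_def)
qed

text \<open>Evaluation at the identity recovers \<open>\<Phi>\<close> from its action, so
  \<open>\<Phi>\<close> vanishes once its action does.\<close>

lemma (in group) left_action_one:
  assumes "\<Phi> \<in> ell1_bidual G"
  shows "left_action G \<Phi> h \<one> = at_fun G \<Phi> h"
  by (simp add: left_action_def) (rule at_fun_cong, simp)

lemma canonical_bidual:
  assumes "x \<in> carrier G"
  shows "canonical G (point_mass x) \<in> ell1_bidual G"
    and "bounded (h ` carrier G) \<Longrightarrow> at_fun G (canonical G (point_mass x)) h = h x"
proof -
  have eq: "at_fun G (canonical G (point_mass x)) h = h x" if "bounded (h ` carrier G)" for h
    using that assms by (simp add: at_fun_def canonical_def of_bounded_dual of_bounded_point_mass)
  then show "bounded (h ` carrier G) \<Longrightarrow> at_fun G (canonical G (point_mass x)) h = h x" .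
  show "canonical G (point_mass x) \<in> ell1_bidual G"
  proof (rule ell1_bidualI[where C=1])
    fix h :: "'a \<Rightarrow> complex" and M :: real assume M: "M \<ge> 0" "\<And>x. x \<in> carrier G \<Longrightarrow> norm (h x) \<le> M"
    then have "bounded (h ` carrier G)" by (auto simp: bounded_iff)
    then show "norm (at_fun G (canonical G (point_mass x)) h) \<le> 1 * M"
      using eq M assms by simp
  next
    show "at_fun G (canonical G (point_mass x)) (g + h)
        = at_fun G (canonical G (point_mass x)) g + at_fun G (canonical G (point_mass x)) h"
      if "bounded (g ` carrier G)" "bounded (h ` carrier G)" for g h
      using eq[OF bounded_image_plus[OF that]] eq[OF that(1)] eq[OF that(2)] by simp
    show "at_fun G (canonical G (point_mass x)) (cscale c h) = c * at_fun G (canonical G (point_mass x)) h"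
      if "bounded (h ` carrier G)" for c h
      using eq[OF bounded_image_cscale[OF that]] eq[OF that] by (simp add: cscale_apply)
  qed (simp add: canonical_def)
qed

text \<open>This left identity makes an invariant difference itself a generator of
  \<open>J_sn G\<close>.\<close>

lemma (in group) arens_canonical_one:
  assumes "\<Phi> \<in> ell1_bidual G"
  shows "arens G (canonical G (point_mass \<one>)) \<Phi> = \<Phi>"
  by (rule bidual_eqI)
    (use assms in \<open>auto intro: arens_bidual canonical_bidual
      simp: at_fun_arens canonical_bidual(2)[OF one_closed left_action_bounded] left_action_one\<close>)

section \<open>Invariant differences\<close>

lemma subnormal_subgroup:
  assumes "group G" "subnormal H G"
  shows "subgroup H G"
proof -
  obtain m K where K: "K 0 = carrier G" "K m = H" "\<And>i. i < m \<Longrightarrow> K (Suc i) \<lhd> G\<lparr>carrier := K i\<rparr>"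
    using assms(2) unfolding subnormal_def by auto
  have "subgroup (K i) G" if "i \<le> m" for i
    using that
  proof (induction i)
    case 0
    then show ?case using K(1) group.subgroup_self[OF assms(1)] by simp
  next
    case (Suc i)
    then show ?case
      using group.incl_subgroup[OF assms(1)] normal_imp_subgroup[OF K(3)[of i]] by auto
  qed
  then show ?thesis using K(2) by auto
qed

lemma (in group) at_fun_incl_bidual:
  assumes H: "subgroup H G" and "bounded (h ` carrier G)"
  shows "at_fun G (incl_bidual G H \<Gamma>) h = at_fun (G\<lparr>carrier := H\<rparr>) \<Gamma> h"
proof -
  note sub = subgroup.subset[OF H]
  have l: "f \<in> ell1 G" if f: "f \<in> ell1 (G\<lparr>carrier := H\<rparr>)" for f
  proof (rule ell1I)
    have "(\<lambda>x. norm (f x)) summable_on H" using ell1_abs_summable[OF f] by simp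
    then show "f abs_summable_on carrier G"
      by (rule summable_on_cong_neutral[THEN iffD1, rotated -1])
        (use ell1_zero_outside[OF f] sub in auto)
  qed (use f sub ell1_zero_outside in force)
  have "incl_adjoint G H (of_bounded G h) = of_bounded (G\<lparr>carrier := H\<rparr>) h"
  proof
    fix f
    have "(\<Sum>\<^sub>\<infinity>x\<in>carrier G. f x * h x) = (\<Sum>\<^sub>\<infinity>x\<in>H. f x * h x)" if "f \<in> ell1 (G\<lparr>carrier := H\<rparr>)"
      by (rule infsum_cong_neutral) (use ell1_zero_outside[OF that] sub in auto)
    then show "incl_adjoint G H (of_bounded G h) f = of_bounded (G\<lparr>carrier := H\<rparr>) h f"
      using l by (simp add: incl_adjoint_def of_bounded_def)
  qed
  then show ?thesis using of_bounded_dual[OF assms(2)] by (simp add: at_fun_def incl_bidual_def)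
qed

lemma (in group) incl_bidual_bidual:
  assumes H: "subgroup H G" and \<Gamma>: "\<Gamma> \<in> ell1_bidual (G\<lparr>carrier := H\<rparr>)"
  shows "incl_bidual G H \<Gamma> \<in> ell1_bidual G"
proof -
  note sub = subgroup.subset[OF H]
  note E = at_fun_incl_bidual[OF H]
  have b: "bounded (h ` carrier (G\<lparr>carrier := H\<rparr>))" if "bounded (h ` carrier G)" for h :: "'a \<Rightarrow> complex"
    using bounded_subset[OF that] sub by (simp add: image_mono)
  obtain C where C: "C \<ge> 0"
    "\<And>h M. M \<ge> 0 \<Longrightarrow> (\<And>x. x \<in> H \<Longrightarrow> norm (h x) \<le> M) \<Longrightarrow> norm (at_fun (G\<lparr>carrier := H\<rparr>) \<Gamma> h) \<le> C * M"
    using at_fun_bound[OF \<Gamma>] by auto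
  show ?thesis
  proof (rule ell1_bidualI[where C=C])
    fix h :: "'a \<Rightarrow> complex" and M :: real
    assume M: "M \<ge> 0" "\<And>x. x \<in> carrier G \<Longrightarrow> norm (h x) \<le> M"
    then have "bounded (h ` carrier G)" by (auto simp: bounded_iff)
    then show "norm (at_fun G (incl_bidual G H \<Gamma>) h) \<le> C * M"
      using C(2)[of M h] M sub E by auto
  next
    show "at_fun G (incl_bidual G H \<Gamma>) (g + h)
      = at_fun G (incl_bidual G H \<Gamma>) g + at_fun G (incl_bidual G H \<Gamma>) h"
      if "bounded (g ` carrier G)" "bounded (h ` carrier G)" for g h
      using E[OF bounded_image_plus[OF that]] E[OF that(1)] E[OF that(2)] at_fun_add[OF \<Gamma> b b] that by simp
    show "at_fun G (incl_bidual G H \<Gamma>) (cscale c h) = c * at_fun G (incl_bidual G H \<Gamma>) h"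
      if "bounded (h ` carrier G)" for c h
      using E[OF bounded_image_cscale[OF that]] E[OF that] at_fun_cscale[OF \<Gamma> b] that by simp
  qed (simp add: incl_bidual_def)
qed

text \<open>Multiplying on the left by the point mass at s and evaluating at h gives the value at s
  of the action on h, which is the value at the translate y -> h (s y); this is how the third
  property arises. The upper bound uses invariant differences only through these four facts.\<close>

lemma (in group) invariant_difference_in_props:
  assumes H: "subgroup H G" and "\<Gamma> \<in> invariant_differences_in G H"
  shows "\<Gamma> \<in> ell1_bidual G"
    and "\<And>g h. bounded (g ` carrier G) \<Longrightarrow> bounded (h ` carrier G) \<Longrightarrow> (\<And>x. x \<in> H \<Longrightarrow> g x = h x)
      \<Longrightarrow> at_fun G \<Gamma> g = at_fun G \<Gamma> h"
    and "\<And>s h. s \<in> H \<Longrightarrow> bounded (h ` carrier G) \<Longrightarrow> at_fun G \<Gamma> (\<lambda>x. h (s \<otimes> x)) = at_fun G \<Gamma> h"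
    and "at_fun G \<Gamma> (\<lambda>_. 1) = 0"
proof -
  let ?H = "G\<lparr>carrier := H\<rparr>"
  interpret H: group ?H by (rule subgroup.subgroup_is_group[OF H is_group])
  note sub = subgroup.subset[OF H]
  obtain \<Delta> where \<Delta>: "\<Gamma> = incl_bidual G H \<Delta>" "\<Delta> \<in> ell1_bidual ?H"
    "\<And>s. s \<in> H \<Longrightarrow> arens ?H (canonical ?H (point_mass s)) \<Delta> = \<Delta>" "at_fun ?H \<Delta> (\<lambda>_. 1) = 0"
    using assms(2) unfolding invariant_differences_in_def invariant_differences_def at_fun_def by auto
  have b: "bounded (h ` carrier ?H)" if "bounded (h ` carrier G)" for h :: "'a \<Rightarrow> complex"
    using bounded_subset[OF that] sub by (simp add: image_mono)
  note E = at_fun_incl_bidual[OF H, of _ \<Delta>, folded \<Delta>(1)]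
  show "\<Gamma> \<in> ell1_bidual G" using incl_bidual_bidual[OF H \<Delta>(2)] \<Delta>(1) by simp
  show "at_fun G \<Gamma> g = at_fun G \<Gamma> h"
    if "bounded (g ` carrier G)" "bounded (h ` carrier G)" "\<And>x. x \<in> H \<Longrightarrow> g x = h x" for g h
    using E that at_fun_cong[of ?H g h \<Delta>] by simp
  show "at_fun G \<Gamma> (\<lambda>x. h (s \<otimes> x)) = at_fun G \<Gamma> h" if s: "s \<in> H" and h: "bounded (h ` carrier G)" for s h
  proof -
    have "s \<in> carrier G" using s sub by auto
    then have "at_fun G \<Gamma> (\<lambda>x. h (s \<otimes> x)) = at_fun ?H \<Delta> (\<lambda>x. h (s \<otimes> x))"
      using translate_bounded[OF h] E by blast
    also have "\<dots> = left_action ?H \<Delta> h s" using s by (simp add: left_action_def)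
    also have "\<dots> = at_fun ?H (canonical ?H (point_mass s)) (left_action ?H \<Delta> h)"
      using canonical_bidual(2)[of s ?H "left_action ?H \<Delta> h"] s H.left_action_bounded[OF \<Delta>(2) b[OF h]] by simp
    also have "\<dots> = at_fun ?H \<Delta> h"
      using H.at_fun_arens[OF \<Delta>(2) b[OF h], of "canonical ?H (point_mass s)"] \<Delta>(3)[OF s] by simp
    finally show ?thesis using E[OF h] by simp
  qed
  show "at_fun G \<Gamma> (\<lambda>_. 1) = 0" using E[of "\<lambda>_. 1"] \<Delta>(4) by (auto simp: bounded_iff)
qed

text \<open>The converse passage, from a functional on bounded functions to an invariant difference.
  The function recovered from a functional on \<open>ell1\<close> of \<open>H\<close> agrees with
  the original one on \<open>H\<close> only, hence the condition \<open>cong\<close>.\<close>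

lemma (in group) invariant_difference_exists:
  assumes H: "subgroup H G"
    and add: "\<And>g h. bounded (g ` H) \<Longrightarrow> bounded (h ` H) \<Longrightarrow> F (g + h) = F g + F h"
    and sc: "\<And>c h. bounded (h ` H) \<Longrightarrow> F (cscale c h) = c * F h"
    and bd: "\<And>h M. M \<ge> 0 \<Longrightarrow> (\<And>x. x \<in> H \<Longrightarrow> norm (h x) \<le> M) \<Longrightarrow> norm (F h) \<le> C * M"
    and cong: "\<And>g h. (\<And>x. x \<in> H \<Longrightarrow> g x = h x) \<Longrightarrow> F g = F h"
    and inv: "\<And>s h. s \<in> H \<Longrightarrow> bounded (h ` H) \<Longrightarrow> F (\<lambda>x. h (s \<otimes> x)) = F h"
    and one: "F (\<lambda>_. 1) = 0"
  shows "\<exists>\<Gamma>\<in>invariant_differences_in G H. \<forall>h. bounded (h ` carrier G) \<longrightarrow> at_fun G \<Gamma> h = F h"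
proof -
  let ?H = "G\<lparr>carrier := H\<rparr>"
  interpret H: group ?H by (rule subgroup.subgroup_is_group[OF H is_group])
  note sub = subgroup.subset[OF H]
  define \<Delta> where "\<Delta> \<phi> = (if \<phi> \<in> ell1_dual ?H then F (\<lambda>x. \<phi> (point_mass x)) else 0)" for \<phi>
  have E: "at_fun ?H \<Delta> h = F h" if "bounded (h ` H)" for h
  proof -
    have "of_bounded ?H h \<in> ell1_dual ?H" using that by (intro of_bounded_dual) simp
    then show ?thesis
      unfolding at_fun_def \<Delta>_def using cong[of "\<lambda>x. of_bounded ?H h (point_mass x)" h]
      by (simp add: of_bounded_point_mass)
  qed
  have \<Delta>: "\<Delta> \<in> ell1_bidual ?H"
  proof (rule ell1_bidualI[where C=C])
    fix h :: "'a \<Rightarrow> complex" and M :: real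
    assume M: "M \<ge> 0" "\<And>x. x \<in> carrier ?H \<Longrightarrow> norm (h x) \<le> M"
    then have "bounded (h ` H)" by (auto simp: bounded_iff)
    then show "norm (at_fun ?H \<Delta> h) \<le> C * M" using bd[of M h] M E by simp
  next
    show "at_fun ?H \<Delta> (g + h) = at_fun ?H \<Delta> g + at_fun ?H \<Delta> h"
      if "bounded (g ` carrier ?H)" "bounded (h ` carrier ?H)" for g h
      using that add[of g h] E[of g] E[of h] E[OF bounded_image_plus[of g H h]] by simp
    show "at_fun ?H \<Delta> (cscale c h) = c * at_fun ?H \<Delta> h" if "bounded (h ` carrier ?H)" for c h
      using that sc[of h c] E[of h] E[OF bounded_image_cscale[of h H c]] by simp
  qed (simp add: \<Delta>_def)
  have "arens ?H (canonical ?H (point_mass s)) \<Delta> = \<Delta>" if s: "s \<in> H" for s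
  proof (rule bidual_eqI)
    show "arens ?H (canonical ?H (point_mass s)) \<Delta> \<in> ell1_bidual ?H"
      using s by (intro H.arens_bidual \<Delta> canonical_bidual(1)) simp
    fix h :: "'a \<Rightarrow> complex" assume h: "bounded (h ` carrier ?H)"
    have "at_fun ?H (arens ?H (canonical ?H (point_mass s)) \<Delta>) h = left_action ?H \<Delta> h s"
      using H.at_fun_arens[OF \<Delta> h] canonical_bidual(2)[OF _ H.left_action_bounded[OF \<Delta> h]] s by simp
    also have "\<dots> = at_fun ?H \<Delta> (\<lambda>x. h (s \<otimes> x))"
      using s by (simp add: left_action_def)
    also have "\<dots> = at_fun ?H \<Delta> h"
      using H.translate_bounded[OF h] s h by (simp add: E inv)
    finally show "at_fun ?H (arens ?H (canonical ?H (point_mass s)) \<Delta>) h = at_fun ?H \<Delta> h" .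
  qed (rule \<Delta>)
  moreover have "at_fun ?H \<Delta> (\<lambda>_. 1) = 0" using E[of "\<lambda>_. 1"] one by (auto simp: bounded_iff)
  ultimately have "\<Delta> \<in> invariant_differences ?H"
    using \<Delta> by (auto simp: invariant_differences_def at_fun_def)
  then have "incl_bidual G H \<Delta> \<in> invariant_differences_in G H"
    by (auto simp: invariant_differences_in_def)
  moreover have "at_fun G (incl_bidual G H \<Delta>) h = F h" if "bounded (h ` carrier G)" for h
    using at_fun_incl_bidual[OF H that] E bounded_subset[OF that] sub by (simp add: image_mono)
  ultimately show ?thesis by blast
qed

section \<open>Functions invariant under independent elements\<close>

definition right_stab :: "('a, 'b) monoid_scheme \<Rightarrow> ('a \<Rightarrow> complex) \<Rightarrow> 'a set" where
  "right_stab G f = {x \<in> carrier G. \<forall>s\<in>carrier G. f (s \<otimes>\<^bsub>G\<^esub> x) = f s}"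

lemma (in group) subgroup_right_stab: "subgroup (right_stab G f) G"
proof (rule subgroupI)
  show "right_stab G f \<noteq> {}" by (auto simp: right_stab_def intro!: exI[of _ \<one>])
next
  fix a assume a: "a \<in> right_stab G f"
  then have "f (s \<otimes> inv a) = f s" if "s \<in> carrier G" for s
  proof -
    have "a \<in> carrier G" using a by (simp add: right_stab_def)
    then have "s \<otimes> inv a \<otimes> a = s" "s \<otimes> inv a \<in> carrier G" using that by (simp_all add: m_assoc)
    then show ?thesis using a unfolding right_stab_def by fastforce
  qed
  then show "inv a \<in> right_stab G f" using a by (auto simp: right_stab_def)
next
  fix a b assume "a \<in> right_stab G f" "b \<in> right_stab G f"
  then show "a \<otimes> b \<in> right_stab G f" by (auto simp: right_stab_def m_assoc[symmetric])
qed (auto simp: right_stab_def)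

text \<open>The product is taken in \<open>G\<close> itself in a fixed order, so that subgroups and
  conjugations of \<open>G\<close> apply to it directly; \<open>finprod_eq_seq_prod\<close> links it
  to products in the abelian subgroup. Sequences may be changed entry by entry without a check for
  collisions.\<close>

primrec seq_prod :: "('a, 'b) monoid_scheme \<Rightarrow> (nat \<Rightarrow> 'a) \<Rightarrow> (nat \<Rightarrow> int) \<Rightarrow> nat \<Rightarrow> 'a" where
  "seq_prod G x k 0 = \<one>\<^bsub>G\<^esub>"
| "seq_prod G x k (Suc r) = seq_prod G x k r \<otimes>\<^bsub>G\<^esub> x r [^]\<^bsub>G\<^esub> k r"

definition independent_seq :: "('a, 'b) monoid_scheme \<Rightarrow> 'a set \<Rightarrow> (nat \<Rightarrow> 'a) \<Rightarrow> nat \<Rightarrow> bool" where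
  "independent_seq G N x r \<longleftrightarrow> (\<forall>i<r. x i \<in> N) \<and>
     (\<forall>k. seq_prod G x k r = \<one>\<^bsub>G\<^esub> \<longrightarrow> (\<forall>i<r. k i = 0))"

lemma (in group) seq_prod_in_subgroup:
  assumes "subgroup H G" "\<And>i. i < r \<Longrightarrow> x i \<in> H"
  shows "seq_prod G x k r \<in> H"
  using assms(2)
  by (induction r) (auto intro: subgroup.m_closed[OF assms(1)] subgroup.one_closed[OF assms(1)]
    subgroup_int_pow_closed[OF assms(1)])

lemma (in group) seq_prod_closed:
  "(\<And>i. i < r \<Longrightarrow> x i \<in> carrier G) \<Longrightarrow> seq_prod G x k r \<in> carrier G"
  by (rule seq_prod_in_subgroup[OF subgroup_self])

lemma seq_prod_cong:
  "(\<And>i. i < r \<Longrightarrow> x i = y i) \<Longrightarrow> (\<And>i. i < r \<Longrightarrow> k i = l i) \<Longrightarrow> seq_prod G x k r = seq_prod G y l r"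
  by (induction r) auto

lemma (in group) seq_prod_hom:
  assumes "h \<in> hom G G" "\<And>i. i < r \<Longrightarrow> x i \<in> carrier G"
  shows "seq_prod G (\<lambda>i. h (x i)) k r = h (seq_prod G x k r)"
  using assms(2)
proof (induction r)
  case 0
  then show ?case using hom_one[OF assms(1)] by simp
next
  case (Suc r)
  then show ?case
    using hom_mult[OF assms(1) seq_prod_closed[of r x k], of "x r [^] k r"]
      hom_int_pow[OF assms(1) _ is_group is_group, of "x r" "k r"] by simp
qed

lemma (in group) conjugation_hom:
  assumes "g \<in> carrier G"
  shows "(\<lambda>x. g \<otimes> x \<otimes> inv g) \<in> hom G G"
proof (rule homI)
  fix x y assume "x \<in> carrier G" "y \<in> carrier G"
  then show "g \<otimes> (x \<otimes> y) \<otimes> inv g = g \<otimes> x \<otimes> inv g \<otimes> (g \<otimes> y \<otimes> inv g)"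
    using assms by (simp add: m_assoc inv_solve_left)
qed (use assms in auto)

lemma (in group) independent_seq_conj:
  assumes "N \<lhd> G" "g \<in> carrier G" "independent_seq G N x r"
  shows "independent_seq G N (\<lambda>i. g \<otimes> x i \<otimes> inv g) r"
proof -
  have sub: "N \<subseteq> carrier G" using assms(1) normal_imp_subgroup subgroup.subset by blast
  have xN: "x i \<in> N" if "i < r" for i using assms(3) that by (auto simp: independent_seq_def)
  then have xc: "x i \<in> carrier G" if "i < r" for i using sub that by auto
  have "seq_prod G x k r = \<one>" if "seq_prod G (\<lambda>i. g \<otimes> x i \<otimes> inv g) k r = \<one>" for k
  proof -
    have "g \<otimes> seq_prod G x k r \<otimes> inv g = \<one>"
      using that seq_prod_hom[OF conjugation_hom[OF assms(2)] xc] by simp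
    moreover have p: "seq_prod G x k r \<in> carrier G" by (rule seq_prod_closed[OF xc])
    moreover have "g \<otimes> seq_prod G x k r = g \<otimes> seq_prod G x k r \<otimes> inv g \<otimes> g"
      using assms(2) p by (simp add: m_assoc)
    ultimately have "g \<otimes> seq_prod G x k r = g" using assms(2) by simp
    then show ?thesis using assms(2) p by simp
  qed
  then show ?thesis
    using assms(3) xN normal.inv_op_closed2[OF assms(1,2)] unfolding independent_seq_def by auto
qed

text \<open>In a relation, all factors but the power of \<open>b\<close> lie in \<open>P\<close>, so
  that power lies in \<open>P\<close> too and its exponent must be 0. What remains is a relation
  among the old elements.\<close>

lemma (in group) independent_seq_extend:
  assumes "independent_seq G N x r" "N \<subseteq> carrier G" "b \<in> N" "subgroup P G"
    "\<And>i. i < r \<Longrightarrow> x i \<in> P" "\<And>m::nat. m > 0 \<Longrightarrow> b [^] m \<notin> P"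
  shows "independent_seq G N (x(r := b)) (Suc r)"
proof -
  have eq: "seq_prod G (x(r := b)) k (Suc r) = seq_prod G x k r \<otimes> b [^] k r" for k
    using seq_prod_cong[of r "x(r := b)" x k k G] by simp
  have bc: "b \<in> carrier G" using assms by auto
  have "k i = 0" if one: "seq_prod G x k r \<otimes> b [^] k r = \<one>" and i: "i < Suc r" for k i
  proof -
    have pP: "seq_prod G x k r \<in> P" by (rule seq_prod_in_subgroup[OF assms(4)]) (rule assms(5))
    then have "inv (seq_prod G x k r) \<in> P" using subgroup.m_inv_closed[OF assms(4)] by blast
    moreover have "b [^] k r = inv (seq_prod G x k r)"
      using one pP subgroup.subset[OF assms(4)] bc
      by (metis int_pow_closed inv_comm inv_equality subsetD)
    ultimately have bP: "b [^] k r \<in> P" by simp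
    then have bP': "b [^] (- k r) \<in> P"
      using int_pow_neg[OF bc] subgroup.m_inv_closed[OF assms(4)] by simp
    have "k r = 0"
    proof (rule ccontr)
      assume nz: "k r \<noteq> 0"
      \<comment> \<open>The hypothesis speaks of natural exponents only, so a negative exponent is
        first replaced by its opposite.\<close>
      have "b [^] nat \<bar>k r\<bar> \<in> P"
        using bP bP' pow_nat[of "\<bar>k r\<bar>" G b] by (cases "k r \<ge> 0") auto
      then show False using assms(6)[of "nat \<bar>k r\<bar>"] nz by simp
    qed
    then have "seq_prod G x k r = \<one>"
      using one pP subgroup.subset[OF assms(4)] by auto
    then show ?thesis
      using assms(1) i \<open>k r = 0\<close> unfolding independent_seq_def by (auto simp: less_Suc_eq)
  qed
  then show ?thesis
    using assms(1,3) unfolding independent_seq_def eq by (auto simp: less_Suc_eq)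
qed

definition invariant_layer :: "('a, 'b) monoid_scheme \<Rightarrow> 'a set \<Rightarrow> nat \<Rightarrow> ('a \<Rightarrow> complex) set" where
  "invariant_layer G N r = {f. bounded (f ` carrier G) \<and> (\<forall>x. x \<notin> carrier G \<longrightarrow> f x = 0) \<and>
     (\<exists>x. independent_seq G N x r \<and> (\<forall>i<r. x i \<in> right_stab G f))}"

text \<open>The tuple in \<open>invariant_layer\<close> depends on the function, so those functions
  need not form a space; the span is the smallest space that admits sums of pieces with different
  conjugated tuples.\<close>

definition layer :: "('a, 'b) monoid_scheme \<Rightarrow> 'a set \<Rightarrow> nat \<Rightarrow> ('a \<Rightarrow> complex) set" where
  "layer G N r = cspan (invariant_layer G N r)"

text \<open>The tail g is kept in the layer so that it is known to be bounded, as additivity of the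
  action requires.\<close>

lemma layer_induct [consumes 1, case_names zero add base]:
  assumes "f \<in> layer G N r" "P 0"
    "\<And>c f g. f \<in> invariant_layer G N r \<Longrightarrow> g \<in> layer G N r \<Longrightarrow> P g \<Longrightarrow> P (cscale c f + g)"
  shows "P f"
proof -
  have "f \<in> cspan (invariant_layer G N r)" using assms(1) by (simp add: layer_def)
  then have "f \<in> layer G N r \<and> P f"
  proof (induction f rule: cmod.span_induct_alt)
    case base
    show ?case using assms(2) cmod.span_zero unfolding layer_def by (rule conjI[rotated])
  next
    case (step c f g)
    then show ?case
      using assms(3)[of f g c] cmod.span_add[OF cmod.span_scale[OF cmod.span_base[of f]], of _ g c]
      unfolding layer_def by blast
  qed
  then show ?thesis by simp
qed

lemma layer_bounded: "f \<in> layer G N r \<Longrightarrow> bounded (f ` carrier G)"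
proof (induction f rule: layer_induct)
  case zero
  then show ?case by (auto simp: bounded_iff)
next
  case (add c f g)
  then show ?case
    using bounded_image_plus[OF bounded_image_cscale] by (auto simp: invariant_layer_def)
qed

lemma layer_0:
  assumes "bounded (f ` carrier G)" "\<And>x. x \<notin> carrier G \<Longrightarrow> f x = 0"
  shows "f \<in> layer G N 0"
  unfolding layer_def using assms
  by (intro cmod.span_base) (auto simp: invariant_layer_def independent_seq_def)

text \<open>The end of the filtration: without \<open>r\<close> independent elements the span is
  that of the empty set.\<close>

lemma layer_empty:
  assumes "\<nexists>x. independent_seq G N x r" "f \<in> layer G N r"
  shows "f = 0"
proof -
  have "invariant_layer G N r = {}" using assms(1) by (auto simp: invariant_layer_def)
  then show ?thesis using assms(2) by (simp add: layer_def cmod.span_empty)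
qed

text \<open>A relation among the first \<open>m\<close> elements becomes one among all of them by
  padding the exponents with 0.\<close>

lemma (in group) independent_seq_prefix:
  assumes "independent_seq G N x r" "m \<le> r" "N \<subseteq> carrier G"
  shows "independent_seq G N x m"
proof -
  have x: "x i \<in> carrier G" if "i < r" for i
    using assms that by (auto simp: independent_seq_def)
  have "seq_prod G x (\<lambda>i. if i < m then k i else 0) s = seq_prod G x k m" if "m \<le> s" "s \<le> r" for k s
    using that
  proof (induction s)
    case 0
    then show ?case by simp
  next
    case (Suc s)
    show ?case
    proof (cases "m = Suc s")
      case True
      show ?thesis unfolding True by (rule seq_prod_cong) auto
    next
      case False
      moreover have "seq_prod G x k m \<in> carrier G"
        using x assms(2) by (intro seq_prod_closed) auto
      ultimately show ?thesis using Suc by simp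
    qed
  qed
  note eq = this[OF assms(2) order_refl]
  have "k i = 0" if "seq_prod G x k m = \<one>" "i < m" for k i
  proof -
    have "seq_prod G x (\<lambda>i. if i < m then k i else 0) r = \<one>" "i < r"
      using eq that assms(2) by auto
    then have "(\<lambda>i. if i < m then k i else 0) i = 0"
      using assms(1) unfolding independent_seq_def by blast
    then show ?thesis using that by simp
  qed
  then show ?thesis using assms(1,2) by (auto simp: independent_seq_def)
qed

section \<open>Splitting a functional along cosets\<close>

lemma sum_apply: "(\<Sum>i\<in>I. u i) x = (\<Sum>i\<in>I. u i x)"
  for u :: "'i \<Rightarrow> 'x \<Rightarrow> complex"
  by (induction I rule: infinite_finite_induct) auto

lemma at_fun_sum:
  assumes "\<Phi> \<in> ell1_bidual G" "finite I" "\<And>i. i \<in> I \<Longrightarrow> bounded (u i ` carrier G)"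
  shows "bounded ((\<Sum>i\<in>I. u i) ` carrier G) \<and> at_fun G \<Phi> (\<Sum>i\<in>I. u i) = (\<Sum>i\<in>I. at_fun G \<Phi> (u i))"
  using assms(2,3)
proof (induction I rule: finite_induct)
  case empty
  then show ?case
    using at_fun_0[OF assms(1)] at_fun_0[OF assms(1), unfolded zero_fun_def] by (auto simp: bounded_iff)
next
  case (insert i I)
  then have "bounded (u i ` carrier G)" "bounded ((\<Sum>i\<in>I. u i) ` carrier G)" by auto
  then have "bounded ((u i + (\<Sum>i\<in>I. u i)) ` carrier G)"
    "at_fun G \<Phi> (u i + (\<Sum>i\<in>I. u i)) = at_fun G \<Phi> (u i) + at_fun G \<Phi> (\<Sum>i\<in>I. u i)"
    by (auto intro: bounded_image_plus at_fun_add[OF assms(1)] simp del: plus_fun_apply)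
  then show ?case
    using insert by (simp only: sum.insert[OF insert(1,2)]) auto
qed

lemma restrict_bounded: "bounded (u ` A) \<Longrightarrow> bounded ((\<lambda>t. if t \<in> D then u t else 0) ` A)"
  for u :: "'x \<Rightarrow> complex"
  using bounded_obtain[of u A] unfolding bounded_image_iff by (metis norm_zero)

text \<open>Here \<open>S\<close> carries \<open>\<Phi>\<close>, and the sets need to partition only
  \<open>S\<close>. The two uses are the right cosets of \<open>N\<close> with \<open>S\<close> the
  whole group, and the left cosets of a subgroup of H with \<open>S\<close> = H.\<close>

lemma at_fun_split:
  assumes "\<Phi> \<in> ell1_bidual G" "bounded (u ` carrier G)" "finite \<C>"
    and supp: "\<And>g h. bounded (g ` carrier G) \<Longrightarrow> bounded (h ` carrier G) \<Longrightarrow> (\<And>x. x \<in> S \<Longrightarrow> g x = h x)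
      \<Longrightarrow> at_fun G \<Phi> g = at_fun G \<Phi> h"
    and part: "\<And>t. t \<in> S \<Longrightarrow> \<exists>!C. C \<in> \<C> \<and> t \<in> C"
  shows "at_fun G \<Phi> u = (\<Sum>C\<in>\<C>. at_fun G \<Phi> (\<lambda>t. if t \<in> C then u t else 0))"
proof -
  let ?u = "\<lambda>C t. if t \<in> C then u t else 0"
  note S = at_fun_sum[OF assms(1,3), of ?u, OF restrict_bounded[OF assms(2)]]
  have "at_fun G \<Phi> u = at_fun G \<Phi> (\<Sum>C\<in>\<C>. ?u C)"
  proof (rule supp[OF assms(2)])
    show "bounded ((\<Sum>C\<in>\<C>. ?u C) ` carrier G)" using S by blast
    fix t assume "t \<in> S"
    then obtain C where C: "C \<in> \<C>" "t \<in> C" "\<And>D. D \<in> \<C> \<Longrightarrow> t \<in> D \<Longrightarrow> D = C" using part by metis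
    have "(\<Sum>D\<in>\<C>. ?u D) t = (\<Sum>D\<in>\<C>. ?u D t)"
      by (rule sum_apply)
    also have "\<dots> = (\<Sum>D\<in>\<C>. if D = C then u t else 0)"
    proof (rule sum.cong[OF refl])
      fix D assume D: "D \<in> \<C>"
      have "t \<in> D \<longleftrightarrow> D = C" using C(2) C(3)[OF D] by blast
      then show "?u D t = (if D = C then u t else 0)" by simp
    qed
    finally show "u t = (\<Sum>C\<in>\<C>. ?u C) t" using C(1) assms(3) by simp
  qed
  then show ?thesis using S by simp
qed

text \<open>This is the action of the part of \<open>\<Phi>\<close> concentrated on
  \<open>D\<close>; the cut is in the variable of \<open>\<Phi>\<close>, not in that of the
  resulting function.\<close>

definition cut_action ::
  "('a, 'b) monoid_scheme \<Rightarrow> ((('a \<Rightarrow> complex) \<Rightarrow> complex) \<Rightarrow> complex)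
    \<Rightarrow> 'a set \<Rightarrow> ('a \<Rightarrow> complex) \<Rightarrow> 'a \<Rightarrow> complex" where
  "cut_action G \<Phi> D f = (\<lambda>s. if s \<in> carrier G then at_fun G \<Phi> (\<lambda>t. if t \<in> D then f (s \<otimes>\<^bsub>G\<^esub> t) else 0) else 0)"

lemma (in group) cut_action_bounded:
  assumes "\<Phi> \<in> ell1_bidual G" "bounded (f ` carrier G)"
  shows "bounded (cut_action G \<Phi> D f ` carrier G)"
proof -
  obtain M where M: "M \<ge> 0" "\<And>x. x \<in> carrier G \<Longrightarrow> norm (f x) \<le> M"
    using bounded_obtain[OF assms(2)] by metis
  obtain C where C: "\<And>h M. M \<ge> 0 \<Longrightarrow> (\<And>x. x \<in> carrier G \<Longrightarrow> norm (h x) \<le> M) \<Longrightarrow> norm (at_fun G \<Phi> h) \<le> C * M"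
    using at_fun_bound[OF assms(1)] by metis
  have "norm (cut_action G \<Phi> D f x) \<le> C * M" if "x \<in> carrier G" for x
    using that M by (auto simp: cut_action_def intro!: C)
  then show ?thesis by (auto simp: bounded_iff)
qed

lemma (in group) left_action_split:
  assumes "N \<lhd> G" "finite (rcosets N)" "\<Phi> \<in> ell1_bidual G" "bounded (f ` carrier G)"
  shows "left_action G \<Phi> f = (\<Sum>D\<in>rcosets N. cut_action G \<Phi> D f)"
proof
  fix s
  have sub: "subgroup N G" using assms(1) normal_imp_subgroup by blast
  have part: "\<exists>!D. D \<in> rcosets N \<and> t \<in> D" if "t \<in> carrier G" for t
    using that rcosets_part_G[OF sub] rcos_disjoint[OF sub] unfolding pairwise_def disjnt_def by blast
  have "left_action G \<Phi> f s = (\<Sum>D\<in>rcosets N. cut_action G \<Phi> D f s)"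
  proof (cases "s \<in> carrier G")
    case True
    have "at_fun G \<Phi> (\<lambda>t. f (s \<otimes> t))
        = (\<Sum>D\<in>rcosets N. at_fun G \<Phi> (\<lambda>t. if t \<in> D then f (s \<otimes> t) else 0))"
      by (rule at_fun_split[OF assms(3) translate_bounded[OF assms(4) True] assms(2), of "carrier G"])
        (erule at_fun_cong, erule part)
    then show ?thesis using True by (simp add: left_action_def cut_action_def)
  qed (simp add: left_action_def cut_action_def)
  also have "\<dots> = (\<Sum>D\<in>rcosets N. cut_action G \<Phi> D f) s"
    by (rule sum_apply[symmetric])
  finally show "left_action G \<Phi> f s = (\<Sum>D\<in>rcosets N. cut_action G \<Phi> D f) s" .
qed

locale abelian_finite_index = group G for G (structure) +
  fixes N
  assumes normal_N: "N \<lhd> G" and finite_index: "finite (rcosets N)"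
    and commute: "\<And>a b. a \<in> N \<Longrightarrow> b \<in> N \<Longrightarrow> a \<otimes> b = b \<otimes> a"
begin

lemma subgroup_N: "subgroup N G" using normal_N normal_imp_subgroup by blast

lemma N_carrier: "x \<in> N \<Longrightarrow> x \<in> carrier G" using subgroup.subset[OF subgroup_N] by blast

text \<open>For \<open>t = a g\<close> in the coset \<open>N g\<close>, the conjugate \<open>g x g\<^sup>-\<^sup>1\<close> commutes with \<open>a\<close>, so \<open>g x g\<^sup>-\<^sup>1 t = t x\<close>.\<close>

lemma conj_right_stab_cut_action:
  assumes "D \<in> rcosets N" "g \<in> D" "x \<in> N" "x \<in> right_stab G f"
  shows "g \<otimes> x \<otimes> inv g \<in> right_stab G (cut_action G \<Phi> D f)"
proof -
  have gc: "g \<in> carrier G"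
    using assms(1,2) subgroup.rcosets_carrier[OF subgroup_N is_group] by blast
  have D: "D = N #> g"
    using assms(1,2) repr_independence[OF _ _ subgroup_N] unfolding RCOSETS_def by blast
  have xc: "x \<in> carrier G" using assms(3) N_carrier by auto
  have cN: "g \<otimes> x \<otimes> inv g \<in> N" using normal.inv_op_closed2[OF normal_N gc assms(3)] .
  have eq: "f (s \<otimes> (g \<otimes> x \<otimes> inv g) \<otimes> t) = f (s \<otimes> t)" if s: "s \<in> carrier G" and t: "t \<in> D" for s t
  proof -
    obtain a where a: "a \<in> N" "t = a \<otimes> g" using t D by (auto simp: r_coset_def)
    have ac: "a \<in> carrier G" using a N_carrier by auto
    have "(g \<otimes> x \<otimes> inv g) \<otimes> t = (g \<otimes> x \<otimes> inv g \<otimes> a) \<otimes> g" using a ac gc xc by (simp add: m_assoc)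
    also have "\<dots> = (a \<otimes> (g \<otimes> x \<otimes> inv g)) \<otimes> g" using commute[OF cN a(1)] by simp
    also have "\<dots> = t \<otimes> x" using a ac gc xc by (simp add: m_assoc)
    finally have "s \<otimes> (g \<otimes> x \<otimes> inv g) \<otimes> t = s \<otimes> t \<otimes> x"
      using s a ac gc xc by (simp add: m_assoc)
    then show ?thesis using assms(4) s a ac gc by (auto simp: right_stab_def)
  qed
  show ?thesis
    using gc xc eq unfolding right_stab_def
    by (auto simp: cut_action_def intro!: at_fun_cong)
qed

lemma sum_cut_action_layer:
  assumes "\<And>D. D \<in> rcosets N \<Longrightarrow> cut_action G \<Phi> D f \<in> layer G N r" "\<Phi> \<in> ell1_bidual G" "bounded (f ` carrier G)"
  shows "left_action G \<Phi> f \<in> layer G N r"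
  unfolding left_action_split[OF normal_N finite_index assms(2,3)]
  using assms(1) unfolding layer_def by (intro cmod.span_sum)

lemma left_action_layer_lift:
  assumes "\<Phi> \<in> ell1_bidual G" "\<And>f. f \<in> invariant_layer G N r \<Longrightarrow> left_action G \<Phi> f \<in> layer G N q"
    "f \<in> layer G N r"
  shows "left_action G \<Phi> f \<in> layer G N q"
  using assms(3)
proof (induction f rule: layer_induct)
  case zero
  have "left_action G \<Phi> 0 = 0"
    using at_fun_0[OF assms(1)] by (auto simp: left_action_def zero_fun_def)
  then show ?case unfolding layer_def by (metis cmod.span_zero)
next
  case (add c f g)
  then have "left_action G \<Phi> (cscale c f + g) = cscale c (left_action G \<Phi> f) + left_action G \<Phi> g"
    using left_action_add[OF is_group assms(1) bounded_image_cscale layer_bounded]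
      left_action_cscale[OF is_group assms(1)] by (auto simp: invariant_layer_def)
  moreover have "cscale c (left_action G \<Phi> f) + left_action G \<Phi> g \<in> layer G N q"
    using assms(2)[OF add(1)] add(3) unfolding layer_def by (rule cmod.span_add[OF cmod.span_scale])
  ultimately show ?case by metis
qed

text \<open>Each coset piece is fixed by the tuple conjugated by a representative of that coset, so
  the sum stays in the span. This lets arbitrary left factors, as in \<open>J_sn\<close>, leave the
  layer unchanged.\<close>

lemma left_action_layer:
  assumes "\<Phi> \<in> ell1_bidual G" "f \<in> layer G N r"
  shows "left_action G \<Phi> f \<in> layer G N r"
proof (rule left_action_layer_lift[OF assms(1) _ assms(2)])
  fix f assume f: "f \<in> invariant_layer G N r"
  then obtain x where b: "bounded (f ` carrier G)"
    and x: "independent_seq G N x r" "\<And>i. i < r \<Longrightarrow> x i \<in> right_stab G f"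
    by (auto simp: invariant_layer_def)
  have "cut_action G \<Phi> D f \<in> invariant_layer G N r" if D: "D \<in> rcosets N" for D
  proof -
    obtain g where g: "g \<in> carrier G" "D = N #> g" using D by (auto simp: RCOSETS_def)
    then have gD: "g \<in> D" using rcos_self[OF g(1) subgroup_N] by simp
    have "x i \<in> N" if "i < r" for i using x(1) that by (auto simp: independent_seq_def)
    then show ?thesis
      using independent_seq_conj[OF normal_N g(1) x(1)] conj_right_stab_cut_action[OF D gD _ x(2)]
        cut_action_bounded[OF assms(1) b]
      by (auto simp: invariant_layer_def cut_action_def)
  qed
  then show "left_action G \<Phi> f \<in> layer G N r"
    by (intro sum_cut_action_layer assms(1) b) (auto simp: layer_def intro: cmod.span_base)
qed

end

section \<open>Invariant differences raise the layer\<close>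

text \<open>On a left coset y L the function is constant, so its piece there is u y times an
  indicator. Left translations by \<open>H\<close> permute these cosets, so all indicators receive
  one value; finitely many equal values add up to the value at 1, which is 0.\<close>

lemma (in group) invariant_difference_vanish:
  assumes H: "subgroup H G" and \<Gamma>: "\<Gamma> \<in> invariant_differences_in G H"
    and L: "subgroup L G" "L \<subseteq> H" "finite ((\<lambda>y. l_coset G y L) ` H)"
    and u: "bounded (u ` carrier G)" "L \<subseteq> right_stab G u"
  shows "at_fun G \<Gamma> u = 0"
proof -
  note \<Gamma>P = invariant_difference_in_props[OF H \<Gamma>]
  note sub = subgroup.subset[OF H]
  let ?C = "(\<lambda>y. l_coset G y L) ` H"
  let ?e = "\<lambda>C t. if t \<in> C then (1::complex) else 0"
  have part: "\<exists>!C. C \<in> ?C \<and> t \<in> C" if t: "t \<in> H" for t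
  proof (rule ex1I)
    show "l_coset G t L \<in> ?C \<and> t \<in> l_coset G t L"
      using t sub subgroup.one_closed[OF L(1)] by (force simp: l_coset_def)
    fix C assume "C \<in> ?C \<and> t \<in> C"
    then obtain y where y: "y \<in> H" "C = l_coset G y L" "t \<in> l_coset G y L" by auto
    then show "C = l_coset G t L" using l_repr_independence[OF y(3) _ L(1)] sub by auto
  qed
  have b: "bounded (?e C ` carrier G)" for C by (auto simp: bounded_iff)
  have coset: "t \<in> l_coset G y L \<longleftrightarrow> inv y \<otimes> t \<in> L" if "y \<in> carrier G" "t \<in> carrier G" for y t
    using that subgroup.subset[OF L(1)]
    by (auto simp: l_coset_def m_assoc[symmetric] subset_iff intro!: bexI[of _ "inv y \<otimes> t"])
  have c: "at_fun G \<Gamma> (?e (l_coset G y L)) = at_fun G \<Gamma> (?e L)" if y: "y \<in> H" for y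
  proof -
    have "at_fun G \<Gamma> (?e (l_coset G y L)) = at_fun G \<Gamma> (\<lambda>t. ?e L (inv y \<otimes> t))"
      using coset y sub by (intro at_fun_cong) auto
    then show ?thesis using \<Gamma>P(3)[OF subgroup.m_inv_closed[OF H y] b] by simp
  qed
  have "0 = at_fun G \<Gamma> (\<lambda>_. 1)" using \<Gamma>P(4) by simp
  also have "\<dots> = (\<Sum>C\<in>?C. at_fun G \<Gamma> (?e C))"
    by (rule at_fun_split[OF \<Gamma>P(1) _ L(3) \<Gamma>P(2) part]) (auto simp: bounded_iff)
  also have "\<dots> = (\<Sum>C\<in>?C. at_fun G \<Gamma> (?e L))" using c by (intro sum.cong) auto
  finally have "of_nat (card ?C) * at_fun G \<Gamma> (?e L) = 0" by simp
  moreover have "card ?C \<noteq> 0" using L(3) subgroup.one_closed[OF H] by (auto simp: card_eq_0_iff)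
  ultimately have z: "at_fun G \<Gamma> (?e L) = 0" by simp
  have "at_fun G \<Gamma> (\<lambda>t. if t \<in> C then u t else 0) = 0" if CC: "C \<in> ?C" for C
  proof -
    obtain y where y: "y \<in> H" "C = l_coset G y L" using CC by blast
    have "at_fun G \<Gamma> (\<lambda>t. if t \<in> C then u t else 0) = at_fun G \<Gamma> (cscale (u y) (?e C))"
      using u(2) y sub by (intro at_fun_cong) (auto simp: cscale_apply l_coset_def right_stab_def subset_iff)
    then show ?thesis using at_fun_cscale[OF \<Gamma>P(1) b] c[OF y(1)] z y(2) by simp
  qed
  then have "(\<Sum>C\<in>?C. at_fun G \<Gamma> (\<lambda>t. if t \<in> C then u t else 0)) = 0"
    by (intro sum.neutral) blast
  moreover have "at_fun G \<Gamma> u = (\<Sum>C\<in>?C. at_fun G \<Gamma> (\<lambda>t. if t \<in> C then u t else 0))"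
    by (rule at_fun_split[OF \<Gamma>P(1) u(1) L(3) \<Gamma>P(2) part])
  ultimately show ?thesis by simp
qed

text \<open>Either every element of \<open>H\<close> \<inter> \<open>N\<close> has a positive power
  in the stabiliser of \<open>f\<close>, and by \<open>fin\<close> the action gives 0; or some
  element has none, and it extends the tuple. The premise \<open>fin\<close> isolates the
  contribution of finite generation.\<close>

lemma (in abelian_finite_index) left_action_invariant_difference:
  assumes fin: "\<And>H P. subgroup H G \<Longrightarrow> subgroup P G \<Longrightarrow> (\<And>b. b \<in> H \<inter> N \<Longrightarrow> \<exists>m>0. b [^] (m::nat) \<in> P)
      \<Longrightarrow> finite ((\<lambda>y. l_coset G y (H \<inter> P)) ` H)"
    and H: "subgroup H G" and \<Gamma>: "\<Gamma> \<in> invariant_differences_in G H" and "f \<in> layer G N r"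
  shows "left_action G \<Gamma> f \<in> layer G N (Suc r)"
proof (rule left_action_layer_lift[OF invariant_difference_in_props(1)[OF H \<Gamma>] _ assms(4)])
  note \<Gamma>P = invariant_difference_in_props[OF H \<Gamma>]
  fix f assume f: "f \<in> invariant_layer G N r"
  then obtain x where b: "bounded (f ` carrier G)"
    and x: "independent_seq G N x r" "\<And>i. i < r \<Longrightarrow> x i \<in> right_stab G f"
    by (auto simp: invariant_layer_def)
  note P = subgroup_right_stab[of f]
  show "left_action G \<Gamma> f \<in> layer G N (Suc r)"
  proof (cases "\<forall>b\<in>H \<inter> N. \<exists>m>0. b [^] (m::nat) \<in> right_stab G f")
    case True
    then have F: "finite ((\<lambda>y. l_coset G y (H \<inter> right_stab G f)) ` H)" using fin[OF H P] by blast
    \<comment> \<open>The intersection of \<open>H\<close> with the right stabiliser of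
      \<open>f\<close> also fixes every left translate of \<open>f\<close> from the right, so the
      vanishing criterion applies to each translate.\<close>
    have "at_fun G \<Gamma> (\<lambda>y. f (s \<otimes> y)) = 0" if s: "s \<in> carrier G" for s
      by (rule invariant_difference_vanish[OF H \<Gamma> subgroups_Inter_pair[OF H P] _ F translate_bounded[OF b s]])
        (use s in \<open>auto simp: right_stab_def m_assoc[symmetric]\<close>)
    then have "left_action G \<Gamma> f = 0" by (auto simp: left_action_def)
    then show ?thesis unfolding layer_def by (metis cmod.span_zero)
  next
    case False
    then obtain c where c: "c \<in> H" "c \<in> N" "\<And>m::nat. m > 0 \<Longrightarrow> c [^] m \<notin> right_stab G f" by blast
    define z where "z = x(r := c)"
    have z: "independent_seq G N z (Suc r)"
      unfolding z_def by (rule independent_seq_extend[OF x(1) subgroup.subset[OF subgroup_N] c(2) P x(2) c(3)])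
    have zN: "z i \<in> N" if "i < Suc r" for i using z that by (auto simp: independent_seq_def)
    have "cut_action G \<Gamma> D f \<in> layer G N (Suc r)" if D: "D \<in> rcosets N" for D
    proof (cases "D \<inter> H = {}")
      case True
      \<comment> \<open>\<open>\<Gamma>\<close> sees only values on \<open>H\<close>, so a coset
        missing \<open>H\<close> contributes 0.\<close>
      have "at_fun G \<Gamma> (\<lambda>t. if t \<in> D then f (s \<otimes> t) else 0) = at_fun G \<Gamma> 0" if "s \<in> carrier G" for s
        using True by (intro \<Gamma>P(2) restrict_bounded translate_bounded b that) (auto simp: bounded_iff)
      then have "cut_action G \<Gamma> D f = 0"
        using at_fun_0[OF \<Gamma>P(1)] by (auto simp: cut_action_def fun_eq_iff)
      then show ?thesis unfolding layer_def by (metis cmod.span_zero)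
    next
      case False
      \<comment> \<open>The representative must come from \<open>H\<close>: only then does the
        conjugate of the new element c lie in \<open>H\<close> again, where \<open>\<Gamma>\<close>
        is invariant.\<close>
      then obtain g where g: "g \<in> D" "g \<in> H" by auto
      have gc: "g \<in> carrier G" using g subgroup.subset[OF H] by auto
      have "g \<otimes> z i \<otimes> inv g \<in> right_stab G (cut_action G \<Gamma> D f)" if i: "i < Suc r" for i
      proof (cases "i < r")
        case True
        then show ?thesis
          using conj_right_stab_cut_action[OF D g(1) zN[OF i], of f] x(2) by (simp add: z_def)
      next
        case False
        define d where "d = g \<otimes> c \<otimes> inv g"
        have d: "d \<in> H" "d \<in> N" "d \<in> carrier G"
          using g c gc normal.inv_op_closed2[OF normal_N gc c(2)] N_carrier
          by (auto simp: d_def intro!: subgroup.m_closed[OF H] subgroup.m_inv_closed[OF H])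
        have Dd: "d \<otimes> t \<in> D \<longleftrightarrow> t \<in> D" if t: "t \<in> carrier G" for t
        proof -
          obtain h where h: "h \<in> carrier G" "D = N #> h" using D by (auto simp: RCOSETS_def)
          have iff: "y \<in> D \<longleftrightarrow> y \<otimes> inv h \<in> N" if "y \<in> carrier G" for y
            using that h N_carrier by (auto simp: r_coset_def m_assoc intro!: bexI[of _ "y \<otimes> inv h"])
          have "d \<otimes> t \<otimes> inv h \<in> N \<longleftrightarrow> t \<otimes> inv h \<in> N"
          proof
            assume "d \<otimes> t \<otimes> inv h \<in> N"
            then have "inv d \<otimes> (d \<otimes> t \<otimes> inv h) \<in> N"
              by (rule subgroup.m_closed[OF subgroup_N subgroup.m_inv_closed[OF subgroup_N d(2)]])
            moreover have "inv d \<otimes> (d \<otimes> t \<otimes> inv h) = t \<otimes> inv h"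
              using d h t by (simp add: m_assoc[symmetric])
            ultimately show "t \<otimes> inv h \<in> N" by metis
          next
            assume "t \<otimes> inv h \<in> N"
            then have "d \<otimes> (t \<otimes> inv h) \<in> N" by (rule subgroup.m_closed[OF subgroup_N d(2)])
            then show "d \<otimes> t \<otimes> inv h \<in> N" using d h t by (simp add: m_assoc)
          qed
          then show ?thesis using iff d t by simp
        qed
        have "cut_action G \<Gamma> D f (s \<otimes> d) = cut_action G \<Gamma> D f s" if s: "s \<in> carrier G" for s
        proof -
          have "at_fun G \<Gamma> (\<lambda>t. if t \<in> D then f (s \<otimes> d \<otimes> t) else 0)
              = at_fun G \<Gamma> (\<lambda>t. if d \<otimes> t \<in> D then f (s \<otimes> (d \<otimes> t)) else 0)"
            using s d Dd by (intro at_fun_cong) (auto simp: m_assoc)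
          also have "\<dots> = at_fun G \<Gamma> (\<lambda>t. if t \<in> D then f (s \<otimes> t) else 0)"
            by (rule \<Gamma>P(3)[OF d(1) restrict_bounded[OF translate_bounded[OF b s]]])
          finally show ?thesis using s d by (simp add: cut_action_def)
        qed
        then show ?thesis using False i d by (auto simp: right_stab_def z_def d_def less_Suc_eq)
      qed
      then have "cut_action G \<Gamma> D f \<in> invariant_layer G N (Suc r)"
        using independent_seq_conj[OF normal_N gc z] cut_action_bounded[OF \<Gamma>P(1) b]
        by (auto simp: invariant_layer_def cut_action_def)
      then show ?thesis by (auto simp: layer_def intro: cmod.span_base)
    qed
    then show ?thesis by (intro sum_cut_action_layer \<Gamma>P(1) b)
  qed
qed

section \<open>Finitely generated virtually abelian groups\<close>

lemma (in comm_group) generate_insert: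
  assumes "A \<subseteq> carrier G" "x \<in> carrier G" "z \<in> generate G (insert x A)"
  shows "\<exists>a\<in>generate G A. \<exists>e::int. z = a \<otimes> x [^] e"
  using assms(3)
proof (induction z rule: generate.induct)
  case one
  show ?case by (rule bexI[of _ \<one>], rule exI[of _ 0]) (auto intro: generate.one)
next
  case (incl h)
  show ?case
  proof (cases "h = x")
    case True
    then show ?thesis
      by (intro bexI[of _ \<one>] exI[of _ 1]) (use assms(2) in \<open>auto intro: generate.one\<close>)
  next
    case False
    then show ?thesis
      by (intro bexI[of _ h] exI[of _ 0]) (use incl assms in \<open>auto intro: generate.incl\<close>)
  qed
next
  case (inv h)
  show ?case
  proof (cases "h = x")
    case True
    then show ?thesis
      by (intro bexI[of _ \<one>] exI[of _ "-1"]) (use assms(2) in \<open>auto intro: generate.one simp: int_pow_neg\<close>)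
  next
    case False
    then show ?thesis
      by (intro bexI[of _ "inv h"] exI[of _ 0]) (use inv assms in \<open>auto intro: generate.inv\<close>)
  qed
next
  case (eng h1 h2)
  then obtain a b and e f :: int where ab: "a \<in> generate G A" "b \<in> generate G A"
    "h1 = a \<otimes> x [^] e" "h2 = b \<otimes> x [^] f" by blast
  then have "a \<in> carrier G" "b \<in> carrier G" using generate_in_carrier[OF assms(1)] by auto
  then have "h1 \<otimes> h2 = (a \<otimes> b) \<otimes> x [^] (e + f)"
    using ab assms(2) by (simp add: int_pow_mult m_ac)
  then show ?case using generate.eng[OF ab(1,2)] by blast
qed

lemma (in comm_group) cancel_middle:
  assumes "a \<in> carrier G" "v \<in> carrier G" "w \<in> carrier G" "u \<in> carrier G"
  shows "a \<otimes> (v \<otimes> w) \<otimes> inv (u \<otimes> v) = a \<otimes> inv u \<otimes> w"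
proof -
  have "a \<otimes> (v \<otimes> w) \<otimes> inv (u \<otimes> v) = a \<otimes> (v \<otimes> inv v) \<otimes> (inv u \<otimes> w)"
    using assms by (simp only: inv_mult m_ac m_closed inv_closed)
  then show ?thesis using assms by (simp add: m_assoc)
qed

text \<open>Induction on the generators. The exponents e such that \<open>B\<close> contains some a
  x^e, with a generated by the old generators, form a group d\<int>. If d = 0, the new generator x
  adds nothing to the intersection with \<open>B\<close>. Otherwise let b0 in \<open>B\<close> have
  exponent d: every b is c b0^q with c in the old intersection, and q matters only modulo m, where
  b0^m lies in \<open>L\<close>.\<close>

lemma (in comm_group) finite_coset_representatives:
  assumes "finite A" "A \<subseteq> carrier G" "subgroup B G" "subgroup L G" "L \<subseteq> B"
    "\<And>b. b \<in> B \<Longrightarrow> \<exists>m>0. b [^] (m::nat) \<in> L"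
  shows "\<exists>Y. finite Y \<and> Y \<subseteq> B \<and> (\<forall>b\<in>B \<inter> generate G A. \<exists>y\<in>Y. inv y \<otimes> b \<in> L)"
  using assms(1,2)
proof (induction A rule: finite_induct)
  case empty
  show ?case
    by (rule exI[of _ "{\<one>}"])
      (use subgroup.one_closed[OF assms(3)] subgroup.one_closed[OF assms(4)] in \<open>auto simp: generate_empty\<close>)
next
  case (insert x A)
  then obtain Y where Y: "finite Y" "Y \<subseteq> B" "\<And>b. b \<in> B \<Longrightarrow> b \<in> generate G A \<Longrightarrow> \<exists>y\<in>Y. inv y \<otimes> b \<in> L" by auto
  have A: "A \<subseteq> carrier G" and x: "x \<in> carrier G" using insert by auto
  note Bc = subgroup.subset[OF assms(3)] and Lc = subgroup.subset[OF assms(4)]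
  let ?E = "\<lambda>e. \<exists>a\<in>generate G A. a \<otimes> x [^] (e::int) \<in> B"
  show ?case
  proof (cases "\<exists>d::nat. d > 0 \<and> ?E (int d)")
    case False
    have "b \<in> generate G A" if b: "b \<in> B" "b \<in> generate G (insert x A)" for b
    proof -
      obtain a and e :: int where a: "a \<in> generate G A" "b = a \<otimes> x [^] e"
        using generate_insert[OF A x b(2)] by blast
      have ac: "a \<in> carrier G" using generate_in_carrier[OF A a(1)] .
      have "\<not> e > 0" using False a b(1) by (metis zero_less_imp_eq_int)
      moreover have "\<not> e < 0"
      proof
        assume "e < 0"
        \<comment> \<open>The negated assumption concerns positive exponents only; a negative one is
          turned around by inverting b.\<close>
        have "inv a \<otimes> x [^] (- e) = inv b" using a ac x by (simp add: inv_mult int_pow_neg)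
        then have "?E (- e)" using subgroup.m_inv_closed[OF assms(3) b(1)]
          generate_m_inv_closed[OF A a(1)] by metis
        then show False using False \<open>e < 0\<close> by (metis neg_0_less_iff_less zero_less_imp_eq_int)
      qed
      ultimately have "e = 0" by simp
      then show ?thesis using a ac by simp
    qed
    then show ?thesis using Y by blast
  next
    case True
    define d where "d = (LEAST d::nat. d > 0 \<and> ?E (int d))"
    have d: "d > 0" "?E (int d)" using LeastI_ex[OF True] unfolding d_def by blast+
    have least: "\<not> ?E (int j)" if "0 < j" "j < d" for j
      using not_less_Least that unfolding d_def by blast
    obtain a0 where a0: "a0 \<in> generate G A" "a0 \<otimes> x [^] int d \<in> B" using d by blast
    define b0 where "b0 = a0 \<otimes> x [^] int d"
    have a0c: "a0 \<in> carrier G" using generate_in_carrier[OF A a0(1)] .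
    have b0: "b0 \<in> B" "b0 \<in> carrier G" using a0 Bc by (auto simp: b0_def)
    obtain m :: nat where m: "m > 0" "b0 [^] m \<in> L" using assms(6)[OF b0(1)] by blast
    define Y' where "Y' = (\<lambda>(y, i). y \<otimes> b0 [^] (i::int)) ` (Y \<times> {0..<int m})"
    have "finite Y'" using Y(1) by (simp add: Y'_def)
    moreover have "Y' \<subseteq> B"
      using Y(2) b0(1) by (auto simp: Y'_def intro!: subgroup.m_closed[OF assms(3)]
        subgroup_int_pow_closed[OF assms(3)])
    moreover have "\<exists>y\<in>Y'. inv y \<otimes> b \<in> L" if b: "b \<in> B" "b \<in> generate G (insert x A)" for b
    proof -
      obtain a and e :: int where a: "a \<in> generate G A" "b = a \<otimes> x [^] e"
        using generate_insert[OF A x b(2)] by blast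
      have ac: "a \<in> carrier G" using generate_in_carrier[OF A a(1)] .
      define q r where "q = e div int d" and "r = e mod int d"
      have e: "e = int d * q + r" by (simp add: q_def r_def)
      define c where "c = b \<otimes> inv (b0 [^] q)"
      have cB: "c \<in> B" unfolding c_def
        by (intro subgroup.m_closed[OF assms(3)] subgroup.m_inv_closed[OF assms(3)]
          subgroup_int_pow_closed[OF assms(3)] b b0)
      have gX: "a \<otimes> inv (a0 [^] q) \<in> generate G A"
        using a a0 generate_is_subgroup[OF A]
        by (intro generate.eng generate_m_inv_closed[OF A] subgroup_int_pow_closed) auto
      have c: "c = (a \<otimes> inv (a0 [^] q)) \<otimes> x [^] r"
      proof -
        have "b0 [^] q = a0 [^] q \<otimes> x [^] (int d * q)"
          unfolding b0_def using a0c x by (simp add: int_pow_distrib int_pow_pow)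
        moreover have "x [^] e = x [^] (int d * q) \<otimes> x [^] r" unfolding e using x by (simp add: int_pow_mult)
        ultimately show ?thesis
          unfolding c_def a(2) using cancel_middle[of a "x [^] (int d * q)" "x [^] r" "a0 [^] q"] ac x a0c by simp
      qed
      \<comment> \<open>After removing b0^q the element c of \<open>B\<close> has exponent r < d,
        which minimality of d forces to be 0.\<close>
      have "r = 0"
      proof (rule ccontr)
        assume "r \<noteq> 0"
        then have "0 < nat r" "nat r < d" "int (nat r) = r" using d(1) unfolding r_def
          by (auto simp: nat_less_iff le_neq_trans)
        then show False using least[of "nat r"] gX c cB by metis
      qed
      then have "c \<in> generate G A" using c gX generate_in_carrier[OF A gX] by simp
      then obtain y where y: "y \<in> Y" "inv y \<otimes> c \<in> L" using Y(3)[OF cB] by blast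
      have yc: "y \<in> carrier G" using y Y(2) Bc by auto
      \<comment> \<open>Since b0^m lies in \<open>L\<close>, reducing q modulo m does not change the
        coset of \<open>L\<close> and leaves finitely many candidates.\<close>
      define i where "i = q mod int m"
      have i: "i \<in> {0..<int m}" using m(1) by (simp add: i_def)
      have "b0 [^] q = b0 [^] i \<otimes> (b0 [^] m) [^] (q div int m)"
        using int_pow_mult[OF b0(2), of i "int m * (q div int m)"]
          int_pow_pow[OF b0(2), of "int m" "q div int m"]
        by (simp add: i_def int_pow_int)
      moreover have "(b0 [^] m) [^] (q div int m) \<in> L" using subgroup_int_pow_closed[OF assms(4) m(2)] .
      moreover define w where "w = (b0 [^] m) [^] (q div int m)"
      ultimately have w: "b0 [^] q = b0 [^] i \<otimes> w" "w \<in> L" by auto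
      have bc: "b \<in> carrier G" "w \<in> carrier G" using b Bc w Lc by auto
      have "b = c \<otimes> b0 [^] q" unfolding c_def using bc b0 by (simp add: m_assoc)
      then have "inv (y \<otimes> b0 [^] i) \<otimes> b = (inv y \<otimes> c) \<otimes> (b0 [^] i \<otimes> w) \<otimes> inv (\<one> \<otimes> b0 [^] i)"
        using yc bc b0 cB Bc unfolding w(1)
        by (simp only: inv_mult inv_one l_one m_ac m_closed inv_closed int_pow_closed one_closed subset_iff)
      also have "\<dots> = (inv y \<otimes> c) \<otimes> w"
        using cancel_middle[of "inv y \<otimes> c" "b0 [^] i" w \<one>] yc bc b0 cB Bc by (simp add: subset_iff)
      finally have "inv (y \<otimes> b0 [^] i) \<otimes> b = (inv y \<otimes> c) \<otimes> w" .
      then have "inv (y \<otimes> b0 [^] i) \<otimes> b \<in> L"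
        using subgroup.m_closed[OF assms(4) y(2) w(2)] by simp
      moreover have "y \<otimes> b0 [^] i \<in> Y'" using y(1) i by (force simp: Y'_def)
      ultimately show ?thesis by blast
    qed
    ultimately show ?thesis by blast
  qed
qed

lemma (in group) comm_group_subgroupI:
  assumes "subgroup N G" "\<And>a b. a \<in> N \<Longrightarrow> b \<in> N \<Longrightarrow> a \<otimes> b = b \<otimes> a"
  shows "comm_group (G\<lparr>carrier := N\<rparr>)"
  by (rule group.group_comm_groupI[OF subgroup.subgroup_is_group[OF assms(1) is_group]]) (use assms(2) in auto)

text \<open>\<open>H\<close> meets finitely many cosets of \<open>N\<close>, and within one of them
  the elements of \<open>H\<close> differ by elements of \<open>H\<close> \<inter> \<open>N\<close>,
  which the previous lemma covers by finitely many cosets of \<open>H\<close> \<inter>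
  \<open>N\<close> \<inter> \<open>P\<close>.\<close>

lemma (in abelian_finite_index) finite_cosets_of_torsion:
  assumes "finite A" "generate G A = N" "A \<subseteq> carrier G" "subgroup H G" "subgroup P G"
    "\<And>b. b \<in> H \<inter> N \<Longrightarrow> \<exists>m>0. b [^] (m::nat) \<in> P"
  shows "finite ((\<lambda>y. l_coset G y (H \<inter> P)) ` H)"
proof -
  let ?N = "G\<lparr>carrier := N\<rparr>"
  interpret N: comm_group ?N by (rule comm_group_subgroupI[OF subgroup_N commute])
  have AN: "A \<subseteq> N" using assms(2) generate.incl[of _ A G] by blast
  have gen: "generate ?N A = N" using generate_consistent[OF AN subgroup_N] assms(2) by simp
  note Bs = subgroups_Inter_pair[OF assms(4) subgroup_N]
  have s1: "subgroup (H \<inter> N) ?N" using subgroup_incl[OF Bs subgroup_N] by auto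
  have s2: "subgroup (H \<inter> N \<inter> P) ?N" using subgroup_incl[OF subgroups_Inter_pair[OF Bs assms(5)] subgroup_N] by auto
  have tors: "\<exists>m>0. b [^]\<^bsub>?N\<^esub> (m::nat) \<in> H \<inter> N \<inter> P" if b: "b \<in> H \<inter> N" for b
  proof -
    obtain m :: nat where m: "m > 0" "b [^] m \<in> P" using assms(6)[OF b] by blast
    have "b [^] m \<in> H \<inter> N" using subgroup_int_pow_closed[OF Bs b, of "int m"] by (simp add: int_pow_int)
    then show ?thesis using m nat_pow_consistent[of b m N] by auto
  qed
  have "\<exists>Y. finite Y \<and> Y \<subseteq> H \<inter> N \<and> (\<forall>b\<in>H \<inter> N \<inter> generate ?N A. \<exists>y\<in>Y. inv\<^bsub>?N\<^esub> y \<otimes>\<^bsub>?N\<^esub> b \<in> H \<inter> N \<inter> P)"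
    by (rule N.finite_coset_representatives[OF assms(1) _ s1 s2 _ tors]) (use AN in auto)
  moreover have "H \<inter> N \<inter> generate ?N A = H \<inter> N" using gen by blast
  ultimately have "\<exists>Y. finite Y \<and> Y \<subseteq> H \<inter> N \<and> (\<forall>b\<in>H \<inter> N. \<exists>y\<in>Y. inv\<^bsub>?N\<^esub> y \<otimes> b \<in> H \<inter> N \<inter> P)"
    by simp
  then obtain Y where Y: "finite Y" "Y \<subseteq> H \<inter> N" "\<And>b. b \<in> H \<inter> N \<Longrightarrow> \<exists>y\<in>Y. inv\<^bsub>?N\<^esub> y \<otimes> b \<in> H \<inter> N \<inter> P"
    by meson
  \<comment> \<open>The representative is chosen inside \<open>H\<close> so that g^-1 h lies in both
    \<open>H\<close> and \<open>N\<close>; its value on cosets missing \<open>H\<close> is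
    irrelevant.\<close>
  define g where "g D = (SOME g. g \<in> D \<inter> H)" for D
  have "(\<lambda>y. l_coset G y (H \<inter> P)) ` H \<subseteq> (\<lambda>(D, y). l_coset G (g D \<otimes> y) (H \<inter> P)) ` ((rcosets N) \<times> Y)"
  proof
    fix C assume "C \<in> (\<lambda>y. l_coset G y (H \<inter> P)) ` H"
    then obtain h where h: "h \<in> H" "C = l_coset G h (H \<inter> P)" by auto
    have hc: "h \<in> carrier G" using h subgroup.subset[OF assms(4)] by auto
    let ?D = "N #> h"
    have D: "?D \<in> rcosets N" using hc by (auto simp: RCOSETS_def)
    have "h \<in> ?D \<inter> H" using rcos_self[OF hc subgroup_N] h by auto
    then have gD: "g ?D \<in> ?D" "g ?D \<in> H" unfolding g_def using someI[of "\<lambda>g. g \<in> ?D \<inter> H" h] by auto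
    have gc: "g ?D \<in> carrier G" using gD subgroup.subset[OF assms(4)] by auto
    obtain n where n: "n \<in> N" "g ?D = n \<otimes> h" using gD by (auto simp: r_coset_def)
    have nc: "n \<in> carrier G" using n N_carrier by auto
    have "inv (g ?D) \<otimes> h = inv h \<otimes> inv n \<otimes> h" using n nc hc by (simp add: inv_mult_group)
    moreover have "inv h \<otimes> inv n \<otimes> h \<in> N"
      using normal.inv_op_closed1[OF normal_N hc subgroup.m_inv_closed[OF subgroup_N n(1)]] .
    ultimately have b: "inv (g ?D) \<otimes> h \<in> H \<inter> N"
      using subgroup.m_closed[OF assms(4) subgroup.m_inv_closed[OF assms(4) gD(2)] h(1)] by simp
    obtain y where y: "y \<in> Y" "inv\<^bsub>?N\<^esub> y \<otimes> (inv (g ?D) \<otimes> h) \<in> H \<inter> N \<inter> P" using Y(3)[OF b] by blast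
    have yN: "y \<in> N" "y \<in> H" "y \<in> carrier G" using y Y N_carrier by auto
    then have p: "inv y \<otimes> (inv (g ?D) \<otimes> h) \<in> H \<inter> P" using y(2) m_inv_consistent[OF subgroup_N] by auto
    have "h = (g ?D \<otimes> y) \<otimes> (inv y \<otimes> (inv (g ?D) \<otimes> h))"
      using yN hc gc by (simp add: m_assoc[symmetric]) (simp add: m_assoc)
    then have "h \<in> l_coset G (g ?D \<otimes> y) (H \<inter> P)" using p unfolding l_coset_def by blast
    then have "l_coset G (g ?D \<otimes> y) (H \<inter> P) = C"
      using l_repr_independence[OF _ _ subgroups_Inter_pair[OF assms(4,5)]] yN gc h(2) by simp
    then show "C \<in> (\<lambda>(D, y). l_coset G (g D \<otimes> y) (H \<inter> P)) ` ((rcosets N) \<times> Y)"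
      using D y(1) by force
  qed
  then show ?thesis by (rule finite_subset) (use Y(1) finite_index in auto)
qed

text \<open>
  Schreier: if \<open>A\<close> collects the elements of \<open>N\<close> of the form \<open>t s t'\<^sup>-\<^sup>1\<close> or \<open>t\<close>, with \<open>s\<close> a generator
  and \<open>t, t'\<close> coset representatives, then the set of products of a word in \<open>A\<close> with a coset
  representative is stable under right multiplication by generators.
\<close>

lemma (in group) finite_index_finitely_generated:
  assumes "finitely_generated_group G" and N: "subgroup N G" and "finite (rcosets N)"
  shows "\<exists>A. finite A \<and> A \<subseteq> carrier G \<and> generate G A = N"
proof -
  obtain S where S: "finite S" "S \<subseteq> carrier G" "generate G S = carrier G"
    using assms(1) by (auto simp: finitely_generated_group_def)
  have "rcosets N = (\<lambda>t. N #> t) ` carrier G" by (auto simp: RCOSETS_def)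
  then obtain T0 where T0: "finite T0" "T0 \<subseteq> carrier G" "rcosets N = (\<lambda>t. N #> t) ` T0"
    using finite_subset_image[OF assms(3), of "\<lambda>t. N #> t" "carrier G"] by auto
  \<comment> \<open>The identity is added so that the rewriting of a word can start at the product
    of two identities.\<close>
  define T where "T = insert \<one> T0"
  have T: "finite T" "T \<subseteq> carrier G" "\<one> \<in> T" using T0 by (auto simp: T_def)
  have rep: "\<exists>t\<in>T. \<exists>n\<in>N. g = n \<otimes> t" if g: "g \<in> carrier G" for g
  proof -
    have "N #> g \<in> rcosets N" using g by (auto simp: RCOSETS_def)
    then obtain t where t: "t \<in> T0" "N #> g = N #> t" using T0(3) by auto
    then have "g \<in> N #> t" using rcos_self[OF g N] by simp
    then show ?thesis using t by (auto simp: r_coset_def T_def)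
  qed
  let ?S = "S \<union> (\<lambda>s. inv s) ` S"
  define A where "A = N \<inter> ((\<lambda>(t, s, t'). t \<otimes> s \<otimes> inv t') ` (T \<times> ?S \<times> T) \<union> T)"
  have A: "finite A" "A \<subseteq> N" "A \<subseteq> carrier G" using T S subgroup.subset[OF N] by (auto simp: A_def)
  have step: "\<exists>w'\<in>generate G A. \<exists>t'\<in>T. w \<otimes> t \<otimes> s = w' \<otimes> t'"
    if w: "w \<in> generate G A" and t: "t \<in> T" and s: "s \<in> ?S" for w t s
  proof -
    have c: "w \<in> carrier G" "t \<in> carrier G" "s \<in> carrier G"
      using generate_in_carrier[OF A(3) w] t T s S by auto
    obtain t' n where tn: "t' \<in> T" "n \<in> N" "t \<otimes> s = n \<otimes> t'" using rep[of "t \<otimes> s"] c by auto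
    have tc: "t' \<in> carrier G" "n \<in> carrier G" using tn T subgroup.subset[OF N] by auto
    have n: "n = t \<otimes> s \<otimes> inv t'" using tn tc by (simp add: m_assoc)
    then have "n \<in> A" using tn t s unfolding A_def by force
    then have "w \<otimes> n \<in> generate G A" by (intro generate.eng w generate.incl)
    moreover have "w \<otimes> t \<otimes> s = w \<otimes> n \<otimes> t'" using c tc tn by (simp add: m_assoc)
    ultimately show ?thesis using tn(1) by blast
  qed
  have main: "\<forall>w\<in>generate G A. \<forall>t\<in>T. \<exists>w'\<in>generate G A. \<exists>t'\<in>T. w \<otimes> t \<otimes> g = w' \<otimes> t'"
    if "g \<in> generate G S" for g
    using that
  proof (induction g rule: generate.induct)
    case one
    have "w \<otimes> t \<otimes> \<one> = w \<otimes> t" if "w \<in> generate G A" "t \<in> T" for w t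
      using generate_in_carrier[OF A(3) that(1)] that T by auto
    then show ?case by metis
  next
    case (eng h1 h2)
    have hc: "h1 \<in> carrier G" "h2 \<in> carrier G" using eng S by auto
    show ?case
    proof (intro ballI)
      fix w t assume wt: "w \<in> generate G A" "t \<in> T"
      then obtain w' t' where 1: "w' \<in> generate G A" "t' \<in> T" "w \<otimes> t \<otimes> h1 = w' \<otimes> t'" using eng.IH by blast
      then obtain w'' t'' where 2: "w'' \<in> generate G A" "t'' \<in> T" "w' \<otimes> t' \<otimes> h2 = w'' \<otimes> t''" using eng.IH
        by blast
      have "w \<otimes> t \<otimes> (h1 \<otimes> h2) = w \<otimes> t \<otimes> h1 \<otimes> h2"
        using hc generate_in_carrier[OF A(3) wt(1)] wt(2) T by (auto simp: m_assoc)
      then show "\<exists>w'\<in>generate G A. \<exists>t'\<in>T. w \<otimes> t \<otimes> (h1 \<otimes> h2) = w' \<otimes> t'"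
        using 1 2 by metis
    qed
  qed (use step in blast)+
  have "n \<in> generate G A" if n: "n \<in> N" for n
  proof -
    have nc: "n \<in> carrier G" using n subgroup.subset[OF N] by auto
    then obtain w t where wt: "w \<in> generate G A" "t \<in> T" "\<one> \<otimes> \<one> \<otimes> n = w \<otimes> t"
      using main[of n] S(3) generate.one[of G A] T(3) by metis
    have wN: "w \<in> N" using generate_subgroup_incl[OF A(2) N] wt(1) by blast
    have c: "w \<in> carrier G" "t \<in> carrier G" using wN subgroup.subset[OF N] wt T by auto
    have eq: "n = w \<otimes> t" using wt(3) nc by simp
    \<comment> \<open>As n and w both lie in \<open>N\<close>, so does the leftover representative
      t; \<open>A\<close> contains such representatives for this reason.\<close>
    then have "t = inv w \<otimes> n" using c by (simp add: m_assoc[symmetric])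
    then have "t \<in> N" using subgroup.m_closed[OF N subgroup.m_inv_closed[OF N wN] n] by simp
    then have "t \<in> A" using wt by (auto simp: A_def)
    then show ?thesis unfolding eq by (intro generate.eng wt generate.incl)
  qed
  then have "generate G A = N" using generate_subgroup_incl[OF A(2) N] by blast
  then show ?thesis using A by blast
qed

text \<open>\<open>N\<close> is the kernel of the action of \<open>G\<close> on the cosets of \<open>K\<close>.\<close>

lemma (in group) finite_index_core:
  assumes K: "subgroup K G" and fin: "finite (rcosets K)"
  shows "\<exists>N. N \<lhd> G \<and> N \<subseteq> K \<and> finite (rcosets N)"
proof -
  define N where "N = {g \<in> carrier G. \<forall>C\<in>rcosets K. C #> g = C}"
  have Cc: "C \<subseteq> carrier G" if "C \<in> rcosets K" for C
    using subgroup.rcosets_carrier[OF K is_group that] .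
  have assoc: "C #> (g \<otimes> h) = C #> g #> h" if "C \<in> rcosets K" "g \<in> carrier G" "h \<in> carrier G" for C g h
    using coset_mult_assoc[OF Cc[OF that(1)] that(2,3)] by simp
  have cl: "C #> g \<in> rcosets K" if C: "C \<in> rcosets K" and g: "g \<in> carrier G" for C g
  proof -
    obtain h where "h \<in> carrier G" "C = K #> h" using C by (auto simp: RCOSETS_def)
    then show ?thesis using coset_mult_assoc[OF subgroup.subset[OF K], of h g] g by (auto simp: RCOSETS_def)
  qed
  have inv: "C #> inv g = C" if "C #> g = C" "C \<in> rcosets K" "g \<in> carrier G" for C g
    using assoc[OF that(2,3), of "inv g"] that coset_mult_one[OF Cc[OF that(2)]] by simp
  have sub: "subgroup N G"
  proof (rule subgroupI)
    show "N \<subseteq> carrier G" by (auto simp: N_def)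
    show "N \<noteq> {}" using coset_mult_one[OF Cc] by (auto simp: N_def intro!: exI[of _ \<one>])
    show "inv a \<in> N" if "a \<in> N" for a using that inv by (auto simp: N_def)
    show "a \<otimes> b \<in> N" if "a \<in> N" "b \<in> N" for a b using that assoc by (auto simp: N_def)
  qed
  have "N \<lhd> G"
  proof (subst normal_inv_iff, intro conjI ballI)
    fix x h assume x: "x \<in> carrier G" and h: "h \<in> N"
    have hc: "h \<in> carrier G" using h by (auto simp: N_def)
    have "C #> (x \<otimes> h \<otimes> inv x) = C" if C: "C \<in> rcosets K" for C
    proof -
      have "C #> (x \<otimes> h \<otimes> inv x) = C #> x #> h #> inv x"
        using assoc[OF C, of "x \<otimes> h" "inv x"] assoc[OF C x hc] x hc by simp
      also have "C #> x #> h = C #> x" using h cl[OF C x] by (auto simp: N_def)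
      also have "C #> x #> inv x = C" using assoc[OF C x, of "inv x"] x coset_mult_one[OF Cc[OF C]] by simp
      finally show ?thesis .
    qed
    then show "x \<otimes> h \<otimes> inv x \<in> N" using x hc by (auto simp: N_def)
  qed (rule sub)
  moreover have "N \<subseteq> K"
  proof
    fix g assume g: "g \<in> N"
    then have gc: "g \<in> carrier G" by (auto simp: N_def)
    have "K #> g = K" using g subgroup.subgroup_in_rcosets[OF K is_group] by (auto simp: N_def)
    then show "g \<in> K" using rcos_self[OF gc K] by simp
  qed
  moreover have "finite (rcosets N)"
  proof -
    \<comment> \<open>The permutation of the cosets of \<open>K\<close> induced by g. There are
      finitely many, and elements inducing the same one differ by an element of the kernel
      \<open>N\<close>.\<close>
    define \<Phi> where "\<Phi> g = restrict (\<lambda>C. C #> g) (rcosets K)" for g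
    have "\<Phi> ` carrier G \<subseteq> PiE (rcosets K) (\<lambda>_. rcosets K)" using cl by (auto simp: \<Phi>_def)
    then have f: "finite (\<Phi> ` carrier G)" using finite_PiE[OF fin] fin finite_subset by metis
    have eq: "N #> g = N #> h" if g: "g \<in> carrier G" and h: "h \<in> carrier G" and p: "\<Phi> g = \<Phi> h" for g h
    proof -
      have "C #> (g \<otimes> inv h) = C" if C: "C \<in> rcosets K" for C
      proof -
        have "C #> g = C #> h" using fun_cong[OF p, of C] C by (simp add: \<Phi>_def)
        then show ?thesis
          using assoc[OF C g, of "inv h"] assoc[OF C h, of "inv h"] h coset_mult_one[OF Cc[OF C]] by simp
      qed
      then have "g \<otimes> inv h \<in> N" using g h by (auto simp: N_def)
      moreover have "g = (g \<otimes> inv h) \<otimes> h" using g h by (simp add: m_assoc)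
      ultimately have "g \<in> N #> h" unfolding r_coset_def by blast
      then show ?thesis using repr_independence[OF _ h sub] by simp
    qed
    have "rcosets N \<subseteq> (\<lambda>p. N #> (SOME g. g \<in> carrier G \<and> \<Phi> g = p)) ` \<Phi> ` carrier G"
    proof
      fix D assume "D \<in> rcosets N"
      then obtain g where g: "g \<in> carrier G" "D = N #> g" by (auto simp: RCOSETS_def)
      let ?h = "SOME h. h \<in> carrier G \<and> \<Phi> h = \<Phi> g"
      have "?h \<in> carrier G \<and> \<Phi> ?h = \<Phi> g" by (rule someI[of _ g]) (use g in auto)
      then have "D = N #> ?h" using eq[of g ?h] g by simp
      then show "D \<in> (\<lambda>p. N #> (SOME g. g \<in> carrier G \<and> \<Phi> g = p)) ` \<Phi> ` carrier G"
        using g(1) by blast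
    qed
    then show ?thesis using f finite_subset by blast
  qed
  ultimately show ?thesis by blast
qed

text \<open>Pigeonhole: two powers of \<open>x\<close> share a coset, and their quotient lies in
  \<open>N\<close>.\<close>

lemma (in group) finite_index_power:
  assumes N: "subgroup N G" and "finite (rcosets N)" and x: "x \<in> carrier G"
  shows "\<exists>m>0. x [^] (m::nat) \<in> N"
proof -
  let ?f = "\<lambda>j::nat. N #> x [^] j"
  have "range ?f \<subseteq> rcosets N" using x by (auto simp: RCOSETS_def)
  then have "finite (range ?f)" using assms(2) finite_subset by blast
  then have "\<not> inj ?f" using range_inj_infinite by blast
  then obtain i j where ij: "i < j" "?f i = ?f j" unfolding inj_on_def by (metis nat_neq_iff)
  have "x [^] j \<in> N #> x [^] i" using rcos_self[of "x [^] j" N] N x ij by simp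
  then obtain n where n: "n \<in> N" "x [^] j = n \<otimes> x [^] i" by (auto simp: r_coset_def)
  have "x [^] j = x [^] (j - i) \<otimes> x [^] i" using nat_pow_mult[OF x, of "j - i" i] ij by simp
  then have "x [^] (j - i) = n"
    using n x subgroup.subset[OF N] by (metis nat_pow_closed right_cancel subsetD)
  then show ?thesis using n(1) ij(1) by (intro exI[of _ "j - i"]) auto
qed

section \<open>Independence and rank in the abelian subgroup\<close>

context group
begin

context
  fixes K
  assumes K: "subgroup K G" and comm: "\<And>a b. a \<in> K \<Longrightarrow> b \<in> K \<Longrightarrow> a \<otimes> b = b \<otimes> a"
begin

lemma seq_prod_add:
  assumes "\<And>i. i < r \<Longrightarrow> x i \<in> K"
  shows "seq_prod G x (\<lambda>i. k i + l i) r = seq_prod G x k r \<otimes> seq_prod G x l r"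
  using assms
proof (induction r)
  case (Suc r)
  have a: "seq_prod G x k r \<in> K" "seq_prod G x l r \<in> K" using Suc seq_prod_in_subgroup[OF K] by auto
  have p: "x r [^] k r \<in> K" "x r [^] l r \<in> K" using subgroup_int_pow_closed[OF K] Suc by auto
  note c = a[THEN subsetD[OF subgroup.subset[OF K]]] p[THEN subsetD[OF subgroup.subset[OF K]]]
  have "x r \<in> carrier G" using Suc subgroup.subset[OF K] by auto
  then have "seq_prod G x (\<lambda>i. k i + l i) (Suc r)
      = seq_prod G x k r \<otimes> (seq_prod G x l r \<otimes> x r [^] k r) \<otimes> x r [^] l r"
    using Suc c by (simp add: int_pow_mult m_assoc)
  also have "seq_prod G x l r \<otimes> x r [^] k r = x r [^] k r \<otimes> seq_prod G x l r" using comm a p by blast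
  finally show ?case using c by (simp add: m_assoc)
qed simp

lemma seq_prod_diff:
  assumes "\<And>i. i < r \<Longrightarrow> x i \<in> K"
  shows "seq_prod G x k r = seq_prod G x l r \<Longrightarrow> seq_prod G x (\<lambda>i. k i - l i) r = \<one>"
proof -
  assume eq: "seq_prod G x k r = seq_prod G x l r"
  have c: "seq_prod G x m r \<in> carrier G" for m
    using seq_prod_in_subgroup[OF K, of r x m] assms subgroup.subset[OF K] by blast
  have "seq_prod G x (\<lambda>i. k i - l i + l i) r = seq_prod G x (\<lambda>i. k i - l i) r \<otimes> seq_prod G x l r"
    by (rule seq_prod_add[OF assms])
  then show ?thesis using eq c by simp
qed

lemma independent_seq_unique:
  assumes "independent_seq G K x r" "seq_prod G x k r = seq_prod G x l r" "i < r"
  shows "k i = l i"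
proof -
  have "seq_prod G x (\<lambda>i. k i - l i) r = \<one>"
    using assms by (intro seq_prod_diff) (auto simp: independent_seq_def)
  then have "k i - l i = 0" using assms(1,3) unfolding independent_seq_def by blast
  then show ?thesis by simp
qed

lemma seq_prod_unit:
  assumes "\<And>i. i < r \<Longrightarrow> x i \<in> carrier G" "i < r"
  shows "seq_prod G x (\<lambda>j. if j = i then c else 0) r = x i [^] (c::int)"
proof -
  have z: "seq_prod G x (\<lambda>j. if j = i then c else 0) s = \<one>" if "s \<le> i" for s
    using that by (induction s) auto
  have "seq_prod G x (\<lambda>j. if j = i then c else 0) s = x i [^] c" if "i < s" "s \<le> r" for s
    using that
  proof (induction s)
    case (Suc s)
    show ?case
    proof (cases "s = i")
      case True
      then show ?thesis using z[of i] assms by simp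
    next
      case False
      then show ?thesis using Suc assms by simp
    qed
  qed simp
  then show ?thesis using assms(2) by blast
qed

text \<open>Two equal entries would give two unit exponent vectors with the same product, against
  uniqueness of exponents. Injectivity makes the length of the sequence a cardinality.\<close>

lemma independent_seq_inj:
  assumes "independent_seq G K x r"
  shows "inj_on x {..<r}"
proof (rule inj_onI)
  fix i j assume ij: "i \<in> {..<r}" "j \<in> {..<r}" "x i = x j"
  have xc: "x i \<in> carrier G" if "i < r" for i
    using assms that subgroup.subset[OF K] by (auto simp: independent_seq_def)
  have "seq_prod G x (\<lambda>l. if l = i then 1 else 0) r = seq_prod G x (\<lambda>l. if l = j then 1 else 0) r"
    using seq_prod_unit[OF xc] ij by simp
  from independent_seq_unique[OF assms this, of i] ij(1) show "i = j" by (simp split: if_splits)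
qed

lemma finprod_eq_seq_prod:
  assumes "\<And>i. i < r \<Longrightarrow> x i \<in> K"
  shows "finprod (G\<lparr>carrier := K\<rparr>) (\<lambda>i. x i [^]\<^bsub>G\<lparr>carrier := K\<rparr>\<^esub> (k i :: int)) {..<r} = seq_prod G x k r"
proof -
  interpret K: comm_group "G\<lparr>carrier := K\<rparr>" by (rule comm_group_subgroupI[OF K comm])
  show ?thesis using assms
  proof (induction r)
    case (Suc r)
    have pc: "x i [^]\<^bsub>G\<lparr>carrier := K\<rparr>\<^esub> k i = x i [^] k i" "x i [^] k i \<in> K" if "i < Suc r" for i
      using int_pow_consistent[OF K Suc(2)[OF that]] subgroup_int_pow_closed[OF K Suc(2)[OF that]] by auto
    have "finprod (G\<lparr>carrier := K\<rparr>) (\<lambda>i. x i [^]\<^bsub>G\<lparr>carrier := K\<rparr>\<^esub> k i) (insert r {..<r})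
        = x r [^]\<^bsub>G\<lparr>carrier := K\<rparr>\<^esub> k r \<otimes> finprod (G\<lparr>carrier := K\<rparr>) (\<lambda>i. x i [^]\<^bsub>G\<lparr>carrier := K\<rparr>\<^esub> k i) {..<r}"
      using K.finprod_insert[of "{..<r}" r "\<lambda>i. x i [^]\<^bsub>G\<lparr>carrier := K\<rparr>\<^esub> k i"] pc by auto
    also have "\<dots> = x r [^] k r \<otimes> seq_prod G x k r" using Suc pc by simp
    also have "\<dots> = seq_prod G x k r \<otimes> x r [^] k r"
      using comm[OF pc(2)[of r] seq_prod_in_subgroup[OF K, of r x k]] Suc(2) by simp
    finally show ?case by (simp add: lessThan_Suc)
  qed simp
qed

lemma int_independent_imp_seq:
  assumes "int_independent (G\<lparr>carrier := K\<rparr>) S"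
  shows "\<exists>x. independent_seq G K x (card S)"
proof -
  interpret K: comm_group "G\<lparr>carrier := K\<rparr>" by (rule comm_group_subgroupI[OF K comm])
  have S: "finite S" "S \<subseteq> K" "\<And>k :: 'a \<Rightarrow> int. finprod (G\<lparr>carrier := K\<rparr>) (\<lambda>s. s [^]\<^bsub>G\<lparr>carrier := K\<rparr>\<^esub> k s) S = \<one> \<Longrightarrow> \<forall>s\<in>S. k s = 0"
    using assms by (auto simp: int_independent_def)
  obtain x where x: "bij_betw x {0..<card S} S" using ex_bij_betw_nat_finite[OF S(1)] by blast
  then have x: "bij_betw x {..<card S} S" by (simp add: atLeast0LessThan)
  have im: "x ` {..<card S} = S" and inj: "inj_on x {..<card S}" using x by (auto simp: bij_betw_def)
  have xK: "x i \<in> K" if "i < card S" for i using im S(2) that by auto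
  have "k i = 0" if k: "seq_prod G x k (card S) = \<one>" and i: "i < card S" for k i
  proof -
    \<comment> \<open>\<open>int_independent\<close> attaches exponents to elements,
      \<open>independent_seq\<close> to positions; l transports them back along the
      enumeration.\<close>
    define l where "l s = k (inv_into {..<card S} x s)" for s
    have lx: "l (x i) = k i" if "i < card S" for i using inj that by (simp add: l_def)
    have "finprod (G\<lparr>carrier := K\<rparr>) (\<lambda>s. s [^]\<^bsub>G\<lparr>carrier := K\<rparr>\<^esub> l s) (x ` {..<card S})
        = finprod (G\<lparr>carrier := K\<rparr>) (\<lambda>i. x i [^]\<^bsub>G\<lparr>carrier := K\<rparr>\<^esub> l (x i)) {..<card S}"
      by (rule K.finprod_reindex[OF _ inj]) (use im S(2) K.int_pow_closed in auto)
    also have "\<dots> = seq_prod G x (\<lambda>i. l (x i)) (card S)" by (rule finprod_eq_seq_prod[OF xK])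
    also have "\<dots> = \<one>" using k lx seq_prod_cong[of "card S" x x "\<lambda>i. l (x i)" k G] by simp
    finally have "\<forall>s\<in>S. l s = 0" unfolding im by (rule S(3))
    moreover have "x i \<in> S" using im i by blast
    ultimately show ?thesis using lx[OF i] by auto
  qed
  then show ?thesis using xK by (auto simp: independent_seq_def)
qed

lemma independent_seq_imp_int_independent:
  assumes "independent_seq G K x r"
  shows "int_independent (G\<lparr>carrier := K\<rparr>) (x ` {..<r})" "card (x ` {..<r}) = r"
proof -
  interpret K: comm_group "G\<lparr>carrier := K\<rparr>" by (rule comm_group_subgroupI[OF K comm])
  have inj: "inj_on x {..<r}" by (rule independent_seq_inj[OF assms])
  then show "card (x ` {..<r}) = r" by (simp add: card_image)
  have xK: "x i \<in> K" if "i < r" for i using assms that by (auto simp: independent_seq_def)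
  have "k s = 0" if k: "finprod (G\<lparr>carrier := K\<rparr>) (\<lambda>s. s [^]\<^bsub>G\<lparr>carrier := K\<rparr>\<^esub> k s) (x ` {..<r}) = \<one>"
    and s: "s \<in> x ` {..<r}" for k :: "'a \<Rightarrow> int" and s
  proof -
    have "finprod (G\<lparr>carrier := K\<rparr>) (\<lambda>s. s [^]\<^bsub>G\<lparr>carrier := K\<rparr>\<^esub> k s) (x ` {..<r})
        = finprod (G\<lparr>carrier := K\<rparr>) (\<lambda>i. x i [^]\<^bsub>G\<lparr>carrier := K\<rparr>\<^esub> k (x i)) {..<r}"
      by (rule K.finprod_reindex[OF _ inj]) (use xK K.int_pow_closed in auto)
    also have "\<dots> = seq_prod G x (\<lambda>i. k (x i)) r" by (rule finprod_eq_seq_prod[OF xK])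
    finally have "seq_prod G x (\<lambda>i. k (x i)) r = \<one>" using k by simp
    then have "\<forall>i<r. k (x i) = 0"
      using assms unfolding independent_seq_def by blast
    then show ?thesis using s by auto
  qed
  then show "int_independent (G\<lparr>carrier := K\<rparr>) (x ` {..<r})" using xK by (auto simp: int_independent_def)
qed

end

text \<open>A relation among the powers is one among the elements themselves, with each exponent
  multiplied by the positive \<open>m i\<close>.\<close>

lemma independent_seq_powers:
  assumes "independent_seq G K x r" "K \<subseteq> carrier G" "\<And>i. i < r \<Longrightarrow> m i > 0 \<and> x i [^] (m i::nat) \<in> N"
  shows "independent_seq G N (\<lambda>i. x i [^] m i) r"
proof -
  have xc: "x i \<in> carrier G" if "i < r" for i using assms that by (auto simp: independent_seq_def)
  have eq: "seq_prod G (\<lambda>i. x i [^] m i) k s = seq_prod G x (\<lambda>i. int (m i) * k i) s" if "s \<le> r" for k s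
    using that
  proof (induction s)
    case (Suc s)
    then show ?case using int_pow_pow[OF xc[of s], of "int (m s)" "k s"] by (simp add: int_pow_int)
  qed simp
  have "k i = 0" if "seq_prod G (\<lambda>i. x i [^] m i) k r = \<one>" "i < r" for k i
  proof -
    have "seq_prod G x (\<lambda>i. int (m i) * k i) r = \<one>" using eq[of r k] that(1) by simp
    then have "int (m i) * k i = 0" using assms(1) that(2) unfolding independent_seq_def by blast
    then show ?thesis using assms(3)[OF that(2)] by simp
  qed
  then show ?thesis using assms(3) by (auto simp: independent_seq_def)
qed

end

text \<open>A finite supremum of natural numbers is attained once the set is nonempty; the empty set
  is independent, so it is.\<close>

lemma torsion_free_rank_eq:
  assumes "torsion_free_rank K = enat n"
  shows "\<exists>S. int_independent K S \<and> card S = n" and "\<And>S. int_independent K S \<Longrightarrow> card S \<le> n"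
proof -
  let ?A = "(\<lambda>S. enat (card S)) ` {S. int_independent K S}"
  have sup: "Sup ?A = enat n" using assms by (simp add: torsion_free_rank_def)
  show le: "card S \<le> n" if "int_independent K S" for S
    using Sup_upper[of "enat (card S)" ?A] that unfolding sup by auto
  have ne: "?A \<noteq> {}" by (auto simp: int_independent_def intro!: exI[of _ "{}"])
  have fin: "finite ?A"
    by (rule finite_subset[of _ "enat ` {..n}"]) (use le in auto)
  have "Sup ?A = Max ?A" unfolding Sup_enat_def using ne fin by (simp only: if_False if_True)
  then have "Sup ?A \<in> ?A" using Max_in[OF fin ne] by simp
  then show "\<exists>S. int_independent K S \<and> card S = n" unfolding sup by auto
qed

text \<open>The given abelian subgroup K may fail to be normal, so its core N replaces it. The rank
  survives: suitable powers of independent elements of K lie in N and stay independent, and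
  independent elements of N are independent in K.\<close>

lemma (in group) abelian_core:
  assumes "finitely_generated_group G" "virtually_abelian_rank G n"
  obtains N A where "abelian_finite_index G N" "finite A" "A \<subseteq> carrier G" "generate G A = N"
    "\<exists>x. independent_seq G N x n" "\<nexists>x. independent_seq G N x (Suc n)"
proof -
  obtain K where K: "subgroup K G" "finite (rcosets K)" "comm_group (G\<lparr>carrier := K\<rparr>)"
    and rank: "torsion_free_rank (G\<lparr>carrier := K\<rparr>) = enat n"
    using assms(2) by (auto simp: virtually_abelian_rank_def finite_index_abelian_def)
  have comm: "a \<otimes> b = b \<otimes> a" if "a \<in> K" "b \<in> K" for a b
    using comm_monoid.m_comm[OF comm_group.axioms(1)[OF K(3)], of a b] that by simp
  obtain N where N: "N \<lhd> G" "N \<subseteq> K" "finite (rcosets N)" using finite_index_core[OF K(1,2)] by blast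
  have sub: "subgroup N G" using N(1) normal_imp_subgroup by blast
  obtain A where A: "finite A" "A \<subseteq> carrier G" "generate G A = N"
    using finite_index_finitely_generated[OF assms(1) sub N(3)] by blast
  have "abelian_finite_index G N"
    by (intro abelian_finite_index.intro group_axioms abelian_finite_index_axioms.intro) (use N comm in auto)
  moreover obtain S where S: "int_independent (G\<lparr>carrier := K\<rparr>) S" "card S = n"
    using torsion_free_rank_eq(1)[OF rank] by blast
  then obtain x where x: "independent_seq G K x n" using int_independent_imp_seq[OF K(1) comm] by blast
  have "\<exists>m. m > 0 \<and> x i [^] (m::nat) \<in> N" if "i < n" for i
    using finite_index_power[OF sub N(3), of "x i"] x that subgroup.subset[OF K(1)] by (auto
      simp: independent_seq_def)
  then obtain m where "\<And>i. i < n \<Longrightarrow> m i > 0 \<and> x i [^] (m i::nat) \<in> N" by metis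
  then have "\<exists>x. independent_seq G N x n"
    using independent_seq_powers[OF x subgroup.subset[OF K(1)]] by blast
  moreover have "\<not> independent_seq G N x (Suc n)" for x
  proof
    assume "independent_seq G N x (Suc n)"
    then have "independent_seq G K x (Suc n)" using N(2) by (auto simp: independent_seq_def)
    from independent_seq_imp_int_independent[OF K(1) comm this] torsion_free_rank_eq(2)[OF rank]
    show False by fastforce
  qed
  ultimately show ?thesis using that A by blast
qed

section \<open>A product that does not vanish\<close>

lemma compact_pi_cball:
  fixes B :: "'i \<Rightarrow> real"
  shows "compact (PiE UNIV (\<lambda>i. cball (0::complex) (B i)))"
  using compactin_PiE[of "\<lambda>_. euclidean :: complex topology" UNIV "\<lambda>i. cball 0 (B i)"]
  by (simp add: euclidean_product_topology)

text \<open>Tychonoff provides a pointwise cluster point, and any relation among finitely many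
  values that holds for \<open>D n\<close> in the limit passes to it. This produces invariant means
  without choosing a limit functional.\<close>

lemma cluster_functional:
  fixes D :: "nat \<Rightarrow> 'i \<Rightarrow> complex"
  assumes "\<And>n h. norm (D n h) \<le> B h"
  obtains F where "\<And>h. norm (F h) \<le> B h"
    "\<And>p c. continuous_on UNIV p \<Longrightarrow> (\<lambda>n. p (D n)) \<longlonglongrightarrow> c \<Longrightarrow> p F = (c::complex)"
proof -
  let ?K = "PiE UNIV (\<lambda>h. cball (0::complex) (B h))"
  have "eventually (\<lambda>x. x \<in> ?K) (filtermap D sequentially)"
    unfolding eventually_filtermap using assms by (intro always_eventually) auto
  then obtain F where F: "F \<in> ?K" "inf (nhds F) (filtermap D sequentially) \<noteq> bot"
    using compact_pi_cball[of B] unfolding compact_filter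
    by (metis filtermap_bot_iff sequentially_bot)
  have "norm (F h) \<le> B h" for h using F(1) by (auto simp: PiE_iff)
  moreover have "p F = c" if p: "continuous_on UNIV p" "(\<lambda>n. p (D n)) \<longlonglongrightarrow> c"
    for p :: "('i \<Rightarrow> complex) \<Rightarrow> complex" and c
  proof -
    have "(p \<longlongrightarrow> p F) (nhds F)"
      using p(1) unfolding continuous_on_def tendsto_at_iff_tendsto_nhds[symmetric] by simp
    then have 1: "(p \<longlongrightarrow> p F) (inf (nhds F) (filtermap D sequentially))"
      by (rule tendsto_mono[rotated]) simp
    have "(p \<longlongrightarrow> c) (filtermap D sequentially)" using p(2) by (simp add: filterlim_filtermap)
    then have 2: "(p \<longlongrightarrow> c) (inf (nhds F) (filtermap D sequentially))"
      by (rule tendsto_mono[rotated]) simp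
    show ?thesis by (rule tendsto_unique[OF F(2) 1 2])
  qed
  ultimately show ?thesis using that by blast
qed

text \<open>
  The difference of an invariant mean supported at \<open>+\<infinity>\<close> and one supported at \<open>-\<infinity>\<close>, as a
  cluster point of differences of averages.
\<close>

lemma int_invariant_difference:
  shows "\<exists>F :: (int \<Rightarrow> complex) \<Rightarrow> complex.
    (\<forall>g h. bounded (range g) \<longrightarrow> bounded (range h) \<longrightarrow> F (g + h) = F g + F h)
    \<and> (\<forall>c h. bounded (range h) \<longrightarrow> F (cscale c h) = c * F h)
    \<and> (\<forall>h M. (\<forall>j. norm (h j) \<le> M) \<longrightarrow> norm (F h) \<le> 2 * M)
    \<and> (\<forall>h k. bounded (range h) \<longrightarrow> F (\<lambda>j. h (j + k)) = F h)
    \<and> F (\<lambda>_. 1) = 0 \<and> F (\<lambda>j. if j \<ge> 0 then 1 else 0) = 1"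
proof -
  \<comment> \<open>The second average starts at -1, so the two halves are disjoint: the constant 1
    gets exactly 0 and the indicator of the nonnegative integers exactly 1, for every n.\<close>
  define T :: "nat \<Rightarrow> (int \<Rightarrow> complex) \<Rightarrow> complex" where
    "T n h = (\<Sum>k<Suc n. h (int k) - h (- 1 - int k)) / of_nat (Suc n)" for n h
  \<comment> \<open>The averages are bounded uniformly in n when h is bounded; the value 0 elsewhere
    keeps every coordinate in a fixed disc, as compactness demands.\<close>
  define D where "D n h = (if bounded (range h) then T n h else 0)" for n h
  define B where "B h = (if bounded (range h) then 2 * (SUP j. norm (h j)) else 0)" for h :: "int \<Rightarrow> complex"
  have T_bound: "norm (T n h) \<le> 2 * M" if M: "\<And>j. norm (h j) \<le> M" for n h M
  proof -
    have "norm (\<Sum>k<Suc n. h (int k) - h (- 1 - int k)) \<le> (\<Sum>k<Suc n. 2 * M)"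
    proof (rule sum_norm_le)
      fix k :: nat
      show "norm (h (int k) - h (- 1 - int k)) \<le> 2 * M"
        using norm_triangle_ineq4[of "h (int k)" "h (- 1 - int k)"] M[of "int k"] M[of "- 1 - int k"]
          by linarith
    qed
    then have "norm (\<Sum>k<Suc n. h (int k) - h (- 1 - int k)) \<le> real (Suc n) * (2 * M)" by simp
    then show ?thesis
      unfolding T_def norm_divide norm_of_nat by (simp add: pos_divide_le_eq mult.commute
        del: of_nat_Suc sum.lessThan_Suc)
  qed
  have le: "norm (h j) \<le> (SUP j. norm (h j))" if "bounded (range h)" for h :: "int \<Rightarrow> complex" and j
    using that by (intro cSUP_upper) (auto simp: bounded_iff bdd_above_def)
  have "norm (D n h) \<le> B h" for n h
    using T_bound[of h "SUP j. norm (h j)", OF le] by (simp add: D_def B_def)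
  then obtain F where F: "\<And>h. norm (F h) \<le> B h"
    and lim: "\<And>p c. continuous_on UNIV p \<Longrightarrow> (\<lambda>n. p (D n)) \<longlonglongrightarrow> c \<Longrightarrow> p F = (c::complex)"
    using cluster_functional[of D B] by metis
  have cont: "continuous_on UNIV (\<lambda>F :: (int \<Rightarrow> complex) \<Rightarrow> complex. F h)" for h
    by (rule continuous_on_product_coordinates)
  have 1: "F (g + h) = F g + F h" if b: "bounded (range g)" "bounded (range h)" for g h
  proof -
    have "D n (g + h) - D n g - D n h = 0" for n
      using b bounded_image_plus[OF b] unfolding D_def T_def
      by (simp add: sum.distrib sum_subtractf diff_divide_distrib add_divide_distrib
        del: sum.lessThan_Suc of_nat_Suc)
    then have "F (g + h) - F g - F h = 0"
      by (intro lim[of "\<lambda>F. F (g + h) - F g - F h"] continuous_intros cont) simp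
    then show ?thesis by (simp add: algebra_simps)
  qed
  have 2: "F (cscale c h) = c * F h" if b: "bounded (range h)" for c h
  proof -
    have "D n (cscale c h) - c * D n h = 0" for n
      using b bounded_image_cscale[OF b, of c] unfolding D_def T_def
      by (simp add: cscale_apply sum_distrib_left right_diff_distrib del: sum.lessThan_Suc of_nat_Suc)
    then have "F (cscale c h) - c * F h = 0"
      by (intro lim[of "\<lambda>F. F (cscale c h) - c * F h"] continuous_intros cont) simp
    then show ?thesis by simp
  qed
  have 3: "norm (F h) \<le> 2 * M" if M: "\<And>j. norm (h j) \<le> M" for h M
  proof -
    have "bounded (range h)" using M by (auto simp: bounded_iff)
    moreover have "(SUP j. norm (h j)) \<le> M" using M by (intro cSUP_least) auto
    ultimately show ?thesis using F[of h] by (simp add: B_def)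
  qed
  have shift: "F (\<lambda>j. h (j + 1)) = F h" if b: "bounded (range h)" for h
  proof -
    obtain M where M: "M \<ge> 0" "\<And>j. norm (h j) \<le> M" using bounded_obtain[OF b] by auto
    have b': "bounded (range (\<lambda>j. h (j + 1)))" using M(2) by (auto simp: bounded_iff)
    \<comment> \<open>Both sums telescope, so a shift changes only four boundary terms; divided by n
      + 1 they disappear in the limit.\<close>
    have tele: "(\<Sum>k<Suc n. h (int k + 1) - h (- 1 - int k + 1)) - (\<Sum>k<Suc n. h (int k) - h (- 1 - int k))
        = h (int n + 1) - h 0 - h 0 + h (- 1 - int n)" for n
      by (induction n) (auto simp: algebra_simps)
    have "(\<lambda>n. D n (\<lambda>j. h (j + 1)) - D n h) \<longlonglongrightarrow> 0"
    proof (rule Lim_null_comparison)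
      show "(\<lambda>n. 4 * M / real (Suc n)) \<longlonglongrightarrow> 0"
        by (rule LIMSEQ_Suc) (rule lim_const_over_n)
      have "norm (D n (\<lambda>j. h (j + 1)) - D n h) \<le> 4 * M / real (Suc n)" for n
      proof -
        have "D n (\<lambda>j. h (j + 1)) - D n h = (h (int n + 1) - h 0 - h 0 + h (- 1 - int n)) / of_nat (Suc n)"
          using b b' unfolding tele[symmetric] D_def T_def
          by (simp add: diff_divide_distrib del: sum.lessThan_Suc of_nat_Suc)
        moreover have "norm (h (int n + 1) - h 0 - h 0 + h (- 1 - int n)) \<le> 4 * M"
          using norm_triangle_ineq[of "h (int n + 1) - h 0 - h 0" "h (- 1 - int n)"]
            norm_triangle_ineq4[of "h (int n + 1) - h 0" "h 0"] norm_triangle_ineq4[of "h (int n + 1)" "h 0"]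
            M(2)[of "int n + 1"] M(2)[of 0] M(2)[of "- 1 - int n"] by linarith
        ultimately show ?thesis
          by (simp add: norm_divide divide_right_mono del: of_nat_Suc)
      qed
      then show "\<forall>\<^sub>F n in sequentially. norm (D n (\<lambda>j. h (j + 1)) - D n h) \<le> 4 * M / real (Suc n)" by simp
    qed
    then have "F (\<lambda>j. h (j + 1)) - F h = 0"
      by (intro lim[of "\<lambda>F. F (\<lambda>j. h (j + 1)) - F h"] continuous_intros cont)
    then show ?thesis by simp
  qed
  have 4: "F (\<lambda>j. h (j + k)) = F h" if b: "bounded (range h)" for h k
  proof (induction k rule: int_induct[of _ 0])
    case base
    then show ?case by simp
  next
    case (step1 i)
    have "bounded (range (\<lambda>j. h (j + i)))" by (rule bounded_subset[OF b]) auto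
    from shift[OF this] step1 show ?case by (simp add: add.assoc add.commute[of 1])
  next
    case (step2 i)
    have "bounded (range (\<lambda>j. h (j + (i - 1))))" by (rule bounded_subset[OF b]) auto
    from shift[OF this] step2 show ?case by (simp add: add.assoc)
  qed
  have "D n (\<lambda>_. 1) = 0" for n by (simp add: D_def T_def)
  then have 5: "F (\<lambda>_. 1) = 0"
    by (intro lim[of "\<lambda>F. F (\<lambda>_. 1)"] cont) simp
  have "D n (\<lambda>j. if j \<ge> 0 then 1 else 0) = 1" for n
  proof -
    have "bounded (range (\<lambda>j::int. if j \<ge> 0 then 1 else 0 :: complex))" by (auto simp: bounded_iff)
    then show ?thesis by (simp add: D_def T_def del: sum.lessThan_Suc of_nat_Suc)
  qed
  then have 6: "F (\<lambda>j. if j \<ge> 0 then 1 else 0) = 1"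
    by (intro lim[of "\<lambda>F. F (\<lambda>j. if j \<ge> 0 then 1 else 0)"] cont) simp
  show ?thesis using 1 2 3 4 5 6 by (intro exI[of _ F]) simp
qed

text \<open>The push-forward of the functional on the integers along j -> x^j; translation by x^k
  becomes a shift by k. One \<open>F\<close> serves all elements x, which makes the factors of the
  later product uniform.\<close>

lemma (in group) invariant_difference_cyclic:
  shows "\<exists>F :: (int \<Rightarrow> complex) \<Rightarrow> complex. F 0 = 0 \<and> F (\<lambda>j. if j \<ge> 0 then 1 else 0) = 1 \<and>
    (\<forall>x\<in>carrier G. \<exists>\<Gamma>\<in>invariant_differences_in G (generate G {x}).
       \<forall>h. bounded (h ` carrier G) \<longrightarrow> at_fun G \<Gamma> h = F (\<lambda>j. h (x [^] j)))"
proof -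
  obtain F :: "(int \<Rightarrow> complex) \<Rightarrow> complex" where F':
    "(\<forall>g h. bounded (range g) \<longrightarrow> bounded (range h) \<longrightarrow> F (g + h) = F g + F h)
    \<and> (\<forall>c h. bounded (range h) \<longrightarrow> F (cscale c h) = c * F h)
    \<and> (\<forall>h M. (\<forall>j. norm (h j) \<le> M) \<longrightarrow> norm (F h) \<le> 2 * M)
    \<and> (\<forall>h k. bounded (range h) \<longrightarrow> F (\<lambda>j. h (j + k)) = F h)
    \<and> F (\<lambda>_. 1) = 0 \<and> F (\<lambda>j. if j \<ge> 0 then 1 else 0) = 1"
    using int_invariant_difference by (elim exE)
  note F = F'[THEN conjunct1, rule_format] F'[THEN conjunct2, THEN conjunct1, rule_format]
    F'[THEN conjunct2, THEN conjunct2, THEN conjunct1, rule_format]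
    F'[THEN conjunct2, THEN conjunct2, THEN conjunct2, THEN conjunct1, rule_format]
    F'[THEN conjunct2, THEN conjunct2, THEN conjunct2, THEN conjunct2, THEN conjunct1]
    F'[THEN conjunct2, THEN conjunct2, THEN conjunct2, THEN conjunct2, THEN conjunct2]
  have "\<exists>\<Gamma>\<in>invariant_differences_in G (generate G {x}).
       \<forall>h. bounded (h ` carrier G) \<longrightarrow> at_fun G \<Gamma> h = F (\<lambda>j. h (x [^] j))" if x: "x \<in> carrier G" for x
  proof (rule invariant_difference_exists[where C=2])
    have H: "generate G {x} = range (\<lambda>j::int. x [^] j)" using generate_pow[OF x] by auto
    have b: "bounded (range (\<lambda>j::int. h (x [^] j)))" if "bounded (h ` generate G {x})" for h :: "'a \<Rightarrow> complex"
      using that unfolding H by (simp add: image_image)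
    show "subgroup (generate G {x}) G" using x by (intro generate_is_subgroup) simp
    show "F (\<lambda>j. (g + h) (x [^] j)) = F (\<lambda>j. g (x [^] j)) + F (\<lambda>j. h (x [^] j))"
      if "bounded (g ` generate G {x})" "bounded (h ` generate G {x})" for g h
      using F(1)[OF b b, OF that] by (simp add: plus_fun_def)
    show "F (\<lambda>j. cscale c h (x [^] j)) = c * F (\<lambda>j. h (x [^] j))"
      if "bounded (h ` generate G {x})" for c h
      using F(2)[OF b[OF that], of c] by (simp add: cscale_def)
    show "norm (F (\<lambda>j. h (x [^] j))) \<le> 2 * M" if "\<And>y. y \<in> generate G {x} \<Longrightarrow> norm (h y) \<le> M" for h M
      using that by (intro F(3)) (auto simp: H)
    show "F (\<lambda>j. g (x [^] j)) = F (\<lambda>j. h (x [^] j))" if "\<And>y. y \<in> generate G {x} \<Longrightarrow> g y = h y" for g h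
      using that by (simp add: H)
    show "F (\<lambda>j. h (s \<otimes> x [^] j)) = F (\<lambda>j. h (x [^] j))"
      if s: "s \<in> generate G {x}" and h: "bounded (h ` generate G {x})" for s h
    proof -
      obtain k :: int where k: "s = x [^] k" using s unfolding H by auto
      have "(\<lambda>j. h (s \<otimes> x [^] j)) = (\<lambda>j. h (x [^] (j + k)))"
        using x k by (simp add: int_pow_mult[symmetric] add.commute)
      then show ?thesis using F(4)[OF b[OF h], of k] by simp
    qed
    show "F (\<lambda>j. 1) = 0" by (rule F(5))
  qed
  moreover have "F 0 = 0" using F(2)[of 0 0] by (auto simp: bounded_iff)
  ultimately show ?thesis using F(6) by (intro exI[of _ F]) simp
qed

text \<open>The chain has two steps, through \<open>N\<close>: a subgroup of an abelian group is
  normal in it, and \<open>N\<close> is normal in \<open>G\<close>.\<close>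

lemma (in abelian_finite_index) subnormal_cyclic:
  assumes "x \<in> N"
  shows "subnormal (generate G {x}) G"
proof -
  interpret N: comm_group "G\<lparr>carrier := N\<rparr>" by (rule comm_group_subgroupI[OF subgroup_N commute])
  have "subgroup (generate G {x}) G" using assms N_carrier by (intro generate_is_subgroup) auto
  then have "subgroup (generate G {x}) (G\<lparr>carrier := N\<rparr>)"
    using generate_subgroup_incl[OF _ subgroup_N] assms subgroup_N by (intro subgroup_incl) auto
  then have "generate G {x} \<lhd> G\<lparr>carrier := N\<rparr>" by (rule N.subgroup_imp_normal)
  then show ?thesis
    unfolding subnormal_def using normal_N
    by (intro exI[of _ 2] exI[of _ "\<lambda>i. if i = 0 then carrier G else if i = 1 then N else generate G {x}"])
      (auto simp: less_2_cases_iff numeral_2_eq_2 less_Suc_eq)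
qed

lemma arens_prod_Cons: "\<Gamma>s \<noteq> [] \<Longrightarrow> arens_prod G (\<Gamma> # \<Gamma>s) = arens G \<Gamma> (arens_prod G \<Gamma>s)"
  by (simp add: arens_prod_def)

lemma arens_prod_singleton: "arens_prod G [\<Gamma>] = \<Gamma>"
  by (simp add: arens_prod_def)

text \<open>The property Q r says that a function is the orthant indicator along the products of the
  first r elements. Acting with the r-th difference (counting from 0) applies \<open>F\<close> to
  the last coordinate of Q (r + 1) and leaves Q r; at r = 0 this says that the value at the identity
  is 1.\<close>

lemma (in abelian_finite_index) nonvanishing_product:
  assumes "independent_seq G N x m" "m \<ge> 1"
  shows "\<exists>\<Gamma>s. length \<Gamma>s = m \<and> arens_prod G \<Gamma>s \<noteq> 0 \<and>
    (\<forall>\<Gamma>\<in>set \<Gamma>s. \<exists>H. subnormal H G \<and> \<Gamma> \<in> invariant_differences_in G H)"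
proof -
  obtain F :: "(int \<Rightarrow> complex) \<Rightarrow> complex" where F0: "F 0 = 0" and F1: "F (\<lambda>j. if j \<ge> 0 then 1 else 0) = 1"
    and FG: "\<And>x. x \<in> carrier G \<Longrightarrow> \<exists>\<Gamma>\<in>invariant_differences_in G (generate G {x}).
       \<forall>h. bounded (h ` carrier G) \<longrightarrow> at_fun G \<Gamma> h = F (\<lambda>j. h (x [^] j))"
    using invariant_difference_cyclic by blast
  have xN: "x i \<in> N" if "i < m" for i using assms that by (auto simp: independent_seq_def)
  then have xc: "x i \<in> carrier G" if "i < m" for i using N_carrier that by auto
  obtain \<Gamma> where \<Gamma>: "\<And>i. i < m \<Longrightarrow> \<Gamma> i \<in> invariant_differences_in G (generate G {x i})"
    "\<And>i h. i < m \<Longrightarrow> bounded (h ` carrier G) \<Longrightarrow> at_fun G (\<Gamma> i) h = F (\<lambda>j. h (x i [^] j))"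
  proof -
    have "\<forall>i. \<exists>g. i < m \<longrightarrow> g \<in> invariant_differences_in G (generate G {x i}) \<and>
        (\<forall>h. bounded (h ` carrier G) \<longrightarrow> at_fun G g h = F (\<lambda>j. h (x i [^] j)))"
      using FG xc by blast
    then obtain g where "\<forall>i. i < m \<longrightarrow> g i \<in> invariant_differences_in G (generate G {x i}) \<and>
        (\<forall>h. bounded (h ` carrier G) \<longrightarrow> at_fun G (g i) h = F (\<lambda>j. h (x i [^] j)))"
      using choice[of "\<lambda>i g. i < m \<longrightarrow> g \<in> invariant_differences_in G (generate G {x i}) \<and>
        (\<forall>h. bounded (h ` carrier G) \<longrightarrow> at_fun G g h = F (\<lambda>j. h (x i [^] j)))"] by blast
    then show ?thesis using that[of g] by blast
  qed
  have sn: "subnormal (generate G {x i}) G" if "i < m" for i using subnormal_cyclic[OF xN[OF that]] .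
  have bid: "\<Gamma> i \<in> ell1_bidual G" if "i < m" for i
    by (rule invariant_difference_in_props(1)[OF subnormal_subgroup[OF is_group sn[OF that]] \<Gamma>(1)[OF that]])
  \<comment> \<open>If an earlier coordinate is negative, the function of the last coordinate is 0
    throughout; otherwise it is the half-line indicator.\<close>
  have Fb: "F (\<lambda>j. if b \<and> j \<ge> 0 then 1 else 0) = (if b then 1 else 0)" for b
    using F0 F1 by (cases b) (auto simp: zero_fun_def)
  define Q where "Q r f \<longleftrightarrow> bounded (f ` carrier G) \<and>
      (\<forall>k. f (seq_prod G x k r) = (if \<forall>i<r. k i \<ge> 0 then 1 else (0::complex)))" for r f
  have step: "Q r (left_action G (\<Gamma> r) f)" if r: "r < m" and Q: "Q (Suc r) f" for r f
  proof -
    have b: "bounded (f ` carrier G)" using Q by (simp add: Q_def)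
    have "left_action G (\<Gamma> r) f (seq_prod G x k r) = (if \<forall>i<r. k i \<ge> 0 then 1 else 0)" for k
    proof -
      have c: "seq_prod G x k r \<in> carrier G" using xc r by (intro seq_prod_closed) auto
      have eq: "f (seq_prod G x k r \<otimes> x r [^] j) = (if (\<forall>i<r. k i \<ge> 0) \<and> j \<ge> 0 then 1 else 0)" for j :: int
      proof -
        have "seq_prod G x k r \<otimes> x r [^] j = seq_prod G x (k(r := j)) (Suc r)"
          using seq_prod_cong[of r x x k "k(r := j)" G] by simp
        moreover have "f (seq_prod G x (k(r := j)) (Suc r)) = (if \<forall>i<Suc r. (k(r := j)) i \<ge> 0 then 1 else 0)"
          using Q unfolding Q_def by blast
        moreover have "(\<forall>i<Suc r. (k(r := j)) i \<ge> 0) \<longleftrightarrow> (\<forall>i<r. k i \<ge> 0) \<and> j \<ge> 0"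
          unfolding All_less_Suc by auto
        ultimately show ?thesis by (simp only:)
      qed
      have "left_action G (\<Gamma> r) f (seq_prod G x k r) = F (\<lambda>j. f (seq_prod G x k r \<otimes> x r [^] j))"
        using c \<Gamma>(2)[OF r translate_bounded[OF b c]] by (simp add: left_action_def)
      also have "\<dots> = F (\<lambda>j. if (\<forall>i<r. k i \<ge> 0) \<and> j \<ge> 0 then 1 else 0)" by (simp only: eq)
      also have "\<dots> = (if \<forall>i<r. k i \<ge> 0 then 1 else 0)"
        by (rule Fb)
      finally show ?thesis .
    qed
    then show ?thesis using left_action_bounded[OF bid[OF r] b] by (simp add: Q_def)
  qed
  \<comment> \<open>Products exist for nonempty lists only, so the induction is on the length minus
    one and grows the list to the left, against the order of action.\<close>
  have main: "arens_prod G (map \<Gamma> [r..<m]) \<in> ell1_bidual G \<and>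
      (\<forall>f. Q m f \<longrightarrow> Q r (left_action G (arens_prod G (map \<Gamma> [r..<m])) f))" if "Suc d = m - r" for d r
    using that
  proof (induction d arbitrary: r)
    case 0
    then have "m = Suc r" by simp
    then have r: "r < m" "[r..<m] = [r]" "m = Suc r" by auto
    then show ?case using bid step by (simp add: arens_prod_singleton)
  next
    case (Suc d)
    then have r: "r < m" "[r..<m] = r # [Suc r..<m]" "map \<Gamma> [Suc r..<m] \<noteq> []" "Suc d = m - Suc r"
      by (auto simp: upt_conv_Cons)
    note IH = Suc.IH[OF r(4)]
    have "arens_prod G (map \<Gamma> [r..<m]) = arens G (\<Gamma> r) (arens_prod G (map \<Gamma> [Suc r..<m]))"
      unfolding r(2) using arens_prod_Cons[OF r(3)] by simp
    then show ?case
      using IH arens_bidual[OF bid[OF r(1)]] step[OF r(1)] left_action_arens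
      by (auto simp: Q_def[of m])
  qed
  define P where "P = arens_prod G (map \<Gamma> [0..<m])"
  define f where "f z = (if \<exists>k. z = seq_prod G x k m \<and> (\<forall>i<m. k i \<ge> 0) then 1 else (0::complex))" for z
  have "Q m f"
  proof -
    have "bounded (f ` carrier G)" by (auto simp: bounded_iff f_def)
    \<comment> \<open>Independence enters here: exponents are determined by the product, so an
      element with a negative exponent has no other representation inside the orthant.\<close>
    moreover have "f (seq_prod G x k m) = (if \<forall>i<m. k i \<ge> 0 then 1 else 0)" for k
      using independent_seq_unique[OF subgroup_N commute assms(1)] unfolding f_def
        by (metis (no_types, lifting))
    ultimately show ?thesis by (simp add: Q_def)
  qed
  moreover have P: "P \<in> ell1_bidual G \<and> (\<forall>f. Q m f \<longrightarrow> Q 0 (left_action G P f))"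
    unfolding P_def by (rule main[of "m - 1"]) (use assms(2) in simp)
  ultimately have "Q 0 (left_action G P f)" by blast
  then have "at_fun G P f = 1" using left_action_one[of P f] P by (simp add: Q_def)
  then have "P \<noteq> 0" by (auto simp: at_fun_def)
  moreover have "\<exists>H. subnormal H G \<and> \<Gamma> i \<in> invariant_differences_in G H" if "i < m" for i
    using \<Gamma>(1)[OF that] sn[OF that] by blast
  ultimately show ?thesis
    by (intro exI[of _ "map \<Gamma> [0..<m]"]) (auto simp: P_def)
qed

section \<open>Nilpotence\<close>

text \<open>One condition for both algebras: it is stable under linear combinations and under left
  multiplication by the whole bidual, so checking it on invariant differences covers both
  spans.\<close>

definition raising :: "('a, 'b) monoid_scheme \<Rightarrow> 'a set \<Rightarrow> ((('a \<Rightarrow> complex) \<Rightarrow> complex) \<Rightarrow> complex) set" where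
  "raising G N = {\<theta> \<in> ell1_bidual G. \<forall>r. \<forall>f\<in>layer G N r. left_action G \<theta> f \<in> layer G N (Suc r)}"

lemma raising_subspace: "cmod.subspace (raising G N)"
proof (rule cmod.subspaceI)
  have *: "left_action G 0 f = 0" for f by (auto simp: left_action_def at_fun_def)
  show "0 \<in> raising G N"
    unfolding raising_def layer_def mem_Collect_eq * using ell1_bidual_0 cmod.span_zero by blast
next
  fix \<theta> \<eta> assume *: "\<theta> \<in> raising G N" "\<eta> \<in> raising G N"
  have eq: "left_action G (\<theta> + \<eta>) f = left_action G \<theta> f + left_action G \<eta> f" for f
    by (auto simp: left_action_def at_fun_def)
  show "\<theta> + \<eta> \<in> raising G N"
    using * unfolding raising_def layer_def mem_Collect_eq eq
    by (blast intro: ell1_bidual_add cmod.span_add)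
next
  fix c \<theta> assume *: "\<theta> \<in> raising G N"
  have eq: "left_action G (cscale c \<theta>) f = cscale c (left_action G \<theta> f)" for f
    by (auto simp: left_action_def at_fun_def cscale_apply)
  show "cscale c \<theta> \<in> raising G N"
    using * unfolding raising_def layer_def mem_Collect_eq eq
    by (blast intro: ell1_bidual_cscale cmod.span_scale)
qed

context abelian_finite_index
begin

text \<open>\<open>\<theta>\<close> acts first and raises the layer; \<open>\<Phi>\<close> then
  preserves it.\<close>

lemma arens_raising:
  assumes "\<Phi> \<in> ell1_bidual G" "\<theta> \<in> raising G N"
  shows "arens G \<Phi> \<theta> \<in> raising G N"
proof -
  have \<theta>: "\<theta> \<in> ell1_bidual G" "\<And>r f. f \<in> layer G N r \<Longrightarrow> left_action G \<theta> f \<in> layer G N (Suc r)"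
    using assms(2) by (auto simp: raising_def)
  have "left_action G (arens G \<Phi> \<theta>) f \<in> layer G N (Suc r)" if "f \<in> layer G N r" for f r
    using left_action_layer[OF assms(1) \<theta>(2)[OF that]] left_action_arens[OF \<theta>(1) layer_bounded[OF that]]
      by simp
  then show ?thesis using arens_bidual[OF assms(1) \<theta>(1)] by (simp add: raising_def)
qed

lemma raising_product:
  assumes "\<theta>s \<noteq> []" "set \<theta>s \<subseteq> raising G N"
  shows "arens_prod G \<theta>s \<in> ell1_bidual G \<and>
    (\<forall>r. \<forall>f\<in>layer G N r. left_action G (arens_prod G \<theta>s) f \<in> layer G N (r + length \<theta>s))"
  using assms
proof (induction \<theta>s)
  case (Cons \<theta> \<theta>s)
  show ?case
  proof (cases "\<theta>s = []")
    case True
    then show ?thesis using Cons by (auto simp: arens_prod_singleton raising_def)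
  next
    case False
    then have IH: "arens_prod G \<theta>s \<in> ell1_bidual G"
      "\<And>r f. f \<in> layer G N r \<Longrightarrow> left_action G (arens_prod G \<theta>s) f \<in> layer G N (r + length \<theta>s)"
      using Cons by auto
    have \<theta>: "\<theta> \<in> ell1_bidual G" "\<And>r f. f \<in> layer G N r \<Longrightarrow> left_action G \<theta> f \<in> layer G N (Suc r)"
      using Cons by (auto simp: raising_def)
    show ?thesis
      unfolding arens_prod_Cons[OF False]
      using arens_bidual[OF \<theta>(1) IH(1)] left_action_arens[OF IH(1) layer_bounded] IH(2) \<theta>(2) by simp
  qed
qed simp

text \<open>Every bounded function, cut to 0 off the carrier, lies in layer 0. After
  \<open>r\<close> raising factors it lies in an empty layer, so the action is 0, and evaluating at
  the identity gives 0.\<close>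

lemma raising_product_vanish:
  assumes "\<nexists>x. independent_seq G N x r" "length \<theta>s = r" "\<theta>s \<noteq> []" "set \<theta>s \<subseteq> raising G N"
  shows "arens_prod G \<theta>s = 0"
proof (rule bidual_eqI)
  note R = raising_product[OF assms(3,4)]
  show "arens_prod G \<theta>s \<in> ell1_bidual G" using R by blast
  fix h :: "'a \<Rightarrow> complex" assume h: "bounded (h ` carrier G)"
  let ?h = "\<lambda>x. if x \<in> carrier G then h x else 0"
  have "?h \<in> layer G N 0" by (rule layer_0) (rule restrict_bounded[OF h], simp)
  then have "left_action G (arens_prod G \<theta>s) ?h \<in> layer G N r" using R assms(2) by fastforce
  then have "left_action G (arens_prod G \<theta>s) ?h = 0" by (rule layer_empty[OF assms(1)])
  then have "at_fun G (arens_prod G \<theta>s) ?h = 0" using left_action_one R by (metis zero_fun_apply)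
  moreover have "at_fun G (arens_prod G \<theta>s) h = at_fun G (arens_prod G \<theta>s) ?h" by (rule at_fun_cong) simp
  ultimately show "at_fun G (arens_prod G \<theta>s) h = at_fun G 0 h" by (simp add: at_fun_def)
qed (rule ell1_bidual_0)

context
  fixes A
  assumes A: "finite A" "A \<subseteq> carrier G" "generate G A = N"
begin

lemma invariant_difference_raising:
  assumes "subnormal H G" "\<Gamma> \<in> invariant_differences_in G H"
  shows "\<Gamma> \<in> raising G N"
proof -
  note H = subnormal_subgroup[OF is_group assms(1)]
  have "left_action G \<Gamma> f \<in> layer G N (Suc r)" if "f \<in> layer G N r" for f r
    by (rule left_action_invariant_difference[OF finite_cosets_of_torsion[OF A(1,3,2)] H assms(2) that])
  then show ?thesis
    using invariant_difference_in_props(1)[OF H assms(2)] by (simp add: raising_def)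
qed

lemma A_sn_raising: "A_sn G \<subseteq> raising G N"
  unfolding A_sn_def
proof (rule cmod.span_minimal[OF _ raising_subspace], clarify)
  fix \<Gamma>s assume "\<Gamma>s \<noteq> []" "\<forall>\<Gamma>\<in>set \<Gamma>s. \<exists>H. subnormal H G \<and> \<Gamma> \<in> invariant_differences_in G H"
  then show "arens_prod G \<Gamma>s \<in> raising G N"
  proof (induction \<Gamma>s)
    case (Cons \<Gamma> \<Gamma>s)
    then have \<Gamma>: "\<Gamma> \<in> raising G N" using invariant_difference_raising by auto
    show ?case
    proof (cases "\<Gamma>s = []")
      case True
      then show ?thesis using \<Gamma> by (simp add: arens_prod_singleton)
    next
      case False
      then show ?thesis
        using Cons \<Gamma> arens_raising[of \<Gamma> "arens_prod G \<Gamma>s"] by (simp add: arens_prod_Cons raising_def)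
    qed
  qed simp
qed

lemma J_sn_raising: "J_sn G \<subseteq> raising G N"
  unfolding J_sn_def
  by (rule cmod.span_minimal[OF _ raising_subspace]) (auto intro: arens_raising invariant_difference_raising)

end

lemma invariant_difference_in_A_sn:
  assumes "subnormal H G" "\<Gamma> \<in> invariant_differences_in G H"
  shows "\<Gamma> \<in> A_sn G"
  unfolding A_sn_def
  by (rule cmod.span_base) (use assms in \<open>auto simp: arens_prod_singleton intro!: exI[of _ "[\<Gamma>]"]\<close>)

lemma invariant_difference_in_J_sn:
  assumes "subnormal H G" "\<Gamma> \<in> invariant_differences_in G H"
  shows "\<Gamma> \<in> J_sn G"
proof -
  have "\<Gamma> = arens G (canonical G (point_mass \<one>)) \<Gamma>"
    using arens_canonical_one[OF invariant_difference_in_props(1)[OF subnormal_subgroup[OF is_group assms(1)] assms(2)]] by simp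
  then show ?thesis
    unfolding J_sn_def using assms canonical_bidual(1)[OF one_closed] by (intro cmod.span_base) blast
qed

text \<open>Minimality requires a nonzero product of every length m \<le> n, not just of length n;
  prefixes of the independent sequence supply one for each m.\<close>

lemma nilpotence_index_eqI:
  assumes "A \<subseteq> raising G N" "\<And>H \<Gamma>. subnormal H G \<Longrightarrow> \<Gamma> \<in> invariant_differences_in G H \<Longrightarrow> \<Gamma> \<in> A"
    "\<exists>x. independent_seq G N x n" "\<nexists>x. independent_seq G N x (Suc n)"
  shows "arens_nilpotent G A \<and> nilpotence_index G A = n + 1"
proof -
  have v: "products_vanish G A (n + 1)"
    unfolding products_vanish_def
  proof (intro allI impI)
    fix \<Gamma>s assume "length \<Gamma>s = n + 1 \<and> set \<Gamma>s \<subseteq> A"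
    then show "arens_prod G \<Gamma>s = 0"
      using assms(1) by (intro raising_product_vanish[OF assms(4)]) auto
  qed
  have "n + 1 \<le> m" if m: "m \<ge> 1 \<and> products_vanish G A m" for m
  proof (rule ccontr)
    assume "\<not> n + 1 \<le> m"
    then have "m \<le> n" by simp
    then obtain x where "independent_seq G N x m"
      using assms(3) independent_seq_prefix[OF _ _ subgroup.subset[OF subgroup_N]] by blast
    then obtain \<Gamma>s where "length \<Gamma>s = m" "arens_prod G \<Gamma>s \<noteq> 0"
      "\<forall>\<Gamma>\<in>set \<Gamma>s. \<exists>H. subnormal H G \<and> \<Gamma> \<in> invariant_differences_in G H"
      using nonvanishing_product m by blast
    then show False using m assms(2) unfolding products_vanish_def by blast
  qed
  then have "nilpotence_index G A = n + 1"
    unfolding nilpotence_index_def using v by (intro Least_equality) auto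
  then show ?thesis using v by (auto simp: arens_nilpotent_def)
qed

end

theorem theorem4p3:
  fixes G :: "('a, 'b) monoid_scheme" and n :: nat
  assumes "group G"
    and "finitely_generated_group G"
    and "virtually_abelian G"
    and "virtually_abelian_rank G n"
  shows "(arens_nilpotent G (A_sn G) \<and> nilpotence_index G (A_sn G) = n + 1) \<and>
         (arens_nilpotent G (J_sn G) \<and> nilpotence_index G (J_sn G) = n + 1)"
proof -
  obtain N A where N: "abelian_finite_index G N" and A: "finite A" "A \<subseteq> carrier G" "generate G A = N"
    and ind: "\<exists>x. independent_seq G N x n" "\<nexists>x. independent_seq G N x (Suc n)"
    using group.abelian_core[OF assms(1,2,4)] by blast
  interpret abelian_finite_index G N by (rule N)
  show ?thesis
  proof
    show "arens_nilpotent G (A_sn G) \<and> nilpotence_index G (A_sn G) = n + 1"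
      by (rule nilpotence_index_eqI[OF A_sn_raising[OF A] _ ind]) (rule invariant_difference_in_A_sn)
    show "arens_nilpotent G (J_sn G) \<and> nilpotence_index G (J_sn G) = n + 1"
      by (rule nilpotence_index_eqI[OF J_sn_raising[OF A] _ ind]) (rule invariant_difference_in_J_sn)
  qed
qed

end
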